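(* Let $(M,H,J,P)$ be a standard form and $p\in M$ a projection, and set $q:=pJpJ$. If $M$ has the Haagerup approximation property, then so does $qMq$ (a von Neumann algebra on $qH$). In particular, $pMp$ also has the Haagerup approximation property.
   Context: Standard form: a quadruple $(M,H,J,P)$ where $M$ is a von Neumann algebra acting on a Hilbert space $H$, $J$ is a conjugate-linear isometry of $H$ with $J^2=1_H$, and $P\subset H$ is a closed convex cone which is self-dual, i.e. $P=\{\xi\in H\mid \langle\xi,\eta\rangle\ge 0 \text{ for all }\eta\in P\}$, such that (i) $JMJ=M'$; (ii) $J\xi=\xi$ for $\xi\in P$; (iii) $xJxJP\subset P$ for $x\in M$; (iv) $JcJ=c^*$ for $c\in M\cap M'$. Every von Neumann algebra is isomorphic to one in standard form, and standard forms are unique up to unitary equivalence. Completely positive operators: for $n\ge1$ let $P^{(n)}$ be the set of matrices $[\xi_{i,j}]\in \mathbb{M}_n(H)=H\otimes\mathbb{M}_n(\mathbb{C})$ with $\sum_{i,j=1}^n x_iJx_jJ\xi_{i,j}\in P$ for all $x_1,\dots,x_n\in M$. A bounded linear operator $T$ on $H$ is completely positive (c.p.) if $[T\xi_{i,j}]\in P^{(n)}$ for all $[\xi_{i,j}]\in P^{(n)}$ and all $n\ge 1$; it is c.c.p. if moreover $\|T\|\le1$. Haagerup approximation property (HAP): a von Neumann algebra (regarded as a W$^*$-algebra) $M$ has the HAP if there exist a standard form $(M,H,J,P)$ of $M$ and a net of c.c.p. compact operators $T_n$ on $H$ with $T_n\to 1_H$ in the strong operator topology. *)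

theory Defs
  imports "HOL-Analysis.Analysis"
begin

text \<open>
  Complex Hilbert spaces. The norm and the topology are those of the underlying real Hilbert space,
  whose inner product is the real part of the complex one. The inner product is linear in its
  first argument.
\<close>

class complex_hilbert_space = real_inner + complete_space +
  fixes scaleC :: "complex \<Rightarrow> 'a \<Rightarrow> 'a"  (infixr "*\<^sub>C" 75)
    and cinner :: "'a \<Rightarrow> 'a \<Rightarrow> complex"
  assumes scaleC_add_right: "c *\<^sub>C (x + y) = c *\<^sub>C x + c *\<^sub>C y"
    and scaleC_add_left: "(c + d) *\<^sub>C x = c *\<^sub>C x + d *\<^sub>C x"
    and scaleC_scaleC: "c *\<^sub>C (d *\<^sub>C x) = (c * d) *\<^sub>C x"
    and scaleC_of_real: "complex_of_real r *\<^sub>C x = r *\<^sub>R x"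
    and cinner_add_left: "cinner (x + y) z = cinner x z + cinner y z"
    and cinner_scaleC_left: "cinner (c *\<^sub>C x) y = c * cinner x y"
    and cinner_commute: "cinner x y = cnj (cinner y x)"
    and Re_cinner: "Re (cinner x y) = x \<bullet> y"

instantiation complex :: complex_hilbert_space
begin

definition scaleC_complex :: "complex \<Rightarrow> complex \<Rightarrow> complex" where
  "scaleC_complex c x = c * x"

definition cinner_complex :: "complex \<Rightarrow> complex \<Rightarrow> complex" where
  "cinner_complex x y = x * cnj y"

instance
  by standard
    (auto simp: scaleC_complex_def cinner_complex_def inner_complex_def algebra_simps scaleR_conv_of_real)

end

text \<open>
  A Hilbert space is a closed complex subspace \<open>H\<close> of a type of this class (\<open>UNIV\<close> included).
\<close>

definition closed_csubspace :: "'a::complex_hilbert_space set \<Rightarrow> bool" where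
  "closed_csubspace H \<longleftrightarrow> subspace H \<and> closed H \<and> (\<forall>c. \<forall>x\<in>H. c *\<^sub>C x \<in> H)"

definition orth :: "'a::complex_hilbert_space set \<Rightarrow> 'a set" where
  "orth H = {x. \<forall>h\<in>H. cinner x h = 0}"

text \<open>
  An operator on \<open>H\<close> is represented by its extension by \<open>0\<close> on the orthogonal complement of \<open>H\<close>,
  so that \<open>B(H)\<close> is a corner of the bounded operators on the whole type. Thus equality of operators on
  \<open>H\<close> is equality of functions, composition and sum are the pointwise ones, the identity of \<open>H\<close>
  is the orthogonal projection onto \<open>H\<close>, and for a projection \<open>q\<close> the compression
  \<open>{q \<circ> x \<circ> q | x \<in> M}\<close> is literally a set of operators on \<open>q ` H\<close>.
\<close>

definition bounded_ops :: "'a::complex_hilbert_space set \<Rightarrow> ('a \<Rightarrow> 'a) set" where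
  "bounded_ops H = {T. bounded_linear T \<and> (\<forall>c x. T (c *\<^sub>C x) = c *\<^sub>C T x) \<and>
     range T \<subseteq> H \<and> (\<forall>x\<in>orth H. T x = 0)}"

definition cadjoint :: "('a::complex_hilbert_space \<Rightarrow> 'a) \<Rightarrow> 'a \<Rightarrow> 'a" where
  "cadjoint T = (THE S. \<forall>x y. cinner (T x) y = cinner x (S y))"

definition commutant :: "'a::complex_hilbert_space set \<Rightarrow> ('a \<Rightarrow> 'a) set \<Rightarrow> ('a \<Rightarrow> 'a) set" where
  "commutant H M = {y \<in> bounded_ops H. \<forall>x\<in>M. x \<circ> y = y \<circ> x}"

definition von_neumann_algebra :: "'a::complex_hilbert_space set \<Rightarrow> ('a \<Rightarrow> 'a) set \<Rightarrow> bool" where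
  "von_neumann_algebra H M \<longleftrightarrow>
     closed_csubspace H \<and> M \<subseteq> bounded_ops H \<and> (\<forall>x\<in>M. cadjoint x \<in> M) \<and>
     commutant H (commutant H M) = M"

definition projection_in :: "('a::complex_hilbert_space \<Rightarrow> 'a) set \<Rightarrow> ('a \<Rightarrow> 'a) \<Rightarrow> bool" where
  "projection_in M p \<longleftrightarrow> p \<in> M \<and> p \<circ> p = p \<and> cadjoint p = p"

text \<open>For von Neumann algebras, *-isomorphisms are automatically isometric and normal.\<close>

definition star_isomorphism ::
    "('a::complex_hilbert_space \<Rightarrow> 'a) set \<Rightarrow> ('b::complex_hilbert_space \<Rightarrow> 'b) set \<Rightarrow>
     (('a \<Rightarrow> 'a) \<Rightarrow> ('b \<Rightarrow> 'b)) \<Rightarrow> bool" where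
  "star_isomorphism M N \<theta> \<longleftrightarrow> bij_betw \<theta> M N \<and>
     (\<forall>x\<in>M. \<forall>y\<in>M. \<theta> (\<lambda>v. x v + y v) = (\<lambda>v. \<theta> x v + \<theta> y v)) \<and>
     (\<forall>c. \<forall>x\<in>M. \<theta> (\<lambda>v. c *\<^sub>C x v) = (\<lambda>v. c *\<^sub>C \<theta> x v)) \<and>
     (\<forall>x\<in>M. \<forall>y\<in>M. \<theta> (x \<circ> y) = \<theta> x \<circ> \<theta> y) \<and>
     (\<forall>x\<in>M. \<theta> (cadjoint x) = cadjoint (\<theta> x))"

definition conjugation_on :: "'a::complex_hilbert_space set \<Rightarrow> ('a \<Rightarrow> 'a) \<Rightarrow> bool" where
  "conjugation_on H J \<longleftrightarrow>
     (\<forall>x y. J (x + y) = J x + J y) \<and> (\<forall>c x. J (c *\<^sub>C x) = cnj c *\<^sub>C J x) \<and>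
     range J \<subseteq> H \<and> (\<forall>x\<in>orth H. J x = 0) \<and>
     (\<forall>x\<in>H. norm (J x) = norm x) \<and> (\<forall>x\<in>H. J (J x) = x)"

definition self_dual_cone :: "'a::complex_hilbert_space set \<Rightarrow> 'a set \<Rightarrow> bool" where
  "self_dual_cone H P \<longleftrightarrow>
     closed P \<and> convex P \<and> cone P \<and> P = {\<xi>\<in>H. \<forall>\<eta>\<in>P. cinner \<xi> \<eta> \<in> \<real>\<^sub>\<ge>\<^sub>0}"

definition standard_form ::
    "('a::complex_hilbert_space \<Rightarrow> 'a) set \<Rightarrow> 'a set \<Rightarrow> ('a \<Rightarrow> 'a) \<Rightarrow> 'a set \<Rightarrow> bool" where
  "standard_form M H J P \<longleftrightarrow>
     von_neumann_algebra H M \<and> conjugation_on H J \<and> self_dual_cone H P \<and>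
     {J \<circ> x \<circ> J |x. x \<in> M} = commutant H M \<and>
     (\<forall>\<xi>\<in>P. J \<xi> = \<xi>) \<and>
     (\<forall>x\<in>M. \<forall>\<xi>\<in>P. x (J (x (J \<xi>))) \<in> P) \<and>
     (\<forall>c\<in>M \<inter> commutant H M. J \<circ> c \<circ> J = cadjoint c)"

text \<open>The cone \<open>P\<^sup>(\<^sup>n\<^sup>)\<close>; only the entries with indices below \<open>n\<close> matter.\<close>

definition matrix_cone ::
    "('a::complex_hilbert_space \<Rightarrow> 'a) set \<Rightarrow> 'a set \<Rightarrow> ('a \<Rightarrow> 'a) \<Rightarrow> 'a set \<Rightarrow> nat \<Rightarrow>
     (nat \<Rightarrow> nat \<Rightarrow> 'a) set" where
  "matrix_cone M H J P n = {\<xi>. (\<forall>i<n. \<forall>j<n. \<xi> i j \<in> H) \<and>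
     (\<forall>x. (\<forall>i<n. x i \<in> M) \<longrightarrow> (\<Sum>i<n. \<Sum>j<n. x i (J (x j (J (\<xi> i j))))) \<in> P)}"

definition cp_operator ::
    "('a::complex_hilbert_space \<Rightarrow> 'a) set \<Rightarrow> 'a set \<Rightarrow> ('a \<Rightarrow> 'a) \<Rightarrow> 'a set \<Rightarrow> ('a \<Rightarrow> 'a) \<Rightarrow> bool" where
  "cp_operator M H J P T \<longleftrightarrow> T \<in> bounded_ops H \<and>
     (\<forall>n\<ge>1. \<forall>\<xi>\<in>matrix_cone M H J P n. (\<lambda>i j. T (\<xi> i j)) \<in> matrix_cone M H J P n)"

definition ccp_operator ::
    "('a::complex_hilbert_space \<Rightarrow> 'a) set \<Rightarrow> 'a set \<Rightarrow> ('a \<Rightarrow> 'a) \<Rightarrow> 'a set \<Rightarrow> ('a \<Rightarrow> 'a) \<Rightarrow> bool" where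
  "ccp_operator M H J P T \<longleftrightarrow> cp_operator M H J P T \<and> onorm T \<le> 1"

definition compact_operator :: "'a::complex_hilbert_space set \<Rightarrow> ('a \<Rightarrow> 'a) \<Rightarrow> bool" where
  "compact_operator H T \<longleftrightarrow> T \<in> bounded_ops H \<and> compact (closure (T ` (H \<inter> cball 0 1)))"

text \<open>
  A standard form of \<open>M\<close> is a standard form \<open>(N, H, J, P)\<close> with \<open>N\<close> *-isomorphic to \<open>M\<close>.
  A formula cannot quantify over the type that hosts the Hilbert space \<open>H\<close>, so this type is a
  parameter. A net of operators is given, as usual in the library, by a proper filter \<open>F\<close> on operators;
  for a net indexed by a directed set this is the filter generated by its tails, and every
  proper filter arises in this way.
\<close>

definition has_HAP ::
    "'b::complex_hilbert_space itself \<Rightarrow> ('a::complex_hilbert_space \<Rightarrow> 'a) set \<Rightarrow> bool" where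
  "has_HAP TYPE('b) M \<longleftrightarrow>
     (\<exists>(N :: ('b \<Rightarrow> 'b) set) H J P \<theta>. standard_form N H J P \<and> star_isomorphism M N \<theta> \<and>
       (\<exists>F :: ('b \<Rightarrow> 'b) filter. F \<noteq> bot \<and>
         (\<forall>\<^sub>F T in F. ccp_operator N H J P T \<and> compact_operator H T) \<and>
         (\<forall>\<xi>\<in>H. ((\<lambda>T. T \<xi>) \<longlongrightarrow> \<xi>) F)))"

definition compression :: "('a \<Rightarrow> 'a) \<Rightarrow> ('a \<Rightarrow> 'a) set \<Rightarrow> ('a \<Rightarrow> 'a) set" where
  "compression q M = {q \<circ> x \<circ> q |x. x \<in> M}"

end

theory Submission
  imports Defs
begin

text \<open>
  Let \<open>(N, K, J, P)\<close> be the standard form that carries the operators \<open>T\<^sub>i\<close>, \<open>p \<in> N\<close> the projection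
  that corresponds to the given one, and \<open>q = pJpJ\<close>. Then \<open>(qNq, qK, qJ, qP)\<close> is a standard form,
  \<open>pNp\<close> and \<open>qNq\<close> are isomorphic through \<open>x \<mapsto> xq\<close>, and the compressions \<open>qT\<^sub>iq\<close> are contractive, compact and
  converge strongly to \<open>q\<close>. The point is their complete positivity: a matrix in the cone \<open>P\<^sup>(\<^sup>n\<^sup>)\<close> of the
  corner has to lie in the cone \<open>P\<^sup>(\<^sup>n\<^sup>)\<close> of \<open>N\<close>. This follows from the fact that, for the corner, \<open>P\<^sup>(\<^sup>n\<^sup>)\<close>
  is contained in every closed convex cone of hermitian matrices that contains the matrices \<open>[x\<^sub>iJx\<^sub>jJ\<eta>]\<close>
  and is invariant under \<open>\<xi> \<mapsto> XJXJ\<xi>\<close>.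
\<close>

section \<open>Closest points and orthogonal projections\<close>

text \<open>The net lives on a standard form that need not be the given one, possibly on another
  type. No unitary equivalence of standard forms is invoked: only algebras are compared, through the
  chain of star-isomorphisms from \<open>qMq\<close> to \<open>pMp\<close>, to the corresponding
  corner \<open>\<theta>(p)N\<theta>(p)\<close>, and to \<open>q'Nq'\<close>. The obstacle to
  complete positivity is that the matrix cone of a corner is tested only by rows with entries in
  that corner, while an operator \<open>T\<close> of the net is known to preserve only matrices that
  pass the test for all rows over the large algebra. The inclusion is therefore proved from the
  other side, by minimality of the cone of the corner. Elements of \<open>qNq\<close> need not lie
  in \<open>N\<close>, so generators and conjugations of the corner are rewritten with lifts in
  \<open>pNp\<close>. Minimality itself uses no modular theory: a nearest point, a first-order
  perturbation, and a projection with matrix entries in the bicommutant separate a matrix from its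
  nearest point.\<close>

lemma closest_point_family:
  fixes C :: "('i \<Rightarrow> 'v::{real_inner,complete_space}) set" and a :: "'i \<Rightarrow> 'v"
  assumes fin: "finite I" and ne: "C \<noteq> {}"
    and mid: "\<And>u v. u \<in> C \<Longrightarrow> v \<in> C \<Longrightarrow> (\<lambda>i. (1/2) *\<^sub>R (u i + v i)) \<in> C"
    and cl: "\<And>f l. (\<And>k. f k \<in> C) \<Longrightarrow> (\<And>i. i \<in> I \<Longrightarrow> (\<lambda>k. f k i) \<longlonglongrightarrow> l i) \<Longrightarrow> l \<in> C"
  obtains u where "u \<in> C" "\<And>v. v \<in> C \<Longrightarrow> (\<Sum>i\<in>I. (norm (u i - a i))\<^sup>2) \<le> (\<Sum>i\<in>I. (norm (v i - a i))\<^sup>2)"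
proof -
  define N where "N u = (\<Sum>i\<in>I. (norm (u i - a i))\<^sup>2)" for u
  define d where "d = Inf (N ` C)"
  have N0: "N u \<ge> 0" for u unfolding N_def by (simp add: sum_nonneg)
  have bdd: "bdd_below (N ` C)" using N0 by (intro bdd_belowI[of _ 0]) auto
  have dle: "d \<le> N u" if "u \<in> C" for u unfolding d_def using that bdd by (intro cInf_lower) auto
  have "\<exists>u\<in>C. N u < d + 1 / real (Suc k)" for k
  proof -
    have "Inf (N ` C) < d + 1 / real (Suc k)" unfolding d_def by simp
    then show ?thesis using cInf_less_iff[of "N ` C"] ne bdd by auto
  qed
  then obtain f where fC: "\<And>k. f k \<in> C" and fN: "\<And>k. N (f k) < d + 1 / real (Suc k)" by metis
  \<comment> \<open>Parallelogram law: the midpoint belongs to \<open>C\<close> and hence costs at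
    least \<open>d\<close>. Two nearly optimal families are therefore close in every coordinate of
    \<open>I\<close>.\<close>
  have par: "(norm (f k i - f l i))\<^sup>2 \<le> 2 * (1 / real (Suc k) + 1 / real (Suc l))" if i: "i \<in> I" for i k l
  proof -
    let ?m = "\<lambda>i. (1/2) *\<^sub>R (f k i + f l i)"
    have e: "(norm (u - v))\<^sup>2 = 2 * (norm (u - w))\<^sup>2 + 2 * (norm (v - w))\<^sup>2 - 4 * (norm ((1/2) *\<^sub>R (u + v) - w))\<^sup>2"
      for u v w :: 'v
      by (simp add: power2_norm_eq_inner inner_simps inner_commute algebra_simps)
    have "(norm (f k i - f l i))\<^sup>2 \<le> (\<Sum>i\<in>I. (norm (f k i - f l i))\<^sup>2)"
      using fin i by (intro member_le_sum) auto
    also have "\<dots> = 2 * N (f k) + 2 * N (f l) - 4 * N ?m"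
      unfolding N_def sum_distrib_left sum.distrib[symmetric] sum_subtractf[symmetric]
      by (intro sum.cong refl e)
    also have "\<dots> \<le> 2 * N (f k) + 2 * N (f l) - 4 * d" using dle[OF mid[OF fC[of k] fC[of l]]] by simp
    also have "\<dots> \<le> 2 * (1 / real (Suc k) + 1 / real (Suc l))" using fN[of k] fN[of l] by (simp add: algebra_simps)
    finally show ?thesis .
  qed
  have "Cauchy (\<lambda>k. f k i)" if i: "i \<in> I" for i
  proof (rule CauchyI)
    fix e :: real assume e: "0 < e"
    then obtain M where M: "1 / real (Suc M) < e\<^sup>2 / 4" using nat_approx_posE[of "e\<^sup>2/4"] by auto
    have "norm (f k i - f l i) < e" if "k \<ge> M" "l \<ge> M" for k l
    proof -
      have le: "1 / real (Suc k) \<le> 1 / real (Suc M)" "1 / real (Suc l) \<le> 1 / real (Suc M)"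
        using that by (auto simp: frac_le)
      note par[OF i, of k l]
      also have "2 * (1 / real (Suc k) + 1 / real (Suc l)) \<le> 2 * (1 / real (Suc M) + 1 / real (Suc M))"
        by (intro mult_left_mono add_mono) (use le in auto)
      also have "\<dots> = 4 * (1 / real (Suc M))" by simp
      also have "\<dots> < 4 * (e\<^sup>2 / 4)" using M by (intro mult_strict_left_mono) auto
      finally have "(norm (f k i - f l i))\<^sup>2 < e\<^sup>2" by simp
      then show ?thesis using e by (meson less_imp_le power2_less_imp_less)
    qed
    then show "\<exists>M. \<forall>m\<ge>M. \<forall>n\<ge>M. norm (f m i - f n i) < e" by blast
  qed
  then have "\<forall>i\<in>I. \<exists>x. (\<lambda>k. f k i) \<longlonglongrightarrow> x"
    by (simp add: Cauchy_convergent_iff convergent_def)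
  from bchoice[OF this] obtain l where l: "\<And>i. i \<in> I \<Longrightarrow> (\<lambda>k. f k i) \<longlonglongrightarrow> l i" by blast
  have lC: "l \<in> C" using cl[OF fC l] .
  have "(\<lambda>k. N (f k)) \<longlonglongrightarrow> N l" unfolding N_def by (intro tendsto_intros l)
  moreover have "(\<lambda>k. d + 1 / real (Suc k)) \<longlonglongrightarrow> d + 0"
    by (intro tendsto_add tendsto_const) (use LIMSEQ_inverse_real_of_nat in \<open>simp add: inverse_eq_divide\<close>)
  ultimately have "N l \<le> d + 0" using fN by (intro LIMSEQ_le) (auto intro: less_imp_le)
  then show ?thesis using that[OF lC] dle unfolding N_def by fastforce
qed

text \<open>Near \<open>t = 0\<close> the linear term dominates. With \<open>c\<close> replaced by a
  positive upper bound \<open>s\<close>, the minimiser of the quadratic gives a negative value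
  unless \<open>b = 0\<close>.\<close>

lemma nonneg_quadratic_imp_zero:
  fixes b c :: real
  assumes "\<And>t. t * b + t\<^sup>2 * c \<ge> 0"
  shows "b = 0"
proof (rule ccontr)
  assume b: "b \<noteq> 0"
  define s where "s = \<bar>c\<bar> + 1"
  have s: "s > 0" "c \<le> s" unfolding s_def by auto
  define t where "t = - b / (2 * s)"
  have "t * b + t\<^sup>2 * c \<le> t * b + t\<^sup>2 * s" using s by (intro add_left_mono mult_left_mono) auto
  also have "\<dots> = - (b\<^sup>2 / (4 * s))" unfolding t_def power2_eq_square using s by (simp add: field_simps)
  also have "\<dots> < 0" using b s by simp
  finally show False using assms[of t] by simp
qed

text \<open>A family indexed by \<open>I\<close> plays the role of a vector in a finite direct sum.
  Later it is a column or a matrix whose entries outside \<open>I\<close> are arbitrary; hence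
  \<open>cl\<close> puts \<open>l\<close> into \<open>C\<close> as soon as its entries in
  \<open>I\<close> are limits. The conclusions come from moving the nearest point to
  \<open>u + t c\<close> and along the ray through \<open>u\<close>.\<close>

lemma closest_point_cone_family:
  fixes C :: "('i \<Rightarrow> 'v::{real_inner,complete_space}) set" and a :: "'i \<Rightarrow> 'v"
  assumes fin: "finite I" and z: "(\<lambda>i. 0) \<in> C"
    and add: "\<And>u v. u \<in> C \<Longrightarrow> v \<in> C \<Longrightarrow> (\<lambda>i. u i + v i) \<in> C"
    and scale: "\<And>t u. 0 \<le> t \<Longrightarrow> u \<in> C \<Longrightarrow> (\<lambda>i. t *\<^sub>R u i) \<in> C"
    and cl: "\<And>f l. (\<And>k. f k \<in> C) \<Longrightarrow> (\<And>i. i \<in> I \<Longrightarrow> (\<lambda>k. f k i) \<longlonglongrightarrow> l i) \<Longrightarrow> l \<in> C"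
  obtains u where "u \<in> C" "\<And>c. c \<in> C \<Longrightarrow> (\<Sum>i\<in>I. (u i - a i) \<bullet> c i) \<ge> 0"
    "(\<Sum>i\<in>I. (u i - a i) \<bullet> u i) = 0"
proof -
  obtain u where u: "u \<in> C"
    "\<And>v. v \<in> C \<Longrightarrow> (\<Sum>i\<in>I. (norm (u i - a i))\<^sup>2) \<le> (\<Sum>i\<in>I. (norm (v i - a i))\<^sup>2)"
  proof (rule closest_point_family[OF fin, of C a])
    show "C \<noteq> {}" using z by blast
    show "(\<lambda>i. (1/2) *\<^sub>R (u i + v i)) \<in> C" if "u \<in> C" "v \<in> C" for u v
      using scale[of "1/2", OF _ add[OF that]] by simp
  next
    show "l \<in> C" if "\<And>k. f k \<in> C" "\<And>i. i \<in> I \<Longrightarrow> (\<lambda>k. f k i) \<longlonglongrightarrow> l i" for f l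
      using that by (rule cl)
    fix u assume "u \<in> C"
      "\<And>v. v \<in> C \<Longrightarrow> (\<Sum>i\<in>I. (norm (u i - a i))\<^sup>2) \<le> (\<Sum>i\<in>I. (norm (v i - a i))\<^sup>2)"
    then show thesis by (rule that)
  qed
  have e: "(norm (x + t *\<^sub>R y - z))\<^sup>2 = (norm (x - z))\<^sup>2 + (t * (2 * ((x - z) \<bullet> y)) + t\<^sup>2 * (norm y)\<^sup>2)"
    for x y z :: 'v and t :: real
  proof -
    have "x + t *\<^sub>R y - z = (x - z) + t *\<^sub>R y" by simp
    then show ?thesis
      unfolding power2_norm_eq_inner
      by (simp only: inner_add_left inner_add_right inner_commute[of y "x - z"] inner_scaleR_left inner_scaleR_right)
        (simp add: algebra_simps power2_eq_square)
  qed
  have ex: "(\<Sum>i\<in>I. (norm (u i + t *\<^sub>R c i - a i))\<^sup>2) =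
      (\<Sum>i\<in>I. (norm (u i - a i))\<^sup>2) + (t * (2 * (\<Sum>i\<in>I. (u i - a i) \<bullet> c i)) + t\<^sup>2 * (\<Sum>i\<in>I. (norm (c i))\<^sup>2))" for t c
    unfolding sum_distrib_left sum.distrib[symmetric] e ..
  have aux: "b / (s + 1) * s \<le> b" if "b > 0" "s \<ge> 0" for b s :: real
    using that by (simp add: field_simps)
  have ge: "t * (2 * (\<Sum>i\<in>I. (u i - a i) \<bullet> c i)) + t\<^sup>2 * (\<Sum>i\<in>I. (norm (c i))\<^sup>2) \<ge> 0"
    if "(\<lambda>i. u i + t *\<^sub>R c i) \<in> C" for t c
    using u(2)[OF that] ex[of t c] by simp
  have 1: "(\<Sum>i\<in>I. (u i - a i) \<bullet> c i) \<ge> 0" if c: "c \<in> C" for c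
  proof (rule ccontr)
    assume n: "\<not> ?thesis"
    define b where "b = - (\<Sum>i\<in>I. (u i - a i) \<bullet> c i)"
    define s where "s = (\<Sum>i\<in>I. (norm (c i))\<^sup>2)"
    have b: "b > 0" using n unfolding b_def by simp
    have s: "s \<ge> 0" unfolding s_def by (simp add: sum_nonneg)
    \<comment> \<open>With this \<open>t\<close> the quadratic term is at most half of the linear
      one; the \<open>+ 1\<close> covers \<open>s = 0\<close>.\<close>
    define t where "t = b / (s + 1)"
    have t: "t > 0" unfolding t_def using b s by simp
    have "0 \<le> t * (2 * - b) + t\<^sup>2 * s"
      using ge[of t c] add[OF u(1) scale[OF less_imp_le[OF t] c]] unfolding b_def s_def by simp
    also have "\<dots> = t * (t * s - 2 * b)" by (simp add: algebra_simps power2_eq_square)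
    also have "\<dots> < 0"
    proof (rule mult_pos_neg[OF t])
      have "t * s < 2 * b"
        using aux[OF b s] b unfolding t_def by linarith
      then show "t * s - 2 * b < 0" by simp
    qed
    finally show False by simp
  qed
  have 2: "(\<Sum>i\<in>I. (u i - a i) \<bullet> u i) \<le> 0"
  proof (rule ccontr)
    assume n: "\<not> ?thesis"
    define b where "b = (\<Sum>i\<in>I. (u i - a i) \<bullet> u i)"
    define s where "s = (\<Sum>i\<in>I. (norm (u i))\<^sup>2)"
    have b: "b > 0" using n unfolding b_def by simp
    have s: "s \<ge> 0" unfolding s_def by (simp add: sum_nonneg)
    \<comment> \<open>The bound by \<open>1\<close> keeps \<open>(1 - t) u\<close> inside the
      cone.\<close>
    define t where "t = min 1 (b / (s + 1))"
    have t: "t > 0" "t \<le> 1" "t \<le> b / (s+1)" unfolding t_def using b s by auto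
    have e: "u i + (- t) *\<^sub>R u i = (1 - t) *\<^sub>R u i" for i by (simp add: algebra_simps)
    have "0 \<le> (-t) * (2 * b) + (-t)\<^sup>2 * s"
      using ge[of "-t" u] unfolding e b_def s_def using scale[of "1 - t" u] t u(1) by simp
    also have "\<dots> = t * (t * s - 2 * b)" by (simp add: algebra_simps power2_eq_square)
    also have "\<dots> < 0"
    proof (rule mult_pos_neg[OF t(1)])
      have "t * s \<le> b / (s+1) * s" using t s by (intro mult_right_mono) auto
      also have "\<dots> < 2 * b"
        using aux[OF b s] b by linarith
      finally show "t * s - 2 * b < 0" by simp
    qed
    finally show False by simp
  qed
  show ?thesis
  proof (rule that[OF u(1) 1])
    show "(\<Sum>i\<in>I. (u i - a i) \<bullet> u i) = 0" using 1[OF u(1)] 2 by (rule antisym[rotated])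
  qed
qed

text \<open>In a subspace both \<open>c\<close> and \<open>- c\<close> are admissible, so the
  inequality for cones becomes orthogonality.\<close>

lemma closest_point_subspace_family:
  fixes C :: "('i \<Rightarrow> 'v::{real_inner,complete_space}) set" and a :: "'i \<Rightarrow> 'v"
  assumes fin: "finite I" and z: "(\<lambda>i. 0) \<in> C"
    and add: "\<And>u v. u \<in> C \<Longrightarrow> v \<in> C \<Longrightarrow> (\<lambda>i. u i + v i) \<in> C"
    and scale: "\<And>t u. u \<in> C \<Longrightarrow> (\<lambda>i. t *\<^sub>R u i) \<in> C"
    and cl: "\<And>f l. (\<And>k. f k \<in> C) \<Longrightarrow> (\<And>i. i \<in> I \<Longrightarrow> (\<lambda>k. f k i) \<longlonglongrightarrow> l i) \<Longrightarrow> l \<in> C"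
  obtains u where "u \<in> C" "\<And>c. c \<in> C \<Longrightarrow> (\<Sum>i\<in>I. (a i - u i) \<bullet> c i) = 0"
proof -
  have "\<exists>u\<in>C. \<forall>c\<in>C. (\<Sum>i\<in>I. (u i - a i) \<bullet> c i) \<ge> 0"
  proof (rule closest_point_cone_family[of I C a])
    show "l \<in> C" if "\<And>k. f k \<in> C" "\<And>i. i \<in> I \<Longrightarrow> (\<lambda>k. f k i) \<longlonglongrightarrow> l i" for f l
      using that by (rule cl)
    show "(\<lambda>i. u i + v i) \<in> C" if "u \<in> C" "v \<in> C" for u v using that by (rule add)
    show "(\<lambda>i. t *\<^sub>R u i) \<in> C" if "u \<in> C" for t u using that by (rule scale)
    fix u assume "u \<in> C" "\<And>c. c \<in> C \<Longrightarrow> (\<Sum>i\<in>I. (u i - a i) \<bullet> c i) \<ge> 0"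
    then show ?thesis by blast
  qed (rule fin z)+
  then obtain u where u: "u \<in> C" "\<And>c. c \<in> C \<Longrightarrow> (\<Sum>i\<in>I. (u i - a i) \<bullet> c i) \<ge> 0"
    by blast
  have "(\<Sum>i\<in>I. (a i - u i) \<bullet> c i) = 0" if c: "c \<in> C" for c
  proof -
    have "(\<Sum>i\<in>I. (a i - u i) \<bullet> c i) = - (\<Sum>i\<in>I. (u i - a i) \<bullet> c i)"
      unfolding sum_negf[symmetric] by (simp add: inner_simps)
    moreover have "(\<Sum>i\<in>I. (a i - u i) \<bullet> c i) = (\<Sum>i\<in>I. (u i - a i) \<bullet> ((-1) *\<^sub>R c i))"
      by (simp add: inner_simps)
    ultimately show ?thesis using u(2)[OF c] u(2)[OF scale[OF c, of "-1"]] by linarith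
  qed
  then show ?thesis using that u(1) by blast
qed

lemma orthogonal_decomposition:
  fixes S :: "'v::{real_inner,complete_space} set"
  assumes "subspace S" "closed S"
  obtains u where "u \<in> S" "\<And>c. c \<in> S \<Longrightarrow> (a - u) \<bullet> c = 0"
proof -
  obtain u :: "unit \<Rightarrow> 'v" where "u \<in> {u. u () \<in> S}"
    "\<And>c. c \<in> {u. u () \<in> S} \<Longrightarrow> (\<Sum>i\<in>{()}. (a - u i) \<bullet> c i) = 0"
  proof (rule closest_point_subspace_family[of "{()}" "{u. u () \<in> S}" "\<lambda>_. a"])
    show "l \<in> {u. u () \<in> S}" if "\<And>k. f k \<in> {u. u () \<in> S}"
      "\<And>i. i \<in> {()} \<Longrightarrow> (\<lambda>k. f k i) \<longlonglongrightarrow> l i" for f and l :: "unit \<Rightarrow> 'v"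
      using that closed_sequentially[OF assms(2), of "\<lambda>k. f k ()" "l ()"] by auto
  qed (use assms(1) in \<open>auto simp: subspace_def\<close>)
  note u = this
  have "(a - u ()) \<bullet> c = 0" if "c \<in> S" for c using u(2)[of "\<lambda>_. c"] that by simp
  then show ?thesis using that[of "u ()"] u(1) by simp
qed

text \<open>Unspecified unless \<open>S\<close> is a closed subspace.\<close>
definition proj :: "'v::{real_inner,complete_space} set \<Rightarrow> 'v \<Rightarrow> 'v" where
  "proj S a = (SOME u. u \<in> S \<and> (\<forall>c\<in>S. (a - u) \<bullet> c = 0))"

context
  fixes S :: "'v::{real_inner,complete_space} set"
  assumes S: "subspace S" "closed S"
begin

lemma proj_in: "proj S a \<in> S"
  and proj_orth: "c \<in> S \<Longrightarrow> (a - proj S a) \<bullet> c = 0"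
proof -
  have "\<exists>u. u \<in> S \<and> (\<forall>c\<in>S. (a - u) \<bullet> c = 0)"
    using orthogonal_decomposition[OF S, of a] by metis
  from someI_ex[OF this] show "proj S a \<in> S" "c \<in> S \<Longrightarrow> (a - proj S a) \<bullet> c = 0"
    unfolding proj_def by auto
qed

lemma proj_eqI:
  assumes "u \<in> S" "\<And>c. c \<in> S \<Longrightarrow> (a - u) \<bullet> c = 0"
  shows "proj S a = u"
proof -
  have "u - proj S a \<in> S" using S(1) assms(1) proj_in by (simp add: subspace_diff)
  then have "(a - proj S a) \<bullet> (u - proj S a) - (a - u) \<bullet> (u - proj S a) = 0"
    using assms(2) proj_orth by simp
  then have "(u - proj S a) \<bullet> (u - proj S a) = 0" by (simp add: inner_simps)
  then show ?thesis by simp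
qed

lemma proj_ident: "a \<in> S \<Longrightarrow> proj S a = a"
  by (rule proj_eqI) auto

lemma proj_inner: "proj S a \<bullet> b = a \<bullet> proj S b"
proof -
  have "proj S a \<bullet> b = proj S a \<bullet> proj S b"
    using proj_orth[OF proj_in, of b a] by (simp add: inner_simps inner_commute)
  also have "\<dots> = a \<bullet> proj S b"
    using proj_orth[OF proj_in, of a b] by (simp add: inner_simps inner_commute)
  finally show ?thesis .
qed

lemma norm_proj_le: "norm (proj S a) \<le> norm a"
proof -
  have "(norm (proj S a))\<^sup>2 = a \<bullet> proj S a"
    by (metis power2_norm_eq_inner proj_ident proj_in proj_inner)
  also have "\<dots> \<le> norm a * norm (proj S a)" by (rule norm_cauchy_schwarz)
  finally show ?thesis by (cases "norm (proj S a) = 0") (auto simp: power2_eq_square)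
qed

lemma bounded_linear_proj: "bounded_linear (proj S)"
proof (rule bounded_linear_intro[of _ 1])
  show "proj S (x + y) = proj S x + proj S y" for x y
  proof (rule proj_eqI)
    show "proj S x + proj S y \<in> S" using S(1) proj_in by (simp add: subspace_add)
    show "(x + y - (proj S x + proj S y)) \<bullet> c = 0" if "c \<in> S" for c
      using proj_orth[OF that, of x] proj_orth[OF that, of y] by (simp add: inner_simps)
  qed
  show "proj S (r *\<^sub>R x) = r *\<^sub>R proj S x" for r x
  proof (rule proj_eqI)
    show "r *\<^sub>R proj S x \<in> S" using S(1) proj_in by (simp add: subspace_scale)
    show "(r *\<^sub>R x - r *\<^sub>R proj S x) \<bullet> c = 0" if "c \<in> S" for c
      using proj_orth[OF that, of x] by (simp add: inner_simps)
  qed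
qed (simp add: norm_proj_le)

lemma proj_eq_0: "(\<And>c. c \<in> S \<Longrightarrow> a \<bullet> c = 0) \<Longrightarrow> proj S a = 0"
  by (rule proj_eqI) (use S(1) subspace_0 in auto)

end

text \<open>The orthogonal complement of the kernel of a nonzero functional is a line. The vector
  \<open>w\<close> spans it, and a rescaling of \<open>w\<close> represents the functional.\<close>

lemma riesz_representation:
  fixes f :: "'v::{real_inner,complete_space} \<Rightarrow> real"
  assumes "bounded_linear f"
  obtains v where "\<And>x. f x = x \<bullet> v"
proof (cases "\<forall>x. f x = 0")
  case True then show ?thesis using that[of 0] by simp
next
  case False
  interpret f: bounded_linear f by fact
  from False obtain b where b: "f b \<noteq> 0" by blast
  define K where "K = {x. f x = 0}"
  have K: "subspace K" "closed K"
    unfolding K_def by (auto simp: subspace_def f.add f.scaleR intro!: closed_Collect_eq f.continuous_on continuous_intros)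
  define w where "w = b - proj K b"
  have fw: "f w = f b" using proj_in[OF K, of b] unfolding w_def K_def by (simp add: f.diff)
  have orth: "w \<bullet> c = 0" if "f c = 0" for c
    using proj_orth[OF K, of c b] that unfolding w_def K_def by simp
  have w0: "w \<noteq> 0" using fw b f.zero by auto
  have "f x = x \<bullet> ((f w / (w \<bullet> w)) *\<^sub>R w)" for x
  proof -
    have "w \<bullet> (x - (f x / f w) *\<^sub>R w) = 0"
      by (rule orth) (use b fw in \<open>simp add: f.diff f.scaleR\<close>)
    then show ?thesis using w0 b fw by (simp add: inner_simps inner_commute field_simps)
  qed
  then show ?thesis by (rule that)
qed

section \<open>Operators, adjoints and commutants\<close>

lemma inner_ext:
  fixes u v :: "'a::real_inner"
  shows "(\<And>w. u \<bullet> w = v \<bullet> w) \<Longrightarrow> u = v"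
  by (metis inner_diff_left inner_eq_zero_iff right_minus_eq)

lemma inner_ext':
  fixes u v :: "'a::real_inner"
  shows "(\<And>w. w \<bullet> u = w \<bullet> v) \<Longrightarrow> u = v"
  by (rule inner_ext) (simp add: inner_commute)

section \<open>Complex scalars and the real inner product\<close>

lemma scaleC_one: "1 *\<^sub>C x = (x::'a::complex_hilbert_space)"
  using scaleC_of_real[of 1 x] by simp

lemma scaleC_scaleR: "c *\<^sub>C (r *\<^sub>R x) = r *\<^sub>R (c *\<^sub>C (x::'a::complex_hilbert_space))"
  by (simp flip: scaleC_of_real add: scaleC_scaleC mult.commute)

lemma scaleC_zero_left: "0 *\<^sub>C x = (0::'a::complex_hilbert_space)"
  using scaleC_of_real[of 0 x] by simp

lemma scaleC_zero_right: "c *\<^sub>C 0 = (0::'a::complex_hilbert_space)"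
  using scaleC_scaleR[of c 0 0] by simp

lemma scaleC_minus_left: "(- c) *\<^sub>C x = - (c *\<^sub>C (x::'a::complex_hilbert_space))"
  using scaleC_add_left[of "-c" c x] by (simp add: scaleC_zero_left eq_neg_iff_add_eq_0)

lemma scaleC_minus_right: "c *\<^sub>C (- x) = - (c *\<^sub>C (x::'a::complex_hilbert_space))"
  using scaleC_add_right[of c "-x" x] by (simp add: scaleC_zero_right eq_neg_iff_add_eq_0)

lemma cinner_scaleC_right: "cinner x (c *\<^sub>C y) = cnj c * cinner x y"
  by (metis cinner_commute cinner_scaleC_left complex_cnj_mult)

lemma inner_scaleC_left: "(c *\<^sub>C x) \<bullet> y = x \<bullet> (cnj c *\<^sub>C (y::'a::complex_hilbert_space))"
  by (simp add: cinner_scaleC_left cinner_scaleC_right flip: Re_cinner)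

lemma Im_cinner: "Im (cinner x y) = ((- \<i>) *\<^sub>C x) \<bullet> y"
  by (simp add: cinner_scaleC_left flip: Re_cinner)

text \<open>The imaginary part of \<open>cinner x y\<close> is a real inner product with a rotated
  first argument. So the real inner product, tested on all complex multiples, controls the complex
  one, and later arguments can stay with the real one.\<close>

lemma cinner_eqI:
  fixes x y x' y' :: "'a::complex_hilbert_space"
  assumes "\<And>c. (c *\<^sub>C x) \<bullet> y = (c *\<^sub>C x') \<bullet> y'"
  shows "cinner x y = cinner x' y'"
  using assms[of 1] assms[of "- \<i>"]
  by (intro complex_eqI) (simp_all add: Re_cinner Im_cinner scaleC_one)

lemma norm_scaleC: "norm (c *\<^sub>C x) = cmod c * norm (x::'a::complex_hilbert_space)"
proof -
  have "(norm (c *\<^sub>C x))\<^sup>2 = x \<bullet> ((cnj c * c) *\<^sub>C x)"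
    by (simp add: power2_norm_eq_inner inner_scaleC_left scaleC_scaleC)
  also have "cnj c * c = complex_of_real ((cmod c)\<^sup>2)"
    by (metis complex_norm_square mult.commute of_real_power)
  finally have "(norm (c *\<^sub>C x))\<^sup>2 = (cmod c * norm x)\<^sup>2"
    by (simp only: scaleC_of_real inner_scaleR_right power2_norm_eq_inner power_mult_distrib)
  then show ?thesis by (simp add: power2_eq_imp_eq)
qed

lemma bounded_linear_scaleC: "bounded_linear (\<lambda>x. c *\<^sub>C (x::'a::complex_hilbert_space))"
  by (rule bounded_linear_intro[of _ "cmod c"])
    (simp_all add: scaleC_add_right scaleC_scaleR norm_scaleC mult.commute)

section \<open>Bounded complex-linear operators and their adjoints\<close>

definition clinop :: "('a::complex_hilbert_space \<Rightarrow> 'a) \<Rightarrow> bool" where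
  "clinop T \<longleftrightarrow> bounded_linear T \<and> (\<forall>c x. T (c *\<^sub>C x) = c *\<^sub>C T x)"

lemma clinopD:
  assumes "clinop T"
  shows "bounded_linear T" "T (c *\<^sub>C x) = c *\<^sub>C T x" "T (x + y) = T x + T y" "T 0 = 0"
    "T (- x) = - T x" "T (x - y) = T x - T y" "T (r *\<^sub>R x) = r *\<^sub>R T x"
  using assms linear_simps[of T] unfolding clinop_def by auto

lemma clinop_sum: "clinop T \<Longrightarrow> T (sum f A) = (\<Sum>i\<in>A. T (f i))"
  by (intro linear_sum) (simp add: bounded_linear.linear clinopD)

lemma clinop_compose: "clinop S \<Longrightarrow> clinop T \<Longrightarrow> clinop (\<lambda>x. S (T x))"
  unfolding clinop_def by (auto intro: bounded_linear_compose)

lemma clinop_add: "clinop S \<Longrightarrow> clinop T \<Longrightarrow> clinop (\<lambda>x. S x + T x)"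
  unfolding clinop_def by (auto intro: bounded_linear_add simp: scaleC_add_right)

lemma clinop_scaleC: "clinop T \<Longrightarrow> clinop (\<lambda>x. c *\<^sub>C T x)"
  unfolding clinop_def
  by (auto intro: bounded_linear_compose[OF bounded_linear_scaleC] simp: scaleC_scaleC mult.commute)

lemma clinop_0: "clinop (\<lambda>x. 0)"
  unfolding clinop_def by (simp add: scaleC_zero_right)

lemma cadjoint_ex:
  fixes T :: "'a::complex_hilbert_space \<Rightarrow> 'a"
  assumes "clinop T"
  obtains S where "\<And>x y. T x \<bullet> y = x \<bullet> S y"
proof -
  have "\<exists>v. \<forall>x. T x \<bullet> y = x \<bullet> v" for y
  proof -
    have "bounded_linear (\<lambda>x. T x \<bullet> y)"
      using bounded_linear_compose[OF bounded_linear_inner_left clinopD(1)[OF assms]] .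
    from riesz_representation[OF this] show ?thesis by metis
  qed
  then show ?thesis using that by metis
qed

text \<open>By complex linearity of \<open>T\<close> the real adjoint relation, applied to multiples
  of \<open>x\<close>, yields the complex one. Adjoints may thus be computed with the real inner
  product alone.\<close>

lemma cadjoint_eqI:
  fixes T :: "'a::complex_hilbert_space \<Rightarrow> 'a"
  assumes T: "clinop T" and S: "\<And>x y. T x \<bullet> y = x \<bullet> S y"
  shows "cadjoint T = S"
  unfolding cadjoint_def
proof (rule the_equality)
  show "\<forall>x y. cinner (T x) y = cinner x (S y)"
    by (auto intro!: cinner_eqI simp: S simp flip: clinopD(2)[OF T])
  fix S' assume S': "\<forall>x y. cinner (T x) y = cinner x (S' y)"
  show "S' = S"
  proof
    fix y
    have "x \<bullet> S' y = x \<bullet> S y" for x using S S' by (metis Re_cinner)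
    then show "S' y = S y" by (rule inner_ext')
  qed
qed

lemma cadjoint_inner: "clinop T \<Longrightarrow> T x \<bullet> y = x \<bullet> cadjoint T y"
  by (metis cadjoint_ex cadjoint_eqI)

lemma cadjoint_inner': "clinop T \<Longrightarrow> cadjoint T x \<bullet> y = x \<bullet> T y"
  by (metis cadjoint_inner inner_commute)

lemma clinop_cadjoint:
  fixes T :: "'a::complex_hilbert_space \<Rightarrow> 'a"
  assumes T: "clinop T"
  shows "clinop (cadjoint T)"
proof -
  note i = cadjoint_inner'[OF T]
  obtain K where K: "\<And>x. norm (T x) \<le> norm x * K" "K \<ge> 0"
    using bounded_linear.nonneg_bounded[OF clinopD(1)[OF T]] by blast
  show ?thesis unfolding clinop_def
  proof (intro conjI allI bounded_linear_intro[of _ K])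
    show "norm (cadjoint T x) \<le> norm x * K" for x
    proof -
      have "(norm (cadjoint T x))\<^sup>2 = x \<bullet> T (cadjoint T x)" by (simp add: power2_norm_eq_inner i)
      also have "\<dots> \<le> norm x * (norm (cadjoint T x) * K)"
        using norm_cauchy_schwarz[of x "T (cadjoint T x)"] mult_left_mono[OF K(1) norm_ge_zero] by (rule order_trans)
      finally show ?thesis
        using K(2) by (cases "norm (cadjoint T x) = 0") (auto simp: power2_eq_square algebra_simps)
    qed
  qed (rule inner_ext, simp add: i inner_simps inner_scaleC_left clinopD[OF T])+
qed

lemma cadjoint_cadjoint: "clinop T \<Longrightarrow> cadjoint (cadjoint T) = T"
  by (rule cadjoint_eqI) (rule clinop_cadjoint cadjoint_inner', assumption)+

lemma cadjoint_compose:
  "clinop S \<Longrightarrow> clinop T \<Longrightarrow> cadjoint (\<lambda>v. S (T v)) = (\<lambda>v. cadjoint T (cadjoint S v))"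
  by (intro cadjoint_eqI) (simp_all add: clinop_compose cadjoint_inner)

section \<open>Closed complex subspaces and the operators they carry\<close>

lemma csubspaceD:
  assumes "closed_csubspace H"
  shows "subspace H" "closed H" "x \<in> H \<Longrightarrow> c *\<^sub>C x \<in> H" "0 \<in> H" "x \<in> H \<Longrightarrow> y \<in> H \<Longrightarrow> x + y \<in> H"
    "x \<in> H \<Longrightarrow> y \<in> H \<Longrightarrow> x - y \<in> H" "x \<in> H \<Longrightarrow> - x \<in> H" "x \<in> H \<Longrightarrow> r *\<^sub>R x \<in> H"
    "(\<And>i. i \<in> A \<Longrightarrow> f i \<in> H) \<Longrightarrow> sum f A \<in> H"
  using assms unfolding closed_csubspace_def
  by (auto simp: subspace_0 subspace_add subspace_diff subspace_neg subspace_scale subspace_sum)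

lemma orth_eq_inner:
  assumes "closed_csubspace H"
  shows "orth H = {x. \<forall>h\<in>H. x \<bullet> h = 0}"
proof -
  have "cinner x h = 0" if "\<forall>h\<in>H. x \<bullet> h = 0" "h \<in> H" for x h
  proof (rule complex_eqI)
    show "Re (cinner x h) = Re 0" using that by (simp add: Re_cinner)
    show "Im (cinner x h) = Im 0"
      using that csubspaceD(3)[OF assms] by (simp add: Im_cinner inner_scaleC_left)
  qed
  moreover have "x \<bullet> h = 0" if "cinner x h = 0" for x h using that by (metis Re_cinner zero_complex.sel(1))
  ultimately show ?thesis unfolding orth_def by blast
qed

lemma clinop_proj:
  assumes H: "closed_csubspace H"
  shows "clinop (proj H)"
  unfolding clinop_def
proof (intro conjI allI)
  note S = csubspaceD(1,2)[OF H]
  show "bounded_linear (proj H)" using bounded_linear_proj[OF S] .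
  show "proj H (c *\<^sub>C x) = c *\<^sub>C proj H x" for c x
  proof (rule proj_eqI[OF S])
    show "c *\<^sub>C proj H x \<in> H" using csubspaceD(3)[OF H] proj_in[OF S] by simp
    show "(c *\<^sub>C x - c *\<^sub>C proj H x) \<bullet> u = 0" if "u \<in> H" for u
    proof -
      have "c *\<^sub>C x - c *\<^sub>C proj H x = c *\<^sub>C (x - proj H x)"
        by (simp add: scaleC_add_right scaleC_minus_right diff_conv_add_uminus del: add_uminus_conv_diff)
      then show ?thesis
        using proj_orth[OF S] csubspaceD(3)[OF H that] by (simp add: inner_scaleC_left)
    qed
  qed
qed

text \<open>Vanishing on the orthogonal complement amounts to factoring through the projection,
  because \<open>x - proj H x\<close> lies in \<open>orth H\<close>. The equational form behaves
  well under composition and adjoints.\<close>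

lemma bounded_ops_iff:
  assumes H: "closed_csubspace H"
  shows "T \<in> bounded_ops H \<longleftrightarrow> clinop T \<and> (\<forall>x. T x \<in> H) \<and> (\<forall>x. T (proj H x) = T x)"
proof -
  note S = csubspaceD(1,2)[OF H]
  have 1: "x - proj H x \<in> orth H" for x using proj_orth[OF S] by (simp add: orth_eq_inner[OF H])
  have 2: "proj H x = 0" if "x \<in> orth H" for x using proj_eq_0[OF S] that by (simp add: orth_eq_inner[OF H])
  show ?thesis
  proof
    assume T: "T \<in> bounded_ops H"
    then have c: "clinop T" unfolding bounded_ops_def clinop_def by simp
    have "T (x - proj H x) = 0" for x using T 1 unfolding bounded_ops_def by blast
    then have "T (proj H x) = T x" for x using clinopD(6)[OF c] by (metis right_minus_eq)
    then show "clinop T \<and> (\<forall>x. T x \<in> H) \<and> (\<forall>x. T (proj H x) = T x)"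
      using c T unfolding bounded_ops_def by auto
  next
    assume T: "clinop T \<and> (\<forall>x. T x \<in> H) \<and> (\<forall>x. T (proj H x) = T x)"
    then have "T x = 0" if "x \<in> orth H" for x using 2[OF that] by (metis clinopD(4))
    then show "T \<in> bounded_ops H" using T unfolding bounded_ops_def clinop_def by auto
  qed
qed

lemma bounded_opsD:
  assumes "closed_csubspace H" "T \<in> bounded_ops H"
  shows "clinop T" "T x \<in> H" "T (proj H x) = T x" "proj H (T x) = T x"
  using assms bounded_ops_iff[OF assms(1), of T] proj_ident csubspaceD(1,2)[OF assms(1)] by auto

lemma proj_bounded_ops: "closed_csubspace H \<Longrightarrow> proj H \<in> bounded_ops H"
  by (simp add: bounded_ops_iff clinop_proj proj_in proj_ident csubspaceD)

lemma bounded_ops_cadjoint: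
  assumes H: "closed_csubspace H" and T: "T \<in> bounded_ops H"
  shows "cadjoint T \<in> bounded_ops H"
proof -
  note S = csubspaceD(1,2)[OF H] and b = bounded_opsD[OF H T]
  have "proj H (cadjoint T x) = cadjoint T x" "cadjoint T (proj H x) = cadjoint T x" for x
    by (rule inner_ext'; simp add: b proj_inner[OF S, symmetric] cadjoint_inner[OF b(1), symmetric])+
  then show ?thesis
    unfolding bounded_ops_iff[OF H] using clinop_cadjoint[OF b(1)] proj_in[OF S] by metis
qed

section \<open>Orthogonal projections as operators\<close>

definition oproj :: "('a::complex_hilbert_space \<Rightarrow> 'a) \<Rightarrow> bool" where
  "oproj p \<longleftrightarrow> clinop p \<and> (\<forall>x. p (p x) = p x) \<and> (\<forall>x y. p x \<bullet> y = x \<bullet> p y)"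

lemma oprojD:
  assumes "oproj p"
  shows "clinop p" "p (p x) = p x" "p x \<bullet> y = x \<bullet> p y" "cadjoint p = p"
  using assms cadjoint_eqI[of p p] unfolding oproj_def by auto

lemma oproj_range:
  assumes p: "oproj p"
  shows "closed_csubspace (range p)" "proj (range p) = p"
proof -
  note D = oprojD[OF p]
  have r: "range p = {x. p x = x}" 
  proof
    show "{x. p x = x} \<subseteq> range p" by (metis (mono_tags) mem_Collect_eq rangeI subsetI)
  qed (use D(2) in auto)
  show c: "closed_csubspace (range p)"
    unfolding r closed_csubspace_def
    using bounded_linear.linear[OF clinopD(1)[OF D(1)]]
    by (auto simp: subspace_def clinopD[OF D(1)]
      intro!: closed_Collect_eq linear_continuous_on clinopD(1)[OF D(1)] continuous_on_id)
  show "proj (range p) = p"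
    by (rule ext, rule proj_eqI[OF csubspaceD(1,2)[OF c]])
      (auto simp: inner_diff_left D)
qed

lemma oproj_proj: "closed_csubspace H \<Longrightarrow> oproj (proj H)"
  unfolding oproj_def by (simp add: clinop_proj proj_ident proj_in proj_inner csubspaceD)

lemma norm_oproj_le: "oproj p \<Longrightarrow> norm (p x) \<le> norm x"
  using norm_proj_le[of "range p" x] oproj_range[of p] csubspaceD(1,2)[of "range p"] by simp

lemma bounded_ops_range_iff:
  assumes p: "oproj p"
  shows "T \<in> bounded_ops (range p) \<longleftrightarrow> clinop T \<and> (\<forall>x. p (T x) = T x) \<and> (\<forall>x. T (p x) = T x)"
  unfolding bounded_ops_iff[OF oproj_range(1)[OF p]] oproj_range(2)[OF p]
  using oprojD(2)[OF p] by (metis rangeE rangeI)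

section \<open>Commutants\<close>

lemma commutantD:
  assumes "y \<in> commutant H M"
  shows "y \<in> bounded_ops H" "x \<in> M \<Longrightarrow> x (y v) = y (x v)"
  using assms unfolding commutant_def by (auto simp: fun_eq_iff)

lemma commutantI:
  assumes "y \<in> bounded_ops H" "\<And>x v. x \<in> M \<Longrightarrow> x (y v) = y (x v)"
  shows "y \<in> commutant H M"
  using assms unfolding commutant_def by (auto simp: fun_eq_iff)

lemma commutant_antimono: "A \<subseteq> B \<Longrightarrow> commutant H B \<subseteq> commutant H A"
  unfolding commutant_def by blast

lemma bicommutant_subset: "A \<subseteq> bounded_ops H \<Longrightarrow> A \<subseteq> commutant H (commutant H A)"
  unfolding commutant_def by auto

lemma commutant_triple:
  assumes "A \<subseteq> bounded_ops H"
  shows "commutant H (commutant H (commutant H A)) = commutant H A"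
proof
  show "commutant H (commutant H (commutant H A)) \<subseteq> commutant H A"
    by (intro commutant_antimono bicommutant_subset assms)
  show "commutant H A \<subseteq> commutant H (commutant H (commutant H A))"
    by (intro bicommutant_subset) (auto simp: commutant_def)
qed

context
  fixes H :: "'a::complex_hilbert_space set" and A :: "('a \<Rightarrow> 'a) set"
  assumes H: "closed_csubspace H" and A: "A \<subseteq> bounded_ops H"
begin

lemma commutant_compose: "x \<in> commutant H A \<Longrightarrow> y \<in> commutant H A \<Longrightarrow> (\<lambda>v. x (y v)) \<in> commutant H A"
  unfolding commutant_def by (auto simp: bounded_ops_iff[OF H] clinop_compose fun_eq_iff)

lemma commutant_add: "x \<in> commutant H A \<Longrightarrow> y \<in> commutant H A \<Longrightarrow> (\<lambda>v. x v + y v) \<in> commutant H A"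
  using A unfolding commutant_def
  by (auto simp: bounded_ops_iff[OF H] clinop_add fun_eq_iff csubspaceD[OF H] clinopD subset_iff)

lemma commutant_scaleC: "x \<in> commutant H A \<Longrightarrow> (\<lambda>v. c *\<^sub>C x v) \<in> commutant H A"
  using A unfolding commutant_def
  by (auto simp: bounded_ops_iff[OF H] clinop_scaleC fun_eq_iff csubspaceD[OF H] clinopD subset_iff)

lemma commutant_0: "(\<lambda>v. 0) \<in> commutant H A"
  using A unfolding commutant_def
  by (auto simp: bounded_ops_iff[OF H] clinop_0 fun_eq_iff csubspaceD[OF H] clinopD subset_iff)

lemma commutant_proj: "proj H \<in> commutant H A"
  using A bounded_opsD[OF H] by (intro commutantI proj_bounded_ops[OF H]) (auto simp: subset_iff)

lemma commutant_cadjoint: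
  assumes star: "\<And>x. x \<in> A \<Longrightarrow> cadjoint x \<in> A" and y: "y \<in> commutant H A"
  shows "cadjoint y \<in> commutant H A"
proof (rule commutantI)
  have yb: "y \<in> bounded_ops H" using y by (rule commutantD)
  then show "cadjoint y \<in> bounded_ops H" by (rule bounded_ops_cadjoint[OF H])
  fix x v assume x: "x \<in> A"
  have c: "clinop x" "clinop y" using x A yb bounded_opsD(1)[OF H] by auto
  have "w \<bullet> x (cadjoint y v) = w \<bullet> cadjoint y (x v)" for w
  proof -
    have "w \<bullet> x (cadjoint y v) = y (cadjoint x w) \<bullet> v" by (simp add: cadjoint_inner[OF c(2)] cadjoint_inner'[OF c(1)])
    also have "\<dots> = cadjoint x (y w) \<bullet> v" using commutantD(2)[OF y star[OF x]] by simp
    also have "\<dots> = w \<bullet> cadjoint y (x v)" by (simp add: cadjoint_inner[OF c(2)] cadjoint_inner'[OF c(1)])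
    finally show ?thesis .
  qed
  then show "x (cadjoint y v) = cadjoint y (x v)" by (rule inner_ext')
qed

lemma von_neumann_algebra_commutant:
  assumes "\<And>x. x \<in> A \<Longrightarrow> cadjoint x \<in> A"
  shows "von_neumann_algebra H (commutant H A)"
  unfolding von_neumann_algebra_def
  using H commutant_triple[OF A] commutant_cadjoint[OF assms] by (auto simp: commutant_def)

end

section \<open>Von Neumann algebras\<close>

context
  fixes H :: "'a::complex_hilbert_space set" and M :: "('a \<Rightarrow> 'a) set"
  assumes M: "von_neumann_algebra H M"
begin

lemma vnaD: "closed_csubspace H" "M \<subseteq> bounded_ops H" "x \<in> M \<Longrightarrow> cadjoint x \<in> M"
    "commutant H (commutant H M) = M"
  using M unfolding von_neumann_algebra_def by auto

lemma vna_op: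
  assumes "x \<in> M"
  shows "clinop x" "x v \<in> H" "x (proj H v) = x v" "proj H (x v) = x v"
  using bounded_opsD[OF vnaD(1)] vnaD(2) assms by auto

lemma vna_commutant: "von_neumann_algebra H (commutant H M)"
  by (intro von_neumann_algebra_commutant vnaD)

lemma vna_closed:
  shows "x \<in> M \<Longrightarrow> y \<in> M \<Longrightarrow> (\<lambda>v. x (y v)) \<in> M" "x \<in> M \<Longrightarrow> y \<in> M \<Longrightarrow> (\<lambda>v. x v + y v) \<in> M"
    "x \<in> M \<Longrightarrow> (\<lambda>v. c *\<^sub>C x v) \<in> M" "(\<lambda>v. 0) \<in> M" "proj H \<in> M"
proof -
  have A: "commutant H M \<subseteq> bounded_ops H" unfolding commutant_def by blast
  note l = commutant_compose[OF vnaD(1) A] commutant_add[OF vnaD(1) A] commutant_scaleC[OF vnaD(1) A]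
    commutant_0[OF vnaD(1) A] commutant_proj[OF vnaD(1) A]
  show "x \<in> M \<Longrightarrow> y \<in> M \<Longrightarrow> (\<lambda>v. x (y v)) \<in> M" "x \<in> M \<Longrightarrow> y \<in> M \<Longrightarrow> (\<lambda>v. x v + y v) \<in> M"
    "x \<in> M \<Longrightarrow> (\<lambda>v. c *\<^sub>C x v) \<in> M" "(\<lambda>v. 0) \<in> M" "proj H \<in> M"
    using l unfolding vnaD(4) by blast+
qed

lemma vna_sum: "finite A \<Longrightarrow> (\<And>i. i \<in> A \<Longrightarrow> x i \<in> M) \<Longrightarrow> (\<lambda>v. \<Sum>i\<in>A. x i v) \<in> M"
  by (induction A rule: finite_induct) (auto intro: vna_closed)

lemma projection_inD:
  assumes "projection_in M p"
  shows "p \<in> M" "oproj p" "p ` H = range p"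
proof -
  show pM: "p \<in> M" using assms unfolding projection_in_def by blast
  show "oproj p"
    using assms vna_op(1)[OF pM] cadjoint_inner[OF vna_op(1)[OF pM]]
    unfolding oproj_def projection_in_def by (auto simp: fun_eq_iff)
  show "p ` H = range p"
    using vna_op(3)[OF pM] proj_in[OF csubspaceD(1,2)[OF vnaD(1)]] by (metis image_subset_iff rangeE subsetI subset_antisym image_eqI rangeI)
qed

end

lemma projection_inI: "oproj p \<Longrightarrow> p \<in> M \<Longrightarrow> projection_in M p"
  unfolding projection_in_def by (simp add: fun_eq_iff oprojD)

text \<open>As \<open>A\<close> is closed under adjoints, the orthogonal complement of
  \<open>Z\<close> is invariant together with \<open>Z\<close>, so elements of \<open>A\<close>
  respect the decomposition.\<close>

lemma proj_in_commutant:
  assumes Z: "closed_csubspace Z" "Z \<subseteq> H" and H: "closed_csubspace H" and A: "A \<subseteq> bounded_ops H"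
    and star: "\<And>x. x \<in> A \<Longrightarrow> cadjoint x \<in> A"
    and inv: "\<And>x v. x \<in> A \<Longrightarrow> v \<in> Z \<Longrightarrow> x v \<in> Z"
  shows "proj Z \<in> commutant H A"
proof (rule commutantI)
  note S = csubspaceD(1,2)[OF Z(1)] and SH = csubspaceD(1,2)[OF H]
  have "proj Z (proj H x) = proj Z x" for x
  proof -
    have "proj Z (proj H x) \<bullet> y = proj Z x \<bullet> y" for y
      using Z(2) by (simp add: proj_inner[OF S] proj_inner[OF SH] proj_ident[OF SH] proj_in[OF S] subset_iff)
    then show ?thesis by (rule inner_ext)
  qed
  then show "proj Z \<in> bounded_ops H"
    unfolding bounded_ops_iff[OF H] using clinop_proj[OF Z(1)] proj_in[OF S] Z(2) by blast
  fix x v assume x: "x \<in> A"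
  then have c: "clinop x" using A bounded_opsD(1)[OF H] by auto
  show "x (proj Z v) = proj Z (x v)"
  proof (rule proj_eqI[OF S, symmetric])
    show "x (proj Z v) \<in> Z" using inv[OF x] proj_in[OF S] by blast
    show "(x v - x (proj Z v)) \<bullet> u = 0" if u: "u \<in> Z" for u
      using proj_orth[OF S inv[OF star[OF x] u], of v]
      by (simp flip: clinopD(6)[OF c] add: cadjoint_inner[OF c])
  qed
qed

section \<open>Reduction of von Neumann algebras\<close>

lemma subspace_closure:
  fixes G :: "'v::real_normed_vector set"
  assumes G: "subspace G"
  shows "subspace (closure G)"
  unfolding subspace_def
proof (intro conjI ballI allI)
  show "0 \<in> closure G" using subspace_0[OF G] closure_subset by blast
  fix x assume "x \<in> closure G"
  then obtain f where f: "\<And>n. f n \<in> G" "f \<longlonglongrightarrow> x" unfolding closure_sequential by blast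
  show "c *\<^sub>R x \<in> closure G" for c
    unfolding closure_sequential
    by (rule exI[of _ "\<lambda>n. c *\<^sub>R f n"]) (use f G in \<open>auto intro: tendsto_intros subspace_scale\<close>)
  fix y assume "y \<in> closure G"
  then obtain g where g: "\<And>n. g n \<in> G" "g \<longlonglongrightarrow> y" unfolding closure_sequential by blast
  show "x + y \<in> closure G"
    unfolding closure_sequential
    by (rule exI[of _ "\<lambda>n. f n + g n"]) (use f g G in \<open>auto intro: tendsto_intros subspace_add\<close>)
qed

text \<open>The bound makes the closure of the relation single valued with closed domain
  \<open>D\<close>, so it is the graph of a bounded map on \<open>D\<close>; composing with the
  projection onto \<open>D\<close> extends that map by zero. Starting from a relation means that
  independence of representatives is a consequence of the bound.\<close>

lemma bounded_graph_extension:
  fixes G :: "('v::{real_inner,complete_space} \<times> 'v) set"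
  assumes G: "subspace G" and bd: "\<And>u v. (u, v) \<in> G \<Longrightarrow> norm v \<le> c * norm u" and c: "c \<ge> 0"
  obtains S where "bounded_linear S" "\<And>u v. (u, v) \<in> G \<Longrightarrow> S u = v"
    "\<And>w. \<forall>z\<in>G. w \<bullet> fst z = 0 \<Longrightarrow> S w = 0" "\<And>w. S w \<in> closure (snd ` G)"
proof -
  define E where "E = closure G"
  have E: "subspace E" "closed E" "G \<subseteq> E" unfolding E_def using subspace_closure[OF G] closure_subset by auto
  \<comment> \<open>Closed conditions on pairs pass from \<open>G\<close> to its closure
    \<open>E\<close>.\<close>
  have min: "z \<in> C" if "z \<in> E" "G \<subseteq> C" "closed C" for z C
    using that closure_minimal unfolding E_def by blast
  have bdE: "norm v \<le> c * norm u" if "(u, v) \<in> E" for u v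
  proof -
    have "(u, v) \<in> {z. norm (snd z) \<le> c * norm (fst z)}"
    proof (rule min[OF that])
      show "closed {z :: 'v \<times> 'v. norm (snd z) \<le> c * norm (fst z)}" by (intro closed_Collect_le continuous_intros)
    qed (use bd in auto)
    then show ?thesis by simp
  qed
  have diffE: "(u - u', v - v') \<in> E" if "(u, v) \<in> E" "(u', v') \<in> E" for u v u' v'
    using subspace_diff[OF E(1) that] by simp
  have uniq: "v = v'" if "(u, v) \<in> E" "(u, v') \<in> E" for u v v'
    using bdE[OF diffE[OF that]] by simp
  define D where "D = fst ` E"
  have "subspace D" unfolding D_def using E(1) by (intro linear_subspace_image) (auto intro: linearI)
  moreover have "closed D"
    unfolding closed_sequential_limits
  proof (intro allI impI)
    fix f l assume "(\<forall>n. f n \<in> D) \<and> f \<longlonglongrightarrow> l"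
    then have fD: "\<forall>n. \<exists>v. (f n, v) \<in> E" and fl: "f \<longlonglongrightarrow> l" unfolding D_def by force+
    from choice[OF fD] obtain g where g: "\<And>n. (f n, g n) \<in> E" by blast
    \<comment> \<open>The bound transfers the Cauchy property from the first to the second
      components; \<open>c + 1\<close> is used as a divisor because \<open>c\<close> may be
      zero.\<close>
    have "Cauchy g"
    proof (rule CauchyI)
      fix e :: real assume e: "0 < e"
      have "Cauchy f" using fl by (rule LIMSEQ_imp_Cauchy)
      then obtain N where N: "\<And>m n. m \<ge> N \<Longrightarrow> n \<ge> N \<Longrightarrow> norm (f m - f n) < e / (c + 1)"
        using e c CauchyD[of f "e / (c + 1)"] by (auto simp: add_nonneg_pos)
      have "norm (g m - g n) < e" if "m \<ge> N" "n \<ge> N" for m n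
      proof -
        have "norm (g m - g n) \<le> c * norm (f m - f n)" using bdE[OF diffE[OF g g]] .
        also have "\<dots> \<le> (c + 1) * norm (f m - f n)" by (intro mult_right_mono) auto
        also have "\<dots> < e" using N[OF that] c by (simp add: pos_less_divide_eq add_nonneg_pos mult.commute)
        finally show ?thesis .
      qed
      then show "\<exists>M. \<forall>m\<ge>M. \<forall>n\<ge>M. norm (g m - g n) < e" by blast
    qed
    then obtain v where "g \<longlonglongrightarrow> v" by (auto simp: Cauchy_convergent_iff convergent_def)
    then have "(\<lambda>n. (f n, g n)) \<longlonglongrightarrow> (l, v)" using fl by (rule tendsto_Pair[rotated])
    then have "(l, v) \<in> E" using closed_sequentially[OF E(2), of "\<lambda>n. (f n, g n)"] g by blast
    then show "l \<in> D" unfolding D_def by force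
  qed
  ultimately have D: "subspace D" "closed D" .
  define S where "S w = (THE v. (proj D w, v) \<in> E)" for w
  have S: "(proj D w, S w) \<in> E" for w
  proof -
    obtain v where "(proj D w, v) \<in> E" using proj_in[OF D, of w] unfolding D_def by force
    then show ?thesis unfolding S_def by (rule theI) (rule uniq[OF _ \<open>(proj D w, v) \<in> E\<close>])
  qed
  have SI: "S w = v" if "(u, v) \<in> E" "\<And>d. d \<in> D \<Longrightarrow> (w - u) \<bullet> d = 0" for w u v
  proof -
    have "u \<in> D" using that(1) unfolding D_def by force
    then have "proj D w = u" using that(2) by (intro proj_eqI[OF D]) auto
    then show ?thesis using S[of w] that(1) uniq by simp
  qed
  have orthD: "w \<bullet> d = 0" if w: "\<And>u v. (u, v) \<in> G \<Longrightarrow> w \<bullet> u = 0" and d: "d \<in> D" for w d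
  proof -
    obtain v where "(d, v) \<in> E" using d unfolding D_def by force
    then have "(d, v) \<in> {z. w \<bullet> fst z = 0}"
    proof (rule min)
      show "closed {z :: 'v \<times> 'v. w \<bullet> fst z = 0}" by (intro closed_Collect_eq continuous_intros)
    qed (use w in auto)
    then show ?thesis by simp
  qed
  show ?thesis
  proof (rule that)
    show "bounded_linear S"
    proof (rule bounded_linear_intro[of _ c])
      show "S (x + y) = S x + S y" for x y
      proof (rule SI[of "proj D x + proj D y"])
        show "(proj D x + proj D y, S x + S y) \<in> E" using subspace_add[OF E(1) S S] by simp
        show "(x + y - (proj D x + proj D y)) \<bullet> d = 0" if "d \<in> D" for d
          using proj_orth[OF D that, of x] proj_orth[OF D that, of y] by (simp add: inner_simps)
      qed
      show "S (r *\<^sub>R x) = r *\<^sub>R S x" for r x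
      proof (rule SI[of "r *\<^sub>R proj D x"])
        show "(r *\<^sub>R proj D x, r *\<^sub>R S x) \<in> E" using subspace_scale[OF E(1) S] by simp
        show "(r *\<^sub>R x - r *\<^sub>R proj D x) \<bullet> d = 0" if "d \<in> D" for d
          using proj_orth[OF D that, of x] by (simp add: inner_simps)
      qed
      show "norm (S x) \<le> norm x * c" for x
      proof -
        have "norm (S x) \<le> c * norm (proj D x)" using bdE[OF S] .
        also have "\<dots> \<le> c * norm x" using c norm_proj_le[OF D] by (intro mult_left_mono)
        finally show ?thesis by (simp add: mult.commute)
      qed
    qed
    show "S u = v" if "(u, v) \<in> G" for u v using SI[of u v u] that E(3) by auto
    show "S w = 0" if w: "\<forall>z\<in>G. w \<bullet> fst z = 0" for w
    proof (rule SI[of 0])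
      show "(w - 0) \<bullet> d = 0" if "d \<in> D" for d using orthD[OF _ that, of w] w by fastforce
    qed (use subspace_0[OF E(1)] in \<open>simp add: zero_prod_def\<close>)
    show "S w \<in> closure (snd ` G)" for w
    proof -
      have "(proj D w, S w) \<in> snd -` closure (snd ` G)"
      proof (rule min[OF S])
        show "G \<subseteq> snd -` closure (snd ` G)" using closure_subset[of "snd ` G"] by auto
        show "closed (snd -` closure (snd ` G) :: ('v \<times> 'v) set)" by (intro closed_vimage closed_closure continuous_intros)
      qed
      then show ?thesis by simp
    qed
  qed
qed

text \<open>\<open>R\<close> preserves the relation, and its adjoint \<open>R'\<close> preserves the
  domain, so \<open>R\<close> also preserves the orthogonal complement of the domain, where
  \<open>S\<close> is zero. The two pieces make up the whole space.\<close>

lemma graph_extension_commute: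
  fixes G :: "('v::{real_inner,complete_space} \<times> 'v) set"
  assumes G: "subspace G" and S: "bounded_linear S" "\<And>u v. (u, v) \<in> G \<Longrightarrow> S u = v"
    "\<And>w. \<forall>z\<in>G. w \<bullet> fst z = 0 \<Longrightarrow> S w = 0"
    and R: "bounded_linear R" "\<And>x y. R x \<bullet> y = x \<bullet> R' y"
    "\<And>u v. (u, v) \<in> G \<Longrightarrow> (R u, R v) \<in> G" "\<And>u v. (u, v) \<in> G \<Longrightarrow> R' u \<in> fst ` G"
  shows "S (R w) = R (S w)"
proof -
  define D where "D = closure (fst ` G)"
  have "subspace (fst ` G)" using G by (intro linear_subspace_image) (auto intro: linearI)
  then have D: "subspace D" "closed D" unfolding D_def using subspace_closure by auto
  have "D \<subseteq> {u. S (R u) = R (S u)}"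
    unfolding D_def
  proof (rule closure_minimal)
    show "closed {u. S (R u) = R (S u)}"
      by (intro closed_Collect_eq linear_continuous_on bounded_linear_compose[of S R] bounded_linear_compose[of R S] S R)
    show "fst ` G \<subseteq> {u. S (R u) = R (S u)}"
    proof
      fix u assume "u \<in> fst ` G"
      then obtain v where v: "(u, v) \<in> G" by force
      then show "u \<in> {u. S (R u) = R (S u)}" using S(2)[OF v] S(2)[OF R(3)[OF v]] by simp
    qed
  qed
  then have 1: "S (R (proj D w)) = R (S (proj D w))" using proj_in[OF D] by blast
  have o: "(w - proj D w) \<bullet> u = 0" if "u \<in> fst ` G" for u
    using proj_orth[OF D, of u w] that closure_subset[of "fst ` G"] unfolding D_def by auto
  have 2: "S (w - proj D w) = 0" by (rule S(3)) (use o in blast)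
  have 3: "S (R (w - proj D w)) = 0"
  proof (rule S(3), rule ballI)
    fix z assume "z \<in> G"
    then have "R' (fst z) \<in> fst ` G" using R(4)[of "fst z" "snd z"] by simp
    then show "R (w - proj D w) \<bullet> fst z = 0" unfolding R(2) by (rule o)
  qed
  show ?thesis using 1 2 3 linear_simps[OF S(1)] linear_simps[OF R(1)] by simp
qed

text \<open>Writing \<open>a 0 = b r\<close>, the step inequality propagates to
  \<open>a n \<ge> b r^(2^n)\<close>. For \<open>r > s\<close> this outgrows
  \<open>C s^(2^n)\<close> whatever \<open>C\<close> is, so \<open>C\<close> leaves no trace in the
  conclusion.\<close>

lemma doubling_sequence_bound:
  fixes a :: "nat \<Rightarrow> real"
  assumes a: "\<And>n. a n \<ge> 0" and b: "b \<ge> 0" and step: "\<And>n. (a n)\<^sup>2 \<le> b * a (Suc n)"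
    and bd: "\<And>n. a n \<le> C * s ^ (2 ^ n)" and s: "s > 0"
  shows "a 0 \<le> s * b"
proof (cases "b = 0")
  case True then show ?thesis using step[of 0] by simp
next
  case False
  then have b: "b > 0" using b by simp
  show ?thesis
  proof (rule ccontr)
    assume n: "\<not> ?thesis"
    define r where "r = a 0 / b"
    have r: "r > s" unfolding r_def using n b by (simp add: field_simps)
    have lo: "b * r ^ (2 ^ n) \<le> a n" for n
    proof (induction n)
      case 0 then show ?case unfolding r_def using b by simp
    next
      case (Suc n)
      have "b * (b * r ^ (2 ^ Suc n)) = (b * r ^ (2 ^ n))\<^sup>2"
        by (simp add: power2_eq_square power_mult mult.commute[of 2] power_mult_distrib)
      also have "\<dots> \<le> (a n)\<^sup>2" using Suc b r s by (intro power_mono) auto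
      also have "\<dots> \<le> b * a (Suc n)" by (rule step)
      finally show ?case using b by simp
    qed
    have "1 < r / s" using r s by simp
    then obtain n where "C / b < (r / s) ^ n" using real_arch_pow by blast
    also have "\<dots> \<le> (r / s) ^ (2 ^ n)" using \<open>1 < r / s\<close> by (intro power_increasing) (auto simp: less_imp_le)
    finally have "C * s ^ (2 ^ n) < b * r ^ (2 ^ n)"
      using b s by (simp add: power_divide field_simps)
    then show False using bd[of n] lo[of n] by linarith
  qed
qed

text \<open>The list is a formal sum of tensors \<open>x \<otimes> \<xi>\<close>. The same formal
  sum can be evaluated with \<open>p\<close> and with another operator \<open>R\<close>, before it
  is known that the first value determines the second.\<close>

definition op_sum :: "('a::complex_hilbert_space \<Rightarrow> 'a) \<Rightarrow> (('a \<Rightarrow> 'a) \<times> 'a) list \<Rightarrow> 'a" where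
  "op_sum R l = (\<Sum>(x, \<xi>)\<leftarrow>l. x (R \<xi>))"

lemma op_sum_simps:
  "op_sum R [] = 0" "op_sum R ((x, \<xi>) # l) = x (R \<xi>) + op_sum R l" "op_sum R (l @ k) = op_sum R l + op_sum R k"
  unfolding op_sum_def by simp_all

lemma compression_cadjoint:
  assumes "von_neumann_algebra H M" "oproj p" "x \<in> compression p M"
  shows "cadjoint x \<in> compression p M"
proof -
  obtain y where y: "y \<in> M" "x = p \<circ> y \<circ> p" using assms(3) unfolding compression_def by blast
  have c: "clinop y" "clinop p" using vna_op(1)[OF assms(1) y(1)] oprojD(1)[OF assms(2)] .
  have "cadjoint x = p \<circ> cadjoint y \<circ> p"
    unfolding y(2) o_def
    by (simp add: cadjoint_compose[OF c(2) clinop_compose[OF c]] cadjoint_compose[OF c] oprojD(4)[OF assms(2)])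
  then show ?thesis using vnaD(3)[OF assms(1) y(1)] unfolding compression_def by blast
qed

lemma compression_subset_bounded_ops:
  assumes "von_neumann_algebra H M" "oproj p"
  shows "compression p M \<subseteq> bounded_ops (range p)"
  unfolding compression_def o_def
  using clinop_compose[OF oprojD(1)[OF assms(2)] clinop_compose[OF vna_op(1)[OF assms(1)] oprojD(1)[OF assms(2)]]]
  by (auto simp: bounded_ops_range_iff[OF assms(2)] oprojD[OF assms(2)])

section \<open>The commutant of a corner \<open>pMp\<close>\<close>

context
  fixes H :: "'a::complex_hilbert_space set" and M :: "('a \<Rightarrow> 'a) set" and p :: "'a \<Rightarrow> 'a"
  assumes M: "von_neumann_algebra H M" and pM: "projection_in M p"
begin

private lemmas P = projection_inD[OF M pM]
private lemmas PD = oprojD[OF P(2)]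
private abbreviation "N \<equiv> commutant (range p) (compression p M)"

lemma corner_commutantD:
  assumes "R \<in> N"
  shows "clinop R" "p (R v) = R v" "R (p v) = R v"
    "x \<in> M \<Longrightarrow> R (p (x (p v))) = p (x (R v))" "cadjoint R \<in> N"
proof -
  show *: "clinop R" "p (R v) = R v" "R (p v) = R v" for v
    using commutantD(1)[OF assms] unfolding bounded_ops_range_iff[OF P(2)] by auto
  show "R (p (x (p v))) = p (x (R v))" if "x \<in> M" for v
  proof -
    have "p \<circ> x \<circ> p \<in> compression p M" using that unfolding compression_def by blast
    from commutantD(2)[OF assms this, of v] show ?thesis by (simp add: *)
  qed
  show "cadjoint R \<in> N"
    using commutant_cadjoint[OF oproj_range(1)[OF P(2)] compression_subset_bounded_ops[OF M P(2)] _ assms]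
      compression_cadjoint[OF M P(2)] by blast
qed

lemma corner_commutant_compose: "R \<in> N \<Longrightarrow> S \<in> N \<Longrightarrow> (\<lambda>v. R (S v)) \<in> N"
  using commutant_compose[OF oproj_range(1)[OF P(2)] compression_subset_bounded_ops[OF M P(2)], of R S] .

text \<open>Pairing two summands brings together the adjoint of \<open>x\<close> and
  \<open>y\<close>; call the product \<open>z\<close>. Both \<open>R\<close> and \<open>R'\<close>
  live on the range of \<open>p\<close> and the adjoint of \<open>R\<close> commutes with
  \<open>p z p\<close>, so \<open>R\<close> moves across as its adjoint and leaves \<open>p\<close>
  behind.\<close>

lemma op_sum_inner:
  assumes R: "R \<in> N" "R' \<in> N" and k: "fst ` set k \<subseteq> M" and l: "fst ` set l \<subseteq> M"
  shows "op_sum R k \<bullet> op_sum R' l = op_sum p k \<bullet> op_sum (\<lambda>v. cadjoint R (R' v)) l"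
proof -
  have 1: "x (R \<xi>) \<bullet> y (R' \<eta>) = x (p \<xi>) \<bullet> y (cadjoint R (R' \<eta>))" if xy: "x \<in> M" "y \<in> M" for x y \<xi> \<eta>
  proof -
    note D = corner_commutantD[OF R(1)] and D' = corner_commutantD[OF R(2)]
      and Da = corner_commutantD[OF D(5)]
    define z where "z = (\<lambda>v. cadjoint x (y v))"
    have z: "z \<in> M" unfolding z_def using xy vna_closed(1)[OF M] vnaD(3)[OF M] by blast
    have "x (R \<xi>) \<bullet> y (R' \<eta>) = p (R \<xi>) \<bullet> z (R' \<eta>)"
      unfolding z_def cadjoint_inner[OF vna_op(1)[OF M xy(1)]] D(2) ..
    also have "\<dots> = \<xi> \<bullet> cadjoint R (p (z (p (R' \<eta>))))"
      unfolding PD(3) cadjoint_inner[OF D(1)] D'(2) ..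
    also have "\<dots> = \<xi> \<bullet> p (z (cadjoint R (R' \<eta>)))" unfolding Da(4)[OF z] ..
    also have "\<dots> = x (p \<xi>) \<bullet> y (cadjoint R (R' \<eta>))"
      unfolding z_def cadjoint_inner[OF vna_op(1)[OF M xy(1)]] PD(3) ..
    finally show ?thesis .
  qed
  have 2: "x (R \<xi>) \<bullet> op_sum R' l = x (p \<xi>) \<bullet> op_sum (\<lambda>v. cadjoint R (R' v)) l" if "x \<in> M" for x \<xi>
    using l
  proof (induction l)
    case (Cons a l) then show ?case
      using 1[OF that, of "fst a"] by (cases a) (simp add: op_sum_simps inner_add_right)
  qed (simp add: op_sum_simps)
  show ?thesis using k
  proof (induction k)
    case (Cons a k) then show ?case
      using 2[of "fst a"] by (cases a) (simp add: op_sum_simps inner_add_left)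
  qed (simp add: op_sum_simps)
qed

text \<open>
  With \<open>S = T\<^sup>*T\<close>, the Cauchy-Schwarz inequality for the form \<open>\<langle>op_sum p l, op_sum R l\<rangle>\<close>, applied to
  \<open>S, S\<^sup>2, S\<^sup>4, \<dots>\<close>, replaces the square root of a positive operator.
\<close>
lemma op_sum_bound:
  assumes T: "T \<in> N"
  obtains c where "c \<ge> 0" "\<And>l. fst ` set l \<subseteq> M \<Longrightarrow> norm (op_sum T l) \<le> c * norm (op_sum p l)"
proof -
  define S where "S = (\<lambda>v. cadjoint T (T v))"
  have SN: "S \<in> N" unfolding S_def by (rule corner_commutant_compose[OF corner_commutantD(5)[OF T] T])
  have Tc: "clinop T" by (rule corner_commutantD(1)[OF T])
  have Sa: "cadjoint S = S" unfolding S_def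
    by (simp add: cadjoint_compose clinop_cadjoint Tc cadjoint_cadjoint)
  obtain s where s: "s > 0" "\<And>x. norm (S x) \<le> norm x * s"
    using bounded_linear.pos_bounded[OF clinopD(1)[OF corner_commutantD(1)[OF SN]]] by auto
  \<comment> \<open>Iterated squaring: \<open>V n\<close> is \<open>S\<close> to the power
    \<open>2^n\<close>, so one Cauchy-Schwarz step leads from \<open>V n\<close> to
    \<open>V (Suc n)\<close>.\<close>
  define V where "V n = ((\<lambda>R v. R (R v)) ^^ n) S" for n :: nat
  have V0: "V 0 = S" and VS: "V (Suc n) = (\<lambda>v. V n (V n v))" for n unfolding V_def by simp_all
  have V: "V n \<in> N \<and> cadjoint (V n) = V n \<and> (\<forall>x. norm (V n x) \<le> norm x * s ^ (2 ^ n))" for n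
  proof (induction n)
    case 0 then show ?case using SN Sa s by (simp add: V0)
  next
    case (Suc n)
    have "norm (V n (V n x)) \<le> norm x * s ^ (2 ^ Suc n)" for x
    proof -
      have "norm (V n (V n x)) \<le> norm (V n x) * s ^ (2 ^ n)" using Suc by blast
      also have "\<dots> \<le> (norm x * s ^ (2 ^ n)) * s ^ (2 ^ n)" using Suc s(1) by (intro mult_right_mono) auto
      also have "\<dots> = norm x * s ^ (2 ^ Suc n)" by (simp add: power_add[symmetric] mult_2)
      finally show ?thesis .
    qed
    then show ?case
      using Suc corner_commutantD(1)[of "V n"] corner_commutant_compose[of "V n" "V n"]
      unfolding VS by (simp add: cadjoint_compose)
  qed
  have "norm (op_sum T l) \<le> sqrt s * norm (op_sum p l)" if l: "fst ` set l \<subseteq> M" for l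
  proof -
    define b where "b = norm (op_sum p l)"
    define a where "a n = norm (op_sum (V n) l)" for n
    have CS: "(norm (op_sum R l))\<^sup>2 \<le> b * norm (op_sum (\<lambda>v. cadjoint R (R v)) l)" if "R \<in> N" for R
      unfolding power2_norm_eq_inner op_sum_inner[OF that that l l] b_def by (rule norm_cauchy_schwarz)
    \<comment> \<open>\<open>C\<close> may depend on the list \<open>l\<close> but not on
      \<open>n\<close>. The doubling argument removes it, which makes the final constant
      \<open>sqrt s\<close> uniform in \<open>l\<close>.\<close>
    have "\<exists>C. \<forall>n. a n \<le> C * s ^ (2 ^ n)"
      using l unfolding a_def
    proof (induction l)
      case Nil then show ?case by (auto simp: op_sum_simps intro: exI[of _ 0])
    next
      case (Cons z l)
      obtain x \<xi> where z: "z = (x, \<xi>)" by (cases z)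
      obtain C where C: "\<And>n. norm (op_sum (V n) l) \<le> C * s ^ (2 ^ n)" using Cons by auto
      have "clinop x" using Cons.prems vna_op(1)[OF M] by (auto simp: z)
      then obtain K where K: "K \<ge> 0" "\<And>v. norm (x v) \<le> norm v * K"
        using bounded_linear.nonneg_bounded[OF clinopD(1)] by blast
      have "norm (op_sum (V n) (z # l)) \<le> (norm \<xi> * K + C) * s ^ (2 ^ n)" for n
      proof -
        have "norm (x (V n \<xi>)) \<le> norm (V n \<xi>) * K" by (rule K(2))
        also have "\<dots> \<le> (norm \<xi> * s ^ (2 ^ n)) * K" using V K(1) by (intro mult_right_mono) auto
        finally show ?thesis
          using norm_triangle_ineq[of "x (V n \<xi>)" "op_sum (V n) l"] C[of n]
          by (simp add: z op_sum_simps algebra_simps)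
      qed
      then show ?case by blast
    qed
    then obtain C where "\<And>n. a n \<le> C * s ^ (2 ^ n)" by blast
    then have "a 0 \<le> s * b"
    proof (intro doubling_sequence_bound[of a b C s])
      show "(a n)\<^sup>2 \<le> b * a (Suc n)" for n using CS[of "V n"] V[of n] unfolding a_def VS by simp
    qed (auto simp: a_def b_def s(1))
    then have "b * a 0 \<le> b * (s * b)" by (intro mult_left_mono) (auto simp: b_def)
    then have "(norm (op_sum T l))\<^sup>2 \<le> s * b\<^sup>2"
      using CS[OF T] unfolding a_def V0 S_def by (simp add: power2_eq_square algebra_simps)
    also have "\<dots> = (sqrt s * b)\<^sup>2" using s(1) by (simp add: power_mult_distrib)
    finally show ?thesis unfolding b_def by (rule power2_le_imp_le) (use s(1) in simp)
  qed
  then show ?thesis using that[of "sqrt s"] s(1) by simp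
qed

text \<open>The extension is \<open>x p \<xi> \<mapsto> x T \<xi>\<close> on the closed span of \<open>M p H\<close>, and \<open>0\<close> on its complement.\<close>
lemma corner_commutant_extension:
  assumes T: "T \<in> N"
  obtains S where "S \<in> commutant H M" "\<And>v. S (p v) = T v"
    "\<And>y v. y \<in> commutant H M \<Longrightarrow> (\<And>v. T (y v) = y (T v)) \<Longrightarrow> S (y v) = y (S v)"
proof -
  note H = vnaD(1)[OF M]
  note D = corner_commutantD[OF T]
  obtain c where c: "c \<ge> 0" "\<And>l. fst ` set l \<subseteq> M \<Longrightarrow> norm (op_sum T l) \<le> c * norm (op_sum p l)"
    using op_sum_bound[OF T] by blast
  define G where "G = {(op_sum p l, op_sum T l) |l. fst ` set l \<subseteq> M}"
  have GI: "(u, v) \<in> G" if "fst ` set l \<subseteq> M" "u = op_sum p l" "v = op_sum T l" for u v l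
    using that unfolding G_def by blast
  have scale: "op_sum R (map (\<lambda>(x, \<xi>). (x, y \<xi>)) l) = y (op_sum R l)"
    if "fst ` set l \<subseteq> M" "\<And>x v. x \<in> M \<Longrightarrow> y (x v) = x (y v)" "\<And>v. R (y v) = y (R v)"
      "y 0 = 0" "\<And>u v. y (u + v) = y u + y v" for y R l
    using that(1) by (induction l) (auto simp: op_sum_simps that(2-5))
  have mult: "op_sum R (map (\<lambda>(y, \<xi>). (\<lambda>v. x (y v), \<xi>)) l) = x (op_sum R l)" if "clinop x" for x R l
    by (induction l) (auto simp: op_sum_simps clinopD[OF that])
  have maps: "fst ` set (map (\<lambda>(x, \<xi>). (x, y \<xi>)) l) \<subseteq> M" if "fst ` set l \<subseteq> M" for y l using that by auto
  have mapm: "fst ` set (map (\<lambda>(y, \<xi>). (\<lambda>v. x (y v), \<xi>)) l) \<subseteq> M" if "fst ` set l \<subseteq> M" "x \<in> M" for x l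
    using that vna_closed(1)[OF M] by auto
  have scale_r: "(r *\<^sub>R u, r *\<^sub>R v) \<in> G" if "(u, v) \<in> G" for r u v
  proof -
    obtain l where l: "fst ` set l \<subseteq> M" "u = op_sum p l" "v = op_sum T l" using \<open>(u, v) \<in> G\<close> unfolding G_def by blast
    show ?thesis
      by (rule GI[OF maps[OF l(1)]]; subst scale[OF l(1)])
        (auto simp: l clinopD[OF vna_op(1)[OF M]] clinopD[OF PD(1)] clinopD[OF D(1)] scaleR_add_right)
  qed
  have subG: "subspace G" unfolding subspace_def
  proof (intro conjI ballI allI)
    show "0 \<in> G" by (simp add: zero_prod_def, rule GI[of "[]"]) (auto simp: op_sum_simps)
    show "x + y \<in> G" if xy: "x \<in> G" "y \<in> G" for x y
    proof -
      obtain l k where "fst ` set l \<subseteq> M" "fst ` set k \<subseteq> M" "x = (op_sum p l, op_sum T l)" "y = (op_sum p k, op_sum T k)"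
        using xy unfolding G_def by blast
      then show ?thesis by (simp, intro GI[of "l @ k"]) (simp_all add: op_sum_simps image_Un)
    qed
    show "r *\<^sub>R x \<in> G" if "x \<in> G" for r x using scale_r that by (cases x) auto
  qed
  have bdG: "norm v \<le> c * norm u" if "(u, v) \<in> G" for u v using that c(2) unfolding G_def by blast
  obtain S where S: "bounded_linear S" "\<And>u v. (u, v) \<in> G \<Longrightarrow> S u = v"
    "\<And>w. \<forall>z\<in>G. w \<bullet> fst z = 0 \<Longrightarrow> S w = 0" "\<And>w. S w \<in> closure (snd ` G)"
  proof (rule bounded_graph_extension[OF subG bdG c(1)])
    fix S assume "bounded_linear S" "\<And>u v. (u, v) \<in> G \<Longrightarrow> S u = v"
      "\<And>w. \<forall>z\<in>G. w \<bullet> fst z = 0 \<Longrightarrow> S w = 0" "\<And>w. S w \<in> closure (snd ` G)"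
    then show thesis by (rule that)
  qed
  have S5: "S (R w) = R (S w)" if "bounded_linear R" "\<And>x y. R x \<bullet> y = x \<bullet> R' y"
    "\<And>u v. (u, v) \<in> G \<Longrightarrow> (R u, R v) \<in> G" "\<And>u v. (u, v) \<in> G \<Longrightarrow> R' u \<in> fst ` G" for R R' w
    by (rule graph_extension_commute) (fact subG S that)+
  have opH: "op_sum R l \<in> H" if "fst ` set l \<subseteq> M" for R l
    using that by (induction l) (auto simp: op_sum_simps csubspaceD[OF H] vna_op(2)[OF M])
  \<comment> \<open>The extension is real linear by construction. Complex homogeneity is commutation
    with multiplication by a scalar, whose real adjoint is multiplication by the conjugate.\<close>
  have sc: "S (c *\<^sub>C w) = c *\<^sub>C S w" for c w
  proof (rule S5[OF bounded_linear_scaleC inner_scaleC_left])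
    fix u v assume "(u, v) \<in> G"
    then obtain l where l: "fst ` set l \<subseteq> M" "u = op_sum p l" "v = op_sum T l" unfolding G_def by blast
    have *: "(c *\<^sub>C u, c *\<^sub>C v) \<in> G" for c
      by (rule GI[OF maps[OF l(1)]]; subst scale[OF l(1)])
        (auto simp: l clinopD[OF vna_op(1)[OF M]] clinopD[OF PD(1)] clinopD[OF D(1)] scaleC_add_right scaleC_zero_right)
    show "(c *\<^sub>C u, c *\<^sub>C v) \<in> G" "cnj c *\<^sub>C u \<in> fst ` G" using * by force+
  qed
  \<comment> \<open>Left multiplication by \<open>x\<close> carries formal sums over
    \<open>M\<close> to formal sums over \<open>M\<close>, and so does the adjoint of
    \<open>x\<close>.\<close>
  have SM: "S (x w) = x (S w)" if x: "x \<in> M" for x w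
  proof (rule S5[OF clinopD(1)[OF vna_op(1)[OF M x]] cadjoint_inner[OF vna_op(1)[OF M x]]])
    fix u v assume "(u, v) \<in> G"
    then obtain l where l: "fst ` set l \<subseteq> M" "u = op_sum p l" "v = op_sum T l" unfolding G_def by blast
    have *: "(y u, y v) \<in> G" if "y \<in> M" for y
      by (rule GI[OF mapm[OF l(1) that]]) (simp_all add: l mult[OF vna_op(1)[OF M that]])
    show "(x u, x v) \<in> G" "cadjoint x u \<in> fst ` G" using *[OF x] *[OF vnaD(3)[OF M x]] by force+
  qed
  have Sc: "clinop S" unfolding clinop_def using S(1) sc by blast
  show ?thesis
  proof (rule that)
    show "S \<in> commutant H M"
    proof (rule commutantI)
      have "S w \<in> H" for w
      proof -
        have "closure (snd ` G) \<subseteq> H" using opH csubspaceD(2)[OF H] by (intro closure_minimal) (auto simp: G_def)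
        then show ?thesis using S(4) by blast
      qed
      moreover have "S (proj H w) = S w" for w
      proof -
        have "S (w - proj H w) = 0"
          by (rule S(3)) (use opH proj_orth[OF csubspaceD(1,2)[OF H]] in \<open>auto simp: G_def\<close>)
        then show ?thesis using clinopD(6)[OF Sc] by (metis right_minus_eq)
      qed
      ultimately show "S \<in> bounded_ops H" using Sc by (simp add: bounded_ops_iff[OF H])
    qed (use SM in simp)
    \<comment> \<open>\<open>proj H\<close> is the unit of \<open>M\<close>, so \<open>p v\<close>
      is itself a one-term sum.\<close>
    show "S (p v) = T v" for v
    proof (rule S(2), rule GI[of "[(proj H, v)]"])
      show "p v = op_sum p [(proj H, v)]" by (simp add: op_sum_simps vna_op(4)[OF M P(1)])
      show "T v = op_sum T [(proj H, v)]" using vna_op(4)[OF M P(1), of "T v"] by (simp add: op_sum_simps D)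
    qed (simp add: vna_closed[OF M])
    \<comment> \<open>An element of \<open>M'\<close> passes through \<open>x\<close> and
      \<open>p\<close> to the vectors of a formal sum. This clause is what later keeps lifts of
      central elements central.\<close>
    show "S (y v) = y (S v)" if y: "y \<in> commutant H M" and Ty: "\<And>v. T (y v) = y (T v)" for y v
    proof (rule S5)
      note M' = vna_commutant[OF M]
      show "bounded_linear y" "y u \<bullet> v = u \<bullet> cadjoint y v" for u v
        using vna_op(1)[OF M' y] by (auto simp: clinopD cadjoint_inner)
      fix u v assume "(u, v) \<in> G"
      then obtain l where l: "fst ` set l \<subseteq> M" "u = op_sum p l" "v = op_sum T l" unfolding G_def by blast
      have y': "cadjoint y \<in> commutant H M" by (rule vnaD(3)[OF M' y])
      have p: "op_sum p (map (\<lambda>(x, \<xi>). (x, y \<xi>)) l) = y (op_sum p l)" if y: "y \<in> commutant H M" for y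
        by (rule scale[OF l(1)]) (auto simp: commutantD(2)[OF y] P(1) clinopD[OF vna_op(1)[OF M' y]])
      have "op_sum T (map (\<lambda>(x, \<xi>). (x, y \<xi>)) l) = y (op_sum T l)"
        by (rule scale[OF l(1)]) (auto simp: commutantD(2)[OF y] Ty clinopD[OF vna_op(1)[OF M' y]])
      then show "(y u, y v) \<in> G" using p[OF y] by (intro GI[OF maps[OF l(1), of y]]) (simp_all add: l)
      show "cadjoint y u \<in> fst ` G"
        using GI[OF maps[OF l(1), of "cadjoint y"] refl refl] p[OF y'] by (force simp: l)
    qed
  qed
qed

text \<open>The substantial inclusion is the extension of an operator commuting with
  \<open>pMp\<close> to an element of \<open>M'\<close>; the other holds because \<open>p\<close>
  belongs to \<open>M\<close> and so commutes with \<open>M'\<close>.\<close>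

lemma corner_commutant: "N = {y \<circ> p |y. y \<in> commutant H M}"
proof
  show "N \<subseteq> {y \<circ> p |y. y \<in> commutant H M}"
  proof
    fix T assume T: "T \<in> N"
    show "T \<in> {y \<circ> p |y. y \<in> commutant H M}"
    proof (rule corner_commutant_extension[OF T])
      fix S assume S: "S \<in> commutant H M" "\<And>v. S (p v) = T v"
      have "T = S \<circ> p" by (simp add: fun_eq_iff S(2))
      then show ?thesis using S(1) by blast
    qed
  qed
  show "{y \<circ> p |y. y \<in> commutant H M} \<subseteq> N"
  proof safe
    fix y assume y: "y \<in> commutant H M"
    have yc: "clinop y" using vna_op(1)[OF vna_commutant[OF M] y] .
    note c = commutantD(2)[OF y P(1)]
    show "y \<circ> p \<in> N"
    proof (rule commutantI)
      show "y \<circ> p \<in> bounded_ops (range p)"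
        unfolding bounded_ops_range_iff[OF P(2)] using clinop_compose[OF yc PD(1)] by (auto simp: c PD o_def)
      show "x ((y \<circ> p) v) = (y \<circ> p) (x v)" if "x \<in> compression p M" for x v
        using that commutantD(2)[OF y] P(1) unfolding compression_def by (auto simp: PD)
    qed
  qed
qed

text \<open>An operator on the range of \<open>p\<close> that commutes with \<open>M'p\<close>
  commutes with \<open>M'\<close> once extended by zero. It then lies in the bicommutant of
  \<open>M\<close>, which is \<open>M\<close>, and is its own compression.\<close>

lemma commutant_reduced_commutant: "commutant (range p) {y \<circ> p |y. y \<in> commutant H M} = compression p M"
proof
  show "compression p M \<subseteq> commutant (range p) {y \<circ> p |y. y \<in> commutant H M}"
    unfolding corner_commutant[symmetric] by (rule bicommutant_subset[OF compression_subset_bounded_ops[OF M P(2)]])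
  show "commutant (range p) {y \<circ> p |y. y \<in> commutant H M} \<subseteq> compression p M"
  proof
    fix T assume T: "T \<in> commutant (range p) {y \<circ> p |y. y \<in> commutant H M}"
    have b: "clinop T" "p (T v) = T v" "T (p v) = T v" for v
      using commutantD(1)[OF T] unfolding bounded_ops_range_iff[OF P(2)] by auto
    have "T \<in> commutant H (commutant H M)"
    proof (rule commutantI)
      have "T v \<in> H" "T (proj H v) = T v" for v
        using vna_op(2)[OF M P(1), of "T v"] vna_op(3)[OF M P(1), of v] b by metis+
      then show "T \<in> bounded_ops H" unfolding bounded_ops_iff[OF vnaD(1)[OF M]] using b by blast
      fix y v assume y: "y \<in> commutant H M"
      have "(y \<circ> p) (T v) = T ((y \<circ> p) v)" by (rule commutantD(2)[OF T]) (use y in blast)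
      then show "y (T v) = T (y v)" by (simp add: b flip: commutantD(2)[OF y P(1)])
    qed
    then have "T \<in> M" unfolding vnaD(4)[OF M] .
    moreover have "T = p \<circ> T \<circ> p" by (simp add: fun_eq_iff b)
    ultimately show "T \<in> compression p M" unfolding compression_def by blast
  qed
qed

lemma von_neumann_algebra_corner: "von_neumann_algebra (range p) (compression p M)"
  and von_neumann_algebra_reduced_commutant: "von_neumann_algebra (range p) {y \<circ> p |y. y \<in> commutant H M}"
proof -
  show 1: "von_neumann_algebra (range p) {y \<circ> p |y. y \<in> commutant H M}"
    unfolding corner_commutant[symmetric]
    by (intro von_neumann_algebra_commutant oproj_range P compression_subset_bounded_ops[OF M] compression_cadjoint[OF M])
  show "von_neumann_algebra (range p) (compression p M)"
    using vna_commutant[OF 1] unfolding commutant_reduced_commutant .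
qed

end

section \<open>Corners of standard forms\<close>

locale std_form =
  fixes M :: "('a::complex_hilbert_space \<Rightarrow> 'a) set" and H J P
  assumes std: "standard_form M H J P"
begin

abbreviation "M' \<equiv> commutant H M"

lemma vna: "von_neumann_algebra H M" and conj_J: "conjugation_on H J" and self_dual: "self_dual_cone H P"
  and M'_eq: "{J \<circ> x \<circ> J |x. x \<in> M} = M'" and J_P: "\<xi> \<in> P \<Longrightarrow> J \<xi> = \<xi>"
  and cone_invariant: "x \<in> M \<Longrightarrow> \<xi> \<in> P \<Longrightarrow> x (J (x (J \<xi>))) \<in> P"
  and center: "c \<in> M \<Longrightarrow> c \<in> M' \<Longrightarrow> J \<circ> c \<circ> J = cadjoint c"
  using std unfolding standard_form_def by auto

lemmas H = vnaD(1)[OF vna]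
lemmas SH = csubspaceD(1,2)[OF H]
lemmas vna' = vna_commutant[OF vna]
lemmas M_op = vna_op[OF vna]
lemmas M_lin = clinopD[OF M_op(1)]
lemmas M'_op = vna_op[OF vna']
lemmas M_closed = vna_closed[OF vna]

lemma M_D: "x \<in> M \<Longrightarrow> x v \<in> H" "x \<in> M \<Longrightarrow> proj H (x v) = x v" "x \<in> M \<Longrightarrow> x (proj H v) = x v"
  "x \<in> M \<Longrightarrow> y \<in> M' \<Longrightarrow> x (y v) = y (x v)"
  using M_op commutantD(2) by auto

lemma J_simps: "J (x + y) = J x + J y" "J (c *\<^sub>C x) = cnj c *\<^sub>C J x" "J x \<in> H" "J (r *\<^sub>R x) = r *\<^sub>R J x"
  "J 0 = 0" "J (- x) = - J x" "J (x - y) = J x - J y" "J (proj H x) = J x" "J (J x) = proj H x" "proj H (J x) = J x"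
proof -
  note c = conj_J[unfolded conjugation_on_def]
  show add: "J (x + y) = J x + J y" for x y using c by blast
  show sc: "J (c *\<^sub>C x) = cnj c *\<^sub>C J x" for c x using c by blast
  show JH: "J x \<in> H" for x using c by blast
  show sr: "J (r *\<^sub>R x) = r *\<^sub>R J x" for r x using sc[of "complex_of_real r" x] by (simp add: scaleC_of_real)
  from sr[of 0 0] show "J 0 = 0" by simp
  show mi: "J (- x) = - J x" for x using sr[of "-1" x] by simp
  show di: "J (x - y) = J x - J y" for x y using add[of x "-y"] mi[of y] by simp
  have "x - proj H x \<in> orth H" using proj_orth[OF SH] by (simp add: orth_eq_inner[OF H])
  then have "J (x - proj H x) = 0" using c by blast
  then show p: "J (proj H x) = J x" by (simp add: di)
  have "J (J (proj H x)) = proj H x" using c proj_in[OF SH] by blast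
  then show "J (J x) = proj H x" by (simp add: p)
  show "proj H (J x) = J x" using proj_ident[OF SH JH] .
qed

lemma J_sum: "J (sum f A) = (\<Sum>i\<in>A. J (f i))"
  by (induction A rule: infinite_finite_induct) (auto simp: J_simps)

text \<open>Polarization turns the isometry into preservation of the real inner product; since
  \<open>J\<close> squares to the identity of \<open>H\<close>, it is symmetric for that
  product.\<close>

lemma J_inner: "J x \<bullet> y = x \<bullet> J y"
proof -
  have n: "norm (J x) = norm x" if "x \<in> H" for x using conj_J that unfolding conjugation_on_def by blast
  have "J x \<bullet> J y = x \<bullet> y" if xy: "x \<in> H" "y \<in> H" for x y
  proof -
    have e: "x \<bullet> y = ((norm (x + y))\<^sup>2 - (norm x)\<^sup>2 - (norm y)\<^sup>2) / 2" for x y :: 'a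
      by (simp add: power2_norm_eq_inner inner_simps inner_commute)
    show ?thesis unfolding e[of "J x"] e[of x] using n[OF xy(1)] n[OF xy(2)] n[OF csubspaceD(5)[OF H xy]]
      by (simp add: J_simps)
  qed
  from this[of "J x" "proj H y"] this[of "J x" "J y"] have "J x \<bullet> proj H y = proj H x \<bullet> J y"
    by (simp add: J_simps proj_in[OF SH])
  then show ?thesis by (simp add: J_simps proj_inner[OF SH] flip: proj_inner[OF SH, of "J x"])
qed

lemma bounded_linear_J: "bounded_linear J"
proof (rule bounded_linear_intro[of _ 1])
  show "norm (J x) \<le> norm x * 1" for x
  proof -
    have "norm (J (proj H x)) = norm (proj H x)"
      using conj_J proj_in[OF SH] unfolding conjugation_on_def by blast
    then show ?thesis using norm_proj_le[OF SH, of x] by (simp add: J_simps)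
  qed
qed (simp_all add: J_simps)

lemma J_conj_in_commutant: "x \<in> M \<Longrightarrow> (\<lambda>v. J (x (J v))) \<in> M'"
  using M'_eq by (auto simp: comp_def)

lemma J_commute: "x \<in> M \<Longrightarrow> y \<in> M \<Longrightarrow> x (J (y (J v))) = J (y (J (x v)))"
  using M_D(4)[OF _ J_conj_in_commutant] by blast

lemma commutant_cases:
  assumes "y \<in> M'"
  obtains x where "x \<in> M" "y = (\<lambda>v. J (x (J v)))"
  using assms unfolding M'_eq[symmetric] by (auto simp: comp_def)

lemma P_H: "\<xi> \<in> P \<Longrightarrow> \<xi> \<in> H"
  using self_dual unfolding self_dual_cone_def by blast

text \<open>Vectors fixed by \<open>J\<close> have real inner products: \<open>J\<close> is
  symmetric for the real product and changes the sign of \<open>i \<xi>\<close>. So the complex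
  positivity condition of the self-dual cone becomes a real one, to which nearest-point arguments
  apply.\<close>

lemma P_iff: "\<xi> \<in> P \<longleftrightarrow> \<xi> \<in> H \<and> J \<xi> = \<xi> \<and> (\<forall>\<eta>\<in>P. \<xi> \<bullet> \<eta> \<ge> 0)"
proof -
  have P: "\<xi> \<in> P \<longleftrightarrow> \<xi> \<in> H \<and> (\<forall>\<eta>\<in>P. cinner \<xi> \<eta> \<in> \<real>\<^sub>\<ge>\<^sub>0)" for \<xi>
    using self_dual unfolding self_dual_cone_def by blast
  have im: "Im (cinner \<xi> \<eta>) = 0" if "J \<xi> = \<xi>" "J \<eta> = \<eta>" for \<xi> \<eta>
  proof -
    have "((- \<i>) *\<^sub>C \<xi>) \<bullet> \<eta> = J ((- \<i>) *\<^sub>C \<xi>) \<bullet> \<eta>" by (simp only: J_inner that)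
    also have "\<dots> = - (((- \<i>) *\<^sub>C \<xi>) \<bullet> \<eta>)" by (simp add: J_simps that scaleC_minus_left)
    finally show ?thesis by (simp add: Im_cinner)
  qed
  show ?thesis
  proof
    assume x: "\<xi> \<in> P"
    then show "\<xi> \<in> H \<and> J \<xi> = \<xi> \<and> (\<forall>\<eta>\<in>P. \<xi> \<bullet> \<eta> \<ge> 0)"
      using P[of \<xi>] J_P by (auto simp: complex_nonneg_Reals_iff Re_cinner)
  next
    assume "\<xi> \<in> H \<and> J \<xi> = \<xi> \<and> (\<forall>\<eta>\<in>P. \<xi> \<bullet> \<eta> \<ge> 0)"
    then show "\<xi> \<in> P" using P[of \<xi>] J_P im by (auto simp: complex_nonneg_Reals_iff Re_cinner)
  qed
qed

lemma P_I: "\<xi> \<in> H \<Longrightarrow> J \<xi> = \<xi> \<Longrightarrow> (\<And>\<eta>. \<eta> \<in> P \<Longrightarrow> \<xi> \<bullet> \<eta> \<ge> 0) \<Longrightarrow> \<xi> \<in> P"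
  using P_iff by blast

lemma P_inner: "\<xi> \<in> P \<Longrightarrow> \<eta> \<in> P \<Longrightarrow> \<xi> \<bullet> \<eta> \<ge> 0"
  using P_iff by blast

lemma P_closed: "closed P" and P_add: "\<xi> \<in> P \<Longrightarrow> \<eta> \<in> P \<Longrightarrow> \<xi> + \<eta> \<in> P"
  and P_scale: "t \<ge> 0 \<Longrightarrow> \<xi> \<in> P \<Longrightarrow> t *\<^sub>R \<xi> \<in> P" and P_0: "0 \<in> P"
proof -
  show "closed P" using self_dual unfolding self_dual_cone_def by blast
  show "0 \<in> P" by (rule P_I) (simp_all add: csubspaceD[OF H] J_simps)
  show "\<xi> \<in> P \<Longrightarrow> \<eta> \<in> P \<Longrightarrow> \<xi> + \<eta> \<in> P"
    by (rule P_I) (simp_all add: csubspaceD[OF H] J_simps inner_add_left P_H J_P P_inner)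
  show "t \<ge> 0 \<Longrightarrow> \<xi> \<in> P \<Longrightarrow> t *\<^sub>R \<xi> \<in> P"
    by (rule P_I) (simp_all add: csubspaceD[OF H] J_simps P_H J_P P_inner)
qed

lemma P_pointed:
  assumes "\<xi> \<in> P" "- \<xi> \<in> P"
  shows "\<xi> = 0"
proof -
  have "- \<xi> \<bullet> \<xi> \<ge> 0" using assms(2,1) by (rule P_inner)
  then show ?thesis using inner_ge_zero[of \<xi>] by (simp add: order_antisym)
qed

end

section \<open>The corner determined by \<open>q = pJpJ\<close>\<close>

locale std_form_projection = std_form +
  fixes p q
  assumes p: "projection_in M p" and q_def: "q = p \<circ> J \<circ> p \<circ> J"
begin

definition e :: "'a \<Rightarrow> 'a" where "e v = J (p (J v))"

lemmas pM = projection_inD(1)[OF vna p]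
lemmas p_oproj = projection_inD(2)[OF vna p]
lemmas p_simps = oprojD[OF p_oproj] clinopD[OF oprojD(1)[OF p_oproj]] M_D(1-3)[OF pM]

lemma e_M': "e \<in> M'"
  using J_conj_in_commutant[OF pM] unfolding e_def .

lemma e_commute: "x \<in> M \<Longrightarrow> x (e v) = e (x v)"
  using M_D(4)[OF _ e_M'] .

lemma e_oproj: "oproj e"
  unfolding oproj_def
proof (intro conjI allI)
  show "clinop e" using M'_op(1)[OF e_M'] .
  show "e (e v) = e v" for v by (simp add: e_def J_simps p_simps)
  show "e v \<bullet> w = v \<bullet> e w" for v w by (simp add: e_def J_inner p_simps(3))
qed

lemmas e_simps = oprojD[OF e_oproj] clinopD[OF oprojD(1)[OF e_oproj]]

lemma q_eq: "q v = p (e v)" "q v = e (p v)"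
  by (simp_all add: q_def e_commute[OF pM] flip: e_def)

lemma q_oproj: "oproj q"
  unfolding oproj_def
proof (intro conjI allI)
  show "clinop q" using clinop_compose[OF p_simps(1) e_simps(1)] by (simp add: q_eq(1)[abs_def])
  show "q (q v) = q v" for v by (metis q_eq p_simps(2) e_simps(2))
  show "q v \<bullet> w = v \<bullet> q w" for v w by (simp add: q_eq(1)[of v] q_eq(2)[of w] p_simps(3) e_simps(3))
qed

lemmas q_simps = oprojD[OF q_oproj] clinopD[OF oprojD(1)[OF q_oproj]]

lemma pq: "p (q v) = q v" "q (p v) = q v" "e (q v) = q v" "q (e v) = q v"
  by (metis q_eq p_simps(2) e_simps(2))+

lemma q_J: "q (J v) = J (q v)"
  by (simp add: q_eq(1)[of "J v"] q_eq(2)[of v] e_def J_simps p_simps)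

lemma q_proj: "q (proj H v) = q v" "proj H (q v) = q v" "q v \<in> H"
  by (simp_all add: q_eq e_def J_simps p_simps)

lemma q_image: "q ` H = range q"
proof
  show "range q \<subseteq> q ` H" using q_proj(1) proj_in[OF SH] by (metis image_iff image_subsetI)
qed auto

text \<open>This is the commutant of \<open>pMp\<close>. The projection \<open>q = e p\<close> in
  general belongs neither to \<open>M\<close> nor to \<open>M'\<close>, but it lies in
  \<open>B\<close>, so the reduction theory can be applied a second time.\<close>

definition B where "B = {y \<circ> p |y. y \<in> M'}"

lemma B_vna: "von_neumann_algebra (range p) B" "commutant (range p) B = compression p M"
  unfolding B_def
  by (rule von_neumann_algebra_reduced_commutant[OF vna p], rule commutant_reduced_commutant[OF vna p])

lemma q_B: "projection_in B q"
proof (rule projection_inI[OF q_oproj])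
  have "q = e \<circ> p" by (simp add: fun_eq_iff q_eq(2))
  then show "q \<in> B" unfolding B_def using e_M' by blast
qed

lemma compression_q_eq: "{y \<circ> q |y. y \<in> compression p M} = compression q M"
proof -
  have "p \<circ> x \<circ> p \<circ> q = q \<circ> x \<circ> q" if "x \<in> M" for x
    by (simp add: fun_eq_iff pq q_eq(1)[of "x _"] flip: e_commute[OF that])
  then show ?thesis unfolding compression_def by auto metis
qed

lemma compression_q_B: "compression q B = compression q M'"
proof -
  have "q \<circ> y \<circ> q = q \<circ> (y \<circ> p) \<circ> q" for y by (simp add: fun_eq_iff pq)
  moreover have "B = (\<lambda>y. y \<circ> p) ` M'" "compression q A = (\<lambda>x. q \<circ> x \<circ> q) ` A" for A
    unfolding B_def compression_def by blast+
  ultimately show ?thesis by (simp only: image_image)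
qed

text \<open>Reduction in two steps: from \<open>M\<close> to \<open>pMp\<close> by \<open>p\<close>,
  then from \<open>B\<close> by its projection \<open>q\<close>. The reduced commutant
  \<open>(pMp)q\<close> of the second step is \<open>qMq\<close>, and the corner \<open>qBq\<close>
  is \<open>qM'q\<close>.\<close>

lemma corner_vna: "von_neumann_algebra (range q) (compression q M)"
  and corner_vna_commutant: "commutant (range q) (compression q M) = compression q M'"
  using von_neumann_algebra_reduced_commutant[OF B_vna(1) q_B] commutant_reduced_commutant[OF B_vna(1) q_B]
  unfolding B_vna(2) compression_q_eq compression_q_B by auto

lemma compression_p_M:
  assumes "y \<in> compression p M"
  shows "y \<in> M" "p (y v) = y v" "y (p v) = y v"
proof -
  obtain x where x: "x \<in> M" "y = (\<lambda>v. p (x (p v)))" using assms unfolding compression_def comp_def by blast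
  show "y \<in> M" unfolding x(2) using M_closed(1)[OF pM M_closed(1)[OF x(1) pM]] .
  show "p (y v) = y v" "y (p v) = y v" by (simp_all add: x(2) p_simps)
qed

lemma q_commute: "y \<in> compression p M \<Longrightarrow> q (y v) = y (q v)"
  using compression_p_M by (metis q_eq e_commute)

text \<open>The extension result is applied twice. Being in the commutant of \<open>qBq\<close>,
  \<open>c\<close> extends to an element of \<open>pMp\<close>, which is central there because
  \<open>c\<close> commutes with \<open>pMp\<close>. That element extends to one of
  \<open>M'\<close> which commutes with \<open>M'\<close>, hence to a central element of
  \<open>M\<close>.\<close>

lemma corner_center:
  assumes c: "c \<in> compression q M" "c \<in> compression q M'"
  obtains S where "S \<in> M" "S \<in> M'" "c = q \<circ> S \<circ> q"
proof -
  have cb: "q (c v) = c v" "c (q v) = c v" for v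
    using c(1) by (auto simp: compression_def q_simps)
  have c': "c \<in> commutant (range q) (compression q M)" unfolding corner_vna_commutant by (rule c)
  have "c \<in> commutant (range q) (compression q B)"
    unfolding compression_q_B corner_vna_commutant[symmetric] vnaD(4)[OF corner_vna] by (rule c)
  from corner_commutant_extension[OF B_vna(1) q_B this]
  obtain S where S: "S \<in> compression p M" "\<And>v. S (q v) = c v"
    and Sc: "\<And>y v. y \<in> compression p M \<Longrightarrow> (\<And>v. c (y v) = y (c v)) \<Longrightarrow> S (y v) = y (S v)"
    unfolding B_vna(2) by metis
  have "c (y v) = y (c v)" if y: "y \<in> compression p M" for y v
  proof -
    have "q \<circ> y \<circ> q \<in> compression q M" using compression_p_M(1)[OF y] unfolding compression_def by blast
    from commutantD(2)[OF c' this, of v] show ?thesis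
      by (simp add: cb q_commute[OF y] q_simps(2)) (metis q_commute[OF y] cb)
  qed
  then have SS: "S (y v) = y (S v)" if "y \<in> compression p M" for y v using Sc that by blast
  have "S \<in> commutant (range p) (compression p M)"
    using S(1) compression_subset_bounded_ops[OF vna p_oproj] by (intro commutantI) (auto simp: SS)
  from corner_commutant_extension[OF vna p this]
  obtain R where R: "R \<in> M'" "\<And>v. R (p v) = S v"
    and Rc: "\<And>y v. y \<in> M' \<Longrightarrow> (\<And>v. S (y v) = y (S v)) \<Longrightarrow> R (y v) = y (R v)" by metis
  have "R \<in> commutant H M'"
    using Rc M_D(4)[OF compression_p_M(1)[OF S(1)]] commutantD(1)[OF R(1)] by (intro commutantI) auto
  then have "R \<in> M" unfolding vnaD(4)[OF vna] .
  moreover have "c = q \<circ> R \<circ> q" using R(2) S(2) cb by (metis (no_types, lifting) comp_apply ext pq(1))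
  ultimately show ?thesis using that R(1) by blast
qed

text \<open>That \<open>q\<close> maps \<open>P\<close> into itself is the invariance axiom of a
  standard form, applied to \<open>p\<close>.\<close>

lemma P_q: "q ` P = P \<inter> range q" "\<xi> \<in> P \<Longrightarrow> q \<xi> \<in> P"
proof -
  show *: "q \<xi> \<in> P" if "\<xi> \<in> P" for \<xi> using cone_invariant[OF pM that] by (simp add: q_def)
  show "q ` P = P \<inter> range q"
  proof
    show "P \<inter> range q \<subseteq> q ` P"
    proof
      fix \<xi> assume "\<xi> \<in> P \<inter> range q"
      then have "\<xi> = q \<xi>" "\<xi> \<in> P" by (auto simp: q_simps)
      then show "\<xi> \<in> q ` P" by (rule image_eqI)
    qed
  qed (use * in auto)
qed

text \<open>Unlike \<open>x\<close> in general, the lift \<open>b\<close> belongs to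
  \<open>M\<close>, and it represents the action through \<open>J\<close> as well because
  \<open>q\<close> commutes with \<open>b\<close> and with \<open>J\<close>. Conditions on the
  corner thereby become instances of conditions on \<open>M\<close>.\<close>

lemma corner_action:
  assumes "x \<in> compression q M"
  obtains b where "b \<in> compression p M" "\<And>v. x v = b (q v)" "\<And>v. q (J (x (q (J v)))) = J (b (J (q v)))"
proof -
  obtain b where b: "b \<in> compression p M" "x = b \<circ> q" using assms unfolding compression_q_eq[symmetric] by blast
  have "q (J (x (q (J v)))) = J (b (J (q v)))" for v
    by (simp add: b(2) q_simps(2) q_J q_commute[OF b(1)])
  then show ?thesis using that b by simp
qed

text \<open>Self-duality comes from \<open>qP = P \<inter> qH\<close> and the symmetry of
  \<open>q\<close>, invariance of the cone from lifts to \<open>pMp\<close>, and the condition on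
  the centre from lifting central elements to \<open>M\<close>, where \<open>J\<close> is known to
  act as the adjoint.\<close>

lemma corner_standard_form: "standard_form (compression q M) (range q) (q \<circ> J) (q ` P)"
  unfolding standard_form_def
proof (intro conjI ballI)
  note Hq = oproj_range(1)[OF q_oproj]
  show "von_neumann_algebra (range q) (compression q M)" by (rule corner_vna)
  show "conjugation_on (range q) (q \<circ> J)"
    unfolding conjugation_on_def
  proof (intro conjI allI ballI)
    show "(q \<circ> J) x = 0" if "x \<in> orth (range q)" for x
    proof -
      have "proj (range q) x = 0"
        using that proj_eq_0[OF csubspaceD(1,2)[OF Hq]] by (auto simp: orth_eq_inner[OF Hq])
      then show ?thesis by (simp add: oproj_range(2)[OF q_oproj] q_J J_simps)
    qed
    show "norm ((q \<circ> J) x) = norm x" if "x \<in> range q" for x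
    proof -
      have "norm (J x) = norm x" using conj_J that q_proj(3) unfolding conjugation_on_def by blast
      then show ?thesis using that by (auto simp: q_J q_simps)
    qed
    show "range (q \<circ> J) \<subseteq> range q" by auto
  qed (auto simp: J_simps q_simps q_J q_proj)
  show "self_dual_cone (range q) (q ` P)"
    unfolding self_dual_cone_def
  proof (intro conjI)
    show "closed (q ` P)" unfolding P_q(1) using P_closed csubspaceD(2)[OF Hq] by (rule closed_Int)
    show "convex (q ` P)" unfolding P_q(1) using self_dual
      unfolding self_dual_cone_def by (intro convex_Int subspace_imp_convex[OF csubspaceD(1)[OF Hq]]) auto
    show "cone (q ` P)" unfolding cone_def
    proof (intro ballI allI impI)
      fix x and c :: real assume "x \<in> q ` P" "c \<ge> 0"
      then obtain \<xi> where "\<xi> \<in> P" "x = q \<xi>" by blast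
      then have "c *\<^sub>R x = q (c *\<^sub>R \<xi>)" "c *\<^sub>R \<xi> \<in> P" using \<open>c \<ge> 0\<close> by (auto simp: q_simps P_scale)
      then show "c *\<^sub>R x \<in> q ` P" by blast
    qed
    show "q ` P = {\<xi> \<in> range q. \<forall>\<eta>\<in>q ` P. cinner \<xi> \<eta> \<in> \<real>\<^sub>\<ge>\<^sub>0}"
    proof -
      have P: "P = {\<xi>\<in>H. \<forall>\<eta>\<in>P. cinner \<xi> \<eta> \<in> \<real>\<^sub>\<ge>\<^sub>0}" using self_dual unfolding self_dual_cone_def by blast
      have c: "cinner (q \<xi>) (q \<eta>) = cinner (q \<xi>) \<eta>" for \<xi> \<eta>
        by (rule cinner_eqI) (simp add: q_simps(2,6) flip: q_simps(3))
      show ?thesis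
      proof (intro equalityI subsetI)
        fix \<xi> assume "\<xi> \<in> q ` P"
        then show "\<xi> \<in> {\<xi> \<in> range q. \<forall>\<eta>\<in>q ` P. cinner \<xi> \<eta> \<in> \<real>\<^sub>\<ge>\<^sub>0}" using P_q P by blast
      next
        fix \<xi> assume "\<xi> \<in> {\<xi> \<in> range q. \<forall>\<eta>\<in>q ` P. cinner \<xi> \<eta> \<in> \<real>\<^sub>\<ge>\<^sub>0}"
        then have "\<xi> \<in> range q" "\<forall>\<eta>\<in>P. cinner \<xi> \<eta> \<in> \<real>\<^sub>\<ge>\<^sub>0" using c by auto
        then have "\<xi> \<in> P" using q_proj(3) by (subst P) auto
        then show "\<xi> \<in> q ` P" unfolding P_q(1) using \<open>\<xi> \<in> range q\<close> by blast
      qed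
    qed
  qed
  show "{q \<circ> J \<circ> x \<circ> (q \<circ> J) |x. x \<in> compression q M} = commutant (range q) (compression q M)"
  proof -
    have "q \<circ> J \<circ> (q \<circ> x \<circ> q) \<circ> (q \<circ> J) = q \<circ> (J \<circ> x \<circ> J) \<circ> q" for x
      by (simp add: fun_eq_iff q_simps(2) q_J flip: q_J)
    then have "{q \<circ> J \<circ> x \<circ> (q \<circ> J) |x. x \<in> compression q M} = compression q {J \<circ> x \<circ> J |x. x \<in> M}"
      unfolding compression_def by auto metis
    then show ?thesis unfolding corner_vna_commutant M'_eq .
  qed
  show "(q \<circ> J) \<xi> = \<xi>" if "\<xi> \<in> q ` P" for \<xi> using that unfolding P_q(1) by (auto simp: J_P q_simps)
  show "x ((q \<circ> J) (x ((q \<circ> J) \<xi>))) \<in> q ` P" if x: "x \<in> compression q M" and xi: "\<xi> \<in> q ` P" for x \<xi>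
  proof -
    obtain b where b: "b \<in> compression p M" "\<And>v. x v = b (q v)" "\<And>v. q (J (x (q (J v)))) = J (b (J (q v)))"
      using corner_action[OF x] by metis
    have "x ((q \<circ> J) (x ((q \<circ> J) \<xi>))) = q (b (J (b (J (q \<xi>)))))"
      by (simp add: b(2,3) q_J q_simps(2) q_commute[OF b(1)])
    then show ?thesis using cone_invariant[OF compression_p_M(1)[OF b(1)]] xi P_q by auto
  qed
  show "q \<circ> J \<circ> c \<circ> (q \<circ> J) = cadjoint c" if "c \<in> compression q M \<inter> commutant (range q) (compression q M)" for c
  proof -
    have cc: "c \<in> compression q M" "c \<in> compression q M'" using that unfolding corner_vna_commutant by auto
    obtain S where S: "S \<in> M" "S \<in> M'" "c = q \<circ> S \<circ> q" by (rule corner_center[OF cc])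
    note cl = M_op(1)[OF S(1)]
    have "J (S (J (q v))) = cadjoint S (q v)" for v using center[OF S(1,2)] by (metis comp_apply)
    then have JSJ: "J (S (q (J v))) = cadjoint S (q v)" for v by (simp add: q_J)
    have "cadjoint c = q \<circ> cadjoint S \<circ> q"
      unfolding S(3) comp_def
      by (simp add: cadjoint_compose[OF q_simps(1) clinop_compose[OF cl q_simps(1)]] cadjoint_compose[OF cl q_simps(1)] q_simps(4))
    then show ?thesis by (simp add: fun_eq_iff S(3) q_simps(2) JSJ flip: q_J)
  qed
qed

text \<open>The projection onto \<open>Z\<close> below is central, dominates \<open>e = JpJ\<close>, hence also \<open>p\<close>, because \<open>JzJ = z\<close>.\<close>
lemma corner_faithful:
  assumes d: "d \<in> M" "\<And>v. d (p v) = d v" and z: "\<And>v. d (q v) = 0"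
  shows "d v = 0"
proof -
  \<comment> \<open>The common kernel of all elements of \<open>M\<close> that annihilate the range
    of \<open>e\<close>. It is invariant under \<open>M\<close> because \<open>e\<close> commutes
    with \<open>M\<close>, and under \<open>M'\<close> because kernels of elements of
    \<open>M\<close> are.\<close>
  define Z where "Z = {u\<in>H. \<forall>x\<in>M. (\<forall>v. x (e v) = 0) \<longrightarrow> x u = 0}"
  have Z: "closed_csubspace Z"
  proof -
    have "Z = H \<inter> (\<Inter>x\<in>{x\<in>M. \<forall>v. x (e v) = 0}. {u. x u = 0})" unfolding Z_def by blast
    moreover have "closed {u. x u = 0}" if "x \<in> M" for x
      using M_lin(1)[OF that] by (intro closed_Collect_eq linear_continuous_on continuous_on_const)
    ultimately have "closed Z" using SH(2) by (auto intro!: closed_Int closed_INT)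
    then show ?thesis using SH(1) unfolding closed_csubspace_def Z_def
      by (auto simp: subspace_def M_lin csubspaceD[OF H] scaleC_zero_right)
  qed
  have sub: "Z \<subseteq> H" unfolding Z_def by blast
  have "proj Z \<in> M'"
  proof (rule proj_in_commutant[OF Z sub H vnaD(2,3)[OF vna]])
    show "x v \<in> Z" if "x \<in> M" "v \<in> Z" for x v
    proof -
      have "y (x v) = 0" if y: "y \<in> M" "\<forall>v. y (e v) = 0" for y
      proof -
        have "\<forall>u. y (x (e u)) = 0" using y(2) by (simp add: e_commute[OF \<open>x \<in> M\<close>])
        moreover have "\<forall>z\<in>M. (\<forall>u. z (e u) = 0) \<longrightarrow> z v = 0" using \<open>v \<in> Z\<close> unfolding Z_def by blast
        ultimately show ?thesis using M_closed(1)[OF y(1) \<open>x \<in> M\<close>] by (auto dest!: bspec)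
      qed
      then show ?thesis using M_D(1)[OF \<open>x \<in> M\<close>] unfolding Z_def by blast
    qed
  qed
  moreover have "proj Z \<in> commutant H M'"
  proof (rule proj_in_commutant[OF Z sub H vnaD(2,3)[OF vna']])
    show "x v \<in> Z" if x: "x \<in> M'" and "v \<in> Z" for x v
    proof -
      have "y (x v) = 0" if y: "y \<in> M" "\<forall>v. y (e v) = 0" for y
      proof -
        have "y v = 0" using \<open>v \<in> Z\<close> y unfolding Z_def by blast
        then show ?thesis using clinopD(4)[OF M'_op(1)[OF x]] by (simp add: M_D(4)[OF y(1) x])
      qed
      then show ?thesis using M'_op(2)[OF x] unfolding Z_def by blast
    qed
  qed
  ultimately have c: "proj Z \<in> M" "proj Z \<in> M'" unfolding vnaD(4)[OF vna] by auto
  note SZ = csubspaceD(1,2)[OF Z]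
  have JzJ: "J (proj Z (J v)) = proj Z v" for v
    using center[OF c] oprojD(4)[OF oproj_proj[OF Z]] by (metis comp_apply)
  have "e v \<in> Z" for v using M'_op(2)[OF e_M'] unfolding Z_def by blast
  then have ze: "proj Z (e v) = e v" for v by (simp add: proj_ident[OF SZ])
  have "proj Z (p v) = p v"
  proof -
    have "J (p v) = e (J v)" by (simp add: e_def J_simps p_simps)
    then have "J (proj Z (J (p v))) = J (J (p v))" by (simp add: ze)
    then show ?thesis by (simp add: JzJ J_simps p_simps)
  qed
  then have "p v \<in> Z" using proj_in[OF SZ] by metis
  \<comment> \<open>Since \<open>d e = d p e = d q = 0\<close>, the operator \<open>d\<close> is one
    of those that define \<open>Z\<close>.\<close>
  moreover have "d (e v) = 0" for v using z[of v] d(2)[of "e v"] by (simp add: q_eq(1))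
  ultimately have "d (p v) = 0" using d(1) unfolding Z_def by blast
  then show ?thesis by (simp add: d(2))
qed

text \<open>Multiplicativity holds because \<open>q\<close> commutes with \<open>pMp\<close>;
  injectivity is the faithfulness of the action of \<open>pMp\<close> on the range of
  \<open>q\<close>.\<close>

lemma corner_star_isomorphism: "star_isomorphism (compression p M) (compression q M) (\<lambda>x. x \<circ> q)"
  unfolding star_isomorphism_def
proof (intro conjI ballI allI)
  note cM = compression_p_M
  show "bij_betw (\<lambda>x. x \<circ> q) (compression p M) (compression q M)"
    unfolding bij_betw_def
  proof
    show "(\<lambda>x. x \<circ> q) ` compression p M = compression q M" unfolding compression_q_eq[symmetric] by blast
    show "inj_on (\<lambda>x. x \<circ> q) (compression p M)"
    proof (rule inj_onI)
      fix x y assume x: "x \<in> compression p M" and y: "y \<in> compression p M" and eq: "x \<circ> q = y \<circ> q"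
      have "(\<lambda>v. x v + (- 1) *\<^sub>C y v) \<in> M"
        using M_closed(2)[OF cM(1)[OF x] M_closed(3)[OF cM(1)[OF y]]] .
      then have "(\<lambda>v. x v - y v) \<in> M" by (simp add: scaleC_minus_left scaleC_one)
      then have "x v - y v = 0" for v
        by (rule corner_faithful) (use eq in \<open>simp_all add: cM x y fun_eq_iff\<close>)
      then show "x = y" by (simp add: fun_eq_iff)
    qed
  qed
  show "x \<circ> y \<circ> q = x \<circ> q \<circ> (y \<circ> q)" if "x \<in> compression p M" "y \<in> compression p M" for x y
    by (simp add: fun_eq_iff q_commute that q_simps)
  show "cadjoint x \<circ> q = cadjoint (x \<circ> q)" if x: "x \<in> compression p M" for x
  proof -
    have "cadjoint (x \<circ> q) = q \<circ> cadjoint x"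
      unfolding comp_def by (simp add: cadjoint_compose[OF M_op(1)[OF cM(1)[OF x]] q_simps(1)] q_simps(4))
    then show ?thesis using q_commute[OF compression_cadjoint[OF vna p_oproj x]] by (simp add: fun_eq_iff)
  qed
qed (auto simp: fun_eq_iff)

end

section \<open>The matrix cones\<close>

context std_form
begin

abbreviation matrices :: "nat \<Rightarrow> (nat \<Rightarrow> nat \<Rightarrow> 'a \<Rightarrow> 'a) set" where
  "matrices n \<equiv> {X. \<forall>i<n. \<forall>k<n. X i k \<in> M}"

abbreviation vectors :: "nat \<Rightarrow> (nat \<Rightarrow> 'a \<Rightarrow> 'a) set" where
  "vectors n \<equiv> {x. \<forall>i<n. x i \<in> M}"

abbreviation MC :: "nat \<Rightarrow> (nat \<Rightarrow> nat \<Rightarrow> 'a) set" where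
  "MC n \<equiv> matrix_cone M H J P n"

definition row_form :: "nat \<Rightarrow> (nat \<Rightarrow> 'a \<Rightarrow> 'a) \<Rightarrow> (nat \<Rightarrow> nat \<Rightarrow> 'a) \<Rightarrow> 'a" where
  "row_form n x \<xi> = (\<Sum>i<n. \<Sum>j<n. x i (J (x j (J (\<xi> i j)))))"

text \<open>With the right action \<open>\<eta> y = J y^* J \<eta>\<close> of \<open>M\<close> on
  \<open>H\<close>, this is the matrix \<open>x \<eta> x^*\<close> of a column \<open>x\<close>.
  Likewise \<open>row_form\<close> is \<open>x \<xi> x^*\<close> for a row \<open>x\<close>.\<close>

definition col_matrix :: "(nat \<Rightarrow> 'a \<Rightarrow> 'a) \<Rightarrow> 'a \<Rightarrow> nat \<Rightarrow> nat \<Rightarrow> 'a" where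
  "col_matrix x \<eta> i j = x i (J (x j (J \<eta>)))"

definition left_mult :: "nat \<Rightarrow> (nat \<Rightarrow> nat \<Rightarrow> 'a \<Rightarrow> 'a) \<Rightarrow> (nat \<Rightarrow> nat \<Rightarrow> 'a) \<Rightarrow> nat \<Rightarrow> nat \<Rightarrow> 'a" where
  "left_mult n X \<xi> i j = (\<Sum>k<n. X i k (\<xi> k j))"

text \<open>In the same bimodule notation this is the product of \<open>\<xi>\<close> with the
  adjoint of the matrix \<open>X\<close> on the right, which explains the index order in
  \<open>X j l\<close>.\<close>

definition right_mult :: "nat \<Rightarrow> (nat \<Rightarrow> nat \<Rightarrow> 'a \<Rightarrow> 'a) \<Rightarrow> (nat \<Rightarrow> nat \<Rightarrow> 'a) \<Rightarrow> nat \<Rightarrow> nat \<Rightarrow> 'a" where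
  "right_mult n X \<xi> i j = (\<Sum>l<n. J (X j l (J (\<xi> i l))))"

lemma J_commute': "x \<in> M \<Longrightarrow> y \<in> M \<Longrightarrow> z \<in> M \<Longrightarrow> J (y (J (x (J (z v))))) = x (J (y (z v)))"
  using J_commute[of x y "J (z v)"] by (simp add: J_simps M_D)

lemma sum_mult_M:
  fixes n :: nat
  assumes "\<And>i. i < n \<Longrightarrow> x i \<in> M" "\<And>i. i < n \<Longrightarrow> y i \<in> M"
  shows "(\<lambda>v. \<Sum>i<n. x i (y i v)) \<in> M"
proof (rule vna_sum[OF vna])
  show "(\<lambda>v. x i (y i v)) \<in> M" if "i \<in> {..<n}" for i
    using M_closed(1)[of "x i" "y i"] assms that by simp
qed simp

lemma MC_iff: "\<xi> \<in> MC n \<longleftrightarrow> (\<forall>i<n. \<forall>j<n. \<xi> i j \<in> H) \<and> (\<forall>x\<in>vectors n. row_form n x \<xi> \<in> P)"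
  unfolding matrix_cone_def row_form_def by blast

lemma MC_D: "\<xi> \<in> MC n \<Longrightarrow> i < n \<Longrightarrow> j < n \<Longrightarrow> \<xi> i j \<in> H" "\<xi> \<in> MC n \<Longrightarrow> x \<in> vectors n \<Longrightarrow> row_form n x \<xi> \<in> P"
  unfolding MC_iff by blast+

lemma MC_cong:
  assumes "\<xi> \<in> MC n" "\<And>i j. i < n \<Longrightarrow> j < n \<Longrightarrow> \<xi> i j = \<zeta> i j"
  shows "\<zeta> \<in> MC n"
proof -
  have "row_form n x \<zeta> = row_form n x \<xi>" for x
    unfolding row_form_def using assms(2) by (intro sum.cong) auto
  then show ?thesis using assms by (simp add: MC_iff)
qed

lemma row_form_linear:
  assumes "x \<in> vectors n"
  shows "row_form n x (\<lambda>i j. \<xi> i j + \<zeta> i j) = row_form n x \<xi> + row_form n x \<zeta>"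
    "row_form n x (\<lambda>i j. \<xi> i j - \<zeta> i j) = row_form n x \<xi> - row_form n x \<zeta>"
    "row_form n x (\<lambda>i j. r *\<^sub>R \<xi> i j) = r *\<^sub>R row_form n x \<xi>"
    "row_form n x (\<lambda>i j. - \<xi> i j) = - row_form n x \<xi>"
    "row_form n x (\<lambda>i j. 0) = 0"
proof -
  have m: "x i \<in> M" if "i < n" for i using assms that by blast
  show "row_form n x (\<lambda>i j. \<xi> i j + \<zeta> i j) = row_form n x \<xi> + row_form n x \<zeta>"
    unfolding row_form_def sum.distrib[symmetric] by (intro sum.cong refl) (simp add: J_simps M_lin m)
  show "row_form n x (\<lambda>i j. \<xi> i j - \<zeta> i j) = row_form n x \<xi> - row_form n x \<zeta>"
    unfolding row_form_def sum_subtractf[symmetric] by (intro sum.cong refl) (simp add: J_simps M_lin m)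
  show "row_form n x (\<lambda>i j. r *\<^sub>R \<xi> i j) = r *\<^sub>R row_form n x \<xi>"
    unfolding row_form_def scaleR_sum_right by (intro sum.cong refl) (simp add: J_simps M_lin m)
  show "row_form n x (\<lambda>i j. - \<xi> i j) = - row_form n x \<xi>"
    unfolding row_form_def sum_negf[symmetric] by (intro sum.cong refl) (simp add: J_simps M_lin m)
  show "row_form n x (\<lambda>i j. 0) = 0"
    unfolding row_form_def by (simp add: J_simps M_lin m)
qed

lemma MC_convex_cone:
  shows "(\<lambda>i j. 0) \<in> MC n" "\<xi> \<in> MC n \<Longrightarrow> \<zeta> \<in> MC n \<Longrightarrow> (\<lambda>i j. \<xi> i j + \<zeta> i j) \<in> MC n"
    "t \<ge> 0 \<Longrightarrow> \<xi> \<in> MC n \<Longrightarrow> (\<lambda>i j. t *\<^sub>R \<xi> i j) \<in> MC n"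
  unfolding MC_iff by (simp_all add: row_form_linear P_0 P_add P_scale csubspaceD[OF H])

lemma MC_closed:
  assumes f: "\<And>k. f k \<in> MC n" and l: "\<And>i j. i < n \<Longrightarrow> j < n \<Longrightarrow> (\<lambda>k. f k i j) \<longlonglongrightarrow> l i j"
  shows "l \<in> MC n"
  unfolding MC_iff
proof (intro conjI allI impI ballI)
  fix i j assume "i < n" "j < n"
  then show "l i j \<in> H" using MC_D(1)[OF f] l closed_sequentially[OF SH(2), of "\<lambda>k. f k i j"] by blast
next
  fix x assume x: "x \<in> vectors n"
  have "(\<lambda>k. row_form n x (f k)) \<longlonglongrightarrow> row_form n x l"
    unfolding row_form_def
  proof (rule tendsto_sum, rule tendsto_sum)
    fix i j assume ij: "i \<in> {..<n}" "j \<in> {..<n}"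
    then have m: "x i \<in> M" "x j \<in> M" using x by auto
    note t = bounded_linear.tendsto[OF M_lin(1)[OF m(1)]] bounded_linear.tendsto[OF M_lin(1)[OF m(2)]]
      bounded_linear.tendsto[OF bounded_linear_J]
    show "(\<lambda>k. x i (J (x j (J (f k i j))))) \<longlonglongrightarrow> x i (J (x j (J (l i j))))"
      by (rule t(1), rule t(3), rule t(2), rule t(3), rule l) (use ij in auto)
  qed
  then show "row_form n x l \<in> P"
    using MC_D(2)[OF f x] closed_sequentially[OF P_closed, of "\<lambda>k. row_form n x (f k)"] by blast
qed

text \<open>Polarization with the scalar row \<open>e_a + t e_b\<close>, encoded by
  \<open>c t a b\<close>. The value \<open>t = 0\<close> kills the diagonal entries; then
  \<open>t = 1\<close> and \<open>t = \<i>\<close> give the sum and the difference of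
  \<open>\<xi> a b\<close> and \<open>\<xi> b a\<close>.\<close>

lemma row_form_eq_0_imp:
  assumes h: "\<And>i j. i < n \<Longrightarrow> j < n \<Longrightarrow> \<xi> i j \<in> H" and z: "\<And>x. x \<in> vectors n \<Longrightarrow> row_form n x \<xi> = 0"
    and ab: "a < n" "b < n"
  shows "\<xi> a b = 0"
proof -
  define c where "c t a b i = of_bool (i = a) + of_bool (i = b) * t" for t :: complex and a b i :: nat
  have delta: "(\<Sum>i<n. c t a b i *\<^sub>C f i) = f a + t *\<^sub>C f b" if "a < n" "b < n" for t a b and f :: "nat \<Rightarrow> 'a"
  proof -
    have "(\<Sum>i<n. c t a b i *\<^sub>C f i) = (\<Sum>i<n. if i = a then f i else 0) + (\<Sum>i<n. if i = b then t *\<^sub>C f i else 0)"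
      unfolding sum.distrib[symmetric] c_def
      by (intro sum.cong refl) (simp add: scaleC_add_left scaleC_zero_left scaleC_one)
    then show ?thesis using that by simp
  qed
  have cc: "cnj (c t a b i) = c (cnj t) a b i" for t a b i unfolding c_def by simp
  have e: "\<xi> a a + cnj t *\<^sub>C \<xi> a b + t *\<^sub>C (\<xi> b a + cnj t *\<^sub>C \<xi> b b) = 0" if ab: "a < n" "b < n" for a b t
  proof -
    define x where "x i = (\<lambda>v. c t a b i *\<^sub>C proj H v)" for i
    have x: "x \<in> vectors n" unfolding x_def using M_closed(3)[OF M_closed(5)] by simp
    have "row_form n x \<xi> = (\<Sum>i<n. c t a b i *\<^sub>C (\<Sum>j<n. c (cnj t) a b j *\<^sub>C \<xi> i j))"
      unfolding row_form_def clinop_sum[OF clinop_scaleC[OF oprojD(1)[OF oproj_proj[OF H]]]]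
    proof (intro sum.cong refl)
      fix i assume i: "i \<in> {..<n}"
      have "x i (J (x j (J (\<xi> i j)))) = c t a b i *\<^sub>C c (cnj t) a b j *\<^sub>C \<xi> i j" if "j \<in> {..<n}" for j
        using h[of i j] i that by (simp add: x_def J_simps cc proj_ident[OF SH] clinopD[OF clinop_proj[OF H]])
      then show "(\<Sum>j<n. x i (J (x j (J (\<xi> i j))))) = c t a b i *\<^sub>C (\<Sum>j<n. c (cnj t) a b j *\<^sub>C \<xi> i j)"
        by (simp add: linear_sum[OF bounded_linear.linear[OF bounded_linear_scaleC]])
    qed
    then show ?thesis using z[OF x] delta[OF ab] by simp
  qed
  have d: "\<xi> a a = 0" if "a < n" for a using e[OF that that, of 0] by (simp add: scaleC_zero_left)
  have 1: "\<xi> a b + \<xi> b a = 0" using e[OF ab, of 1] d ab by (simp add: scaleC_one)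
  have "\<i> *\<^sub>C \<xi> a b = \<i> *\<^sub>C \<xi> b a" using e[OF ab, of \<i>] d ab by (simp add: scaleC_minus_left scaleC_zero_right)
  then have "(- \<i>) *\<^sub>C (\<i> *\<^sub>C \<xi> a b) = (- \<i>) *\<^sub>C (\<i> *\<^sub>C \<xi> b a)" by simp
  then have "\<xi> a b = \<xi> b a" by (simp add: scaleC_scaleC scaleC_one)
  then have "2 *\<^sub>R \<xi> a b = 0" using 1 by (simp add: scaleR_2)
  then show ?thesis by simp
qed

text \<open>Row forms of \<open>\<xi>\<close> lie in \<open>P\<close> and are fixed by
  \<open>J\<close>, while \<open>J\<close> of a row form is the row form of the adjoint matrix. So
  \<open>\<xi>\<close> and its adjoint matrix have the same row forms, and these determine a
  matrix.\<close>

lemma MC_hermitian: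
  assumes xi: "\<xi> \<in> MC n" and ij: "i < n" "j < n"
  shows "J (\<xi> i j) = \<xi> j i"
proof -
  note h = MC_D(1)[OF xi]
  have "\<xi> j i - J (\<xi> i j) = 0"
  proof (rule row_form_eq_0_imp[of n "\<lambda>i j. \<xi> i j - J (\<xi> j i)"])
    show "\<xi> i j - J (\<xi> j i) \<in> H" if "i < n" "j < n" for i j
      using that h by (simp add: csubspaceD[OF H] J_simps)
    fix x assume x: "x \<in> vectors n"
    have "row_form n x (\<lambda>i j. J (\<xi> j i)) = (\<Sum>j<n. \<Sum>i<n. x i (J (x j (J (J (\<xi> j i))))))"
      unfolding row_form_def by (rule sum.swap)
    also have "\<dots> = (\<Sum>j<n. \<Sum>i<n. J (x j (J (x i (J (\<xi> j i))))))"
      using x h by (intro sum.cong refl) (simp add: J_commute flip: J_commute)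
    also have "\<dots> = J (row_form n x \<xi>)" unfolding row_form_def by (simp add: J_sum)
    also have "\<dots> = row_form n x \<xi>" by (rule J_P[OF MC_D(2)[OF xi x]])
    finally show "row_form n x (\<lambda>i j. \<xi> i j - J (\<xi> j i)) = 0" by (simp add: row_form_linear[OF x])
  qed (use ij in auto)
  then show ?thesis by simp
qed

lemma row_form_inner:
  assumes x: "x \<in> vectors n"
  shows "row_form n x \<xi> \<bullet> \<eta> = (\<Sum>i<n. \<Sum>j<n. \<xi> i j \<bullet> col_matrix (\<lambda>i. cadjoint (x i)) \<eta> i j)"
  unfolding row_form_def inner_sum_left
proof (intro sum.cong refl)
  fix i j assume "i \<in> {..<n}" "j \<in> {..<n}"
  then have m: "x i \<in> M" "x j \<in> M" using x by auto
  note m' = vnaD(3)[OF vna m(1)] vnaD(3)[OF vna m(2)]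
  show "x i (J (x j (J (\<xi> i j)))) \<bullet> \<eta> = \<xi> i j \<bullet> col_matrix (\<lambda>i. cadjoint (x i)) \<eta> i j"
    unfolding col_matrix_def J_commute[OF m'] cadjoint_inner[OF M_op(1)[OF m(1)]] J_inner
      cadjoint_inner[OF M_op(1)[OF m(2)]] ..
qed

text \<open>Among hermitian matrices the cone is the dual of the set of all
  \<open>col_matrix x \<eta>\<close>. Hermiticity makes each row form fixed by \<open>J\<close>, so
  that real inner products with \<open>P\<close> decide membership.\<close>

lemma MC_I:
  assumes h: "\<And>i j. i < n \<Longrightarrow> j < n \<Longrightarrow> \<xi> i j \<in> H" "\<And>i j. i < n \<Longrightarrow> j < n \<Longrightarrow> J (\<xi> i j) = \<xi> j i"
    and pos: "\<And>x \<eta>. x \<in> vectors n \<Longrightarrow> \<eta> \<in> P \<Longrightarrow> (\<Sum>i<n. \<Sum>j<n. \<xi> i j \<bullet> col_matrix x \<eta> i j) \<ge> 0"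
  shows "\<xi> \<in> MC n"
  unfolding MC_iff
proof (intro conjI allI impI ballI)
  fix x assume x: "x \<in> vectors n"
  then have x': "(\<lambda>i. cadjoint (x i)) \<in> vectors n" using vnaD(3)[OF vna] by simp
  show "row_form n x \<xi> \<in> P"
  proof (rule P_I)
    show "row_form n x \<xi> \<in> H" unfolding row_form_def using x M_D(1) by (intro csubspaceD(9)[OF H]) auto
    have "J (row_form n x \<xi>) = (\<Sum>j<n. \<Sum>i<n. J (x i (J (x j (J (\<xi> i j))))))"
      unfolding row_form_def J_sum by (rule sum.swap)
    also have "\<dots> = row_form n x \<xi>"
      unfolding row_form_def
    proof (intro sum.cong refl)
      fix i j assume "i \<in> {..<n}" "j \<in> {..<n}"
      then have m: "x i \<in> M" "x j \<in> M" "i < n" "j < n" using x by auto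
      show "J (x j (J (x i (J (\<xi> j i))))) = x i (J (x j (J (\<xi> i j))))"
        unfolding J_commute[OF m(1,2), symmetric] h(2)[OF m(4,3)] ..
    qed
    finally show "J (row_form n x \<xi>) = row_form n x \<xi>" .
    show "row_form n x \<xi> \<bullet> \<eta> \<ge> 0" if "\<eta> \<in> P" for \<eta>
      unfolding row_form_inner[OF x] by (rule pos[OF x' that])
  qed
qed (use h in auto)

text \<open>Associativity: the row \<open>x\<close> applied to \<open>X \<xi> X^*\<close> is the row
  \<open>xX\<close> applied to \<open>\<xi>\<close>. What remains is to reorder four sums.\<close>

lemma row_form_mult:
  assumes X: "X \<in> matrices n" and x: "x \<in> vectors n"
  shows "row_form n x (left_mult n X (right_mult n X \<xi>)) = row_form n (\<lambda>k v. \<Sum>i<n. x i (X i k v)) \<xi>"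
proof -
  have m: "x i \<in> M" if "i < n" for i using x that by blast
  have mX: "X i k \<in> M" if "i < n" "k < n" for i k using X that by blast
  have 1: "x i (J (x j (J (left_mult n X (right_mult n X \<xi>) i j)))) =
      (\<Sum>k<n. \<Sum>l<n. x i (X i k (J (x j (X j l (J (\<xi> k l)))))))" if ij: "i < n" "j < n" for i j
    unfolding left_mult_def right_mult_def
    by (simp add: clinop_sum[OF M_op(1)] J_sum m mX ij J_commute')
  have "row_form n x (left_mult n X (right_mult n X \<xi>)) =
      (\<Sum>i<n. \<Sum>j<n. \<Sum>k<n. \<Sum>l<n. x i (X i k (J (x j (X j l (J (\<xi> k l)))))))"
    unfolding row_form_def by (intro sum.cong refl) (simp add: 1)
  also have "\<dots> = (\<Sum>i<n. \<Sum>k<n. \<Sum>j<n. \<Sum>l<n. x i (X i k (J (x j (X j l (J (\<xi> k l)))))))"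
    by (rule sum.cong[OF refl], rule sum.swap)
  also have "\<dots> = (\<Sum>k<n. \<Sum>i<n. \<Sum>j<n. \<Sum>l<n. x i (X i k (J (x j (X j l (J (\<xi> k l)))))))"
    by (rule sum.swap)
  also have "\<dots> = (\<Sum>k<n. \<Sum>i<n. \<Sum>l<n. \<Sum>j<n. x i (X i k (J (x j (X j l (J (\<xi> k l)))))))"
    by (rule sum.cong[OF refl], rule sum.cong[OF refl], rule sum.swap)
  also have "\<dots> = (\<Sum>k<n. \<Sum>l<n. \<Sum>i<n. \<Sum>j<n. x i (X i k (J (x j (X j l (J (\<xi> k l)))))))"
    by (rule sum.cong[OF refl], rule sum.swap)
  also have "\<dots> = row_form n (\<lambda>k v. \<Sum>i<n. x i (X i k v)) \<xi>"
    unfolding row_form_def by (intro sum.cong refl) (simp add: clinop_sum[OF M_op(1)] J_sum m mX)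
  finally show ?thesis .
qed

lemma MC_mult:
  assumes X: "X \<in> matrices n" and xi: "\<xi> \<in> MC n"
  shows "left_mult n X (right_mult n X \<xi>) \<in> MC n"
  unfolding MC_iff
proof (intro conjI allI impI ballI)
  show "left_mult n X (right_mult n X \<xi>) i j \<in> H" if "i < n" "j < n" for i j
    unfolding left_mult_def using X that M_D(1) by (intro csubspaceD(9)[OF H]) auto
  fix x assume x: "x \<in> vectors n"
  have "(\<lambda>k v. \<Sum>i<n. x i (X i k v)) \<in> vectors n"
    using X x sum_mult_M[of n x "\<lambda>i. X i k" for k] by simp
  then show "row_form n x (left_mult n X (right_mult n X \<xi>)) \<in> P"
    unfolding row_form_mult[OF X x] by (rule MC_D(2)[OF xi])
qed

text \<open>A row meets the column \<open>b\<close> in a single element \<open>z\<close> of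
  \<open>M\<close>, so the row form is \<open>zJzJ\<eta>\<close> and the invariance axiom
  applies.\<close>

lemma MC_col_matrix:
  assumes b: "b \<in> vectors n" and eta: "\<eta> \<in> P"
  shows "col_matrix b \<eta> \<in> MC n"
  unfolding MC_iff
proof (intro conjI allI impI ballI)
  show "col_matrix b \<eta> i j \<in> H" if "i < n" "j < n" for i j
    unfolding col_matrix_def using b that M_D(1) by blast
  fix x assume x: "x \<in> vectors n"
  have m: "x i \<in> M" "b i \<in> M" if "i < n" for i using x b that by auto
  define z where "z = (\<lambda>v. \<Sum>i<n. x i (b i v))"
  have z: "z \<in> M" unfolding z_def using m by (rule sum_mult_M)
  have "row_form n x (col_matrix b \<eta>) = (\<Sum>i<n. \<Sum>j<n. x i (b i (J (x j (b j (J \<eta>))))))"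
    unfolding row_form_def col_matrix_def
    by (intro sum.cong refl) (simp add: J_commute' m)
  also have "\<dots> = z (J (z (J \<eta>)))"
    unfolding z_def by (intro sum.cong refl) (simp add: clinop_sum[OF M_op(1)] J_sum m)
  finally show "row_form n x (col_matrix b \<eta>) \<in> P" using cone_invariant[OF z eta] by simp
qed

end

section \<open>Minimality of the matrix cones\<close>

context std_form
begin

text \<open>\<open>Z\<close> is a closed \<open>M'\<close>-submodule of the n-fold sum of
  \<open>H\<close>, so the projection onto it commutes with the diagonal action of \<open>M'\<close>
  and has its matrix entries in the bicommutant \<open>M\<close>. Columns are functions on all of
  \<open>nat\<close> of which only the entries below \<open>n\<close> are determined; uniqueness is
  therefore stated for these only.\<close>

lemma column_projection:
  fixes Z :: "(nat \<Rightarrow> 'a) set"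
  assumes zero: "(\<lambda>i. 0) \<in> Z"
    and add: "\<And>u v. u \<in> Z \<Longrightarrow> v \<in> Z \<Longrightarrow> (\<lambda>i. u i + v i) \<in> Z"
    and scale: "\<And>c u. u \<in> Z \<Longrightarrow> (\<lambda>i. c *\<^sub>C u i) \<in> Z"
    and cl: "\<And>f l. (\<And>k. f k \<in> Z) \<Longrightarrow> (\<And>i. i < n \<Longrightarrow> (\<lambda>k. f k i) \<longlonglongrightarrow> l i) \<Longrightarrow> l \<in> Z"
    and ZH: "\<And>u i. u \<in> Z \<Longrightarrow> i < n \<Longrightarrow> u i \<in> H"
    and inv: "\<And>y u. y \<in> M' \<Longrightarrow> u \<in> Z \<Longrightarrow> (\<lambda>i. y (u i)) \<in> Z"
  obtains G where "G \<in> matrices n" "\<And>u i. u \<in> Z \<Longrightarrow> i < n \<Longrightarrow> (\<Sum>k<n. G i k (u k)) = u i"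
    "\<And>a i. i < n \<Longrightarrow> \<forall>z\<in>Z. (\<Sum>i<n. a i \<bullet> z i) = 0 \<Longrightarrow> (\<Sum>k<n. G i k (a k)) = 0"
proof -
  define is_proj where "is_proj a g \<longleftrightarrow> g \<in> Z \<and> (\<forall>z\<in>Z. (\<Sum>i<n. (a i - g i) \<bullet> z i) = 0)" for a g
  have scaleR: "(\<lambda>i. r *\<^sub>R u i) \<in> Z" if "u \<in> Z" for r u
    using scale[OF that, of "complex_of_real r"] by (simp add: scaleC_of_real)
  have ex: "\<exists>g. is_proj a g" for a
  proof (rule closest_point_subspace_family[of "{..<n}" Z a])
    show "l \<in> Z" if "\<And>k. f k \<in> Z" "\<And>i. i \<in> {..<n} \<Longrightarrow> (\<lambda>k. f k i) \<longlonglongrightarrow> l i" for f l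
      using that(2) by (intro cl[OF that(1)]) simp
    show "(\<lambda>i. u i + v i) \<in> Z" if "u \<in> Z" "v \<in> Z" for u v using that by (rule add)
    show "(\<lambda>i. r *\<^sub>R u i) \<in> Z" if "u \<in> Z" for r u using that by (rule scaleR)
    fix u assume "u \<in> Z" "\<And>c. c \<in> Z \<Longrightarrow> (\<Sum>i\<in>{..<n}. (a i - u i) \<bullet> c i) = 0"
    then show ?thesis unfolding is_proj_def by blast
  qed (simp_all add: zero)
  define g where "g a = (SOME h. is_proj a h)" for a
  have g: "is_proj a (g a)" for a unfolding g_def using ex by (rule someI_ex)
  have eqI: "g a i = h i" if h: "is_proj a h" and i: "i < n" for a h i
  proof -
    define d where "d i = g a i - h i" for i
    have "d \<in> Z"
      using add[of "g a" "\<lambda>i. (-1) *\<^sub>R h i"] scaleR[of h "-1"] h g[of a] unfolding is_proj_def d_def by simp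
    then have "(\<Sum>i<n. (a i - h i) \<bullet> d i) - (\<Sum>i<n. (a i - g a i) \<bullet> d i) = 0"
      using h g[of a] unfolding is_proj_def by simp
    then have "(\<Sum>i<n. d i \<bullet> d i) = 0"
      unfolding sum_subtractf[symmetric] by (simp add: d_def flip: inner_diff_left)
    then have "d i \<bullet> d i = 0" using i by (subst (asm) sum_nonneg_eq_0_iff) auto
    then show ?thesis by (simp add: d_def)
  qed
  have cong: "is_proj b h" if "is_proj a h" "\<And>i z. i < n \<Longrightarrow> z \<in> Z \<Longrightarrow> a i \<bullet> z i = b i \<bullet> z i" for a b h
    using that unfolding is_proj_def by (simp add: inner_diff_left)
  have addI: "is_proj (\<lambda>i. a i + b i) (\<lambda>i. h i + h' i)" if "is_proj a h" "is_proj b h'" for a b h h'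
  proof -
    have "(\<Sum>i<n. (a i + b i - (h i + h' i)) \<bullet> z i) = (\<Sum>i<n. (a i - h i) \<bullet> z i) + (\<Sum>i<n. (b i - h' i) \<bullet> z i)" for z
      unfolding sum.distrib[symmetric] by (simp add: algebra_simps flip: inner_add_left)
    then show ?thesis using that add unfolding is_proj_def by simp
  qed
  \<comment> \<open>An operator that, together with its adjoint, preserves \<open>Z\<close>
    coordinatewise commutes with the projection onto \<open>Z\<close>. This serves both for scalars
    and for \<open>M'\<close>.\<close>
  have opI: "is_proj (\<lambda>i. R (a i)) (\<lambda>i. R (h i))"
    if a: "is_proj a h" and R: "\<And>x y. R x - R y = R (x - y)" "\<And>x y. R x \<bullet> y = x \<bullet> R' y"
      "\<And>u. u \<in> Z \<Longrightarrow> (\<lambda>i. R (u i)) \<in> Z" "\<And>u. u \<in> Z \<Longrightarrow> (\<lambda>i. R' (u i)) \<in> Z" for R R' a h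
    unfolding is_proj_def
  proof (intro conjI ballI)
    show "(\<lambda>i. R (h i)) \<in> Z" using a R(3)[of h] unfolding is_proj_def by blast
    fix z assume "z \<in> Z"
    then have "(\<Sum>i<n. (a i - h i) \<bullet> R' (z i)) = 0" using a R(4)[of z] unfolding is_proj_def by simp
    then show "(\<Sum>i<n. (R (a i) - R (h i)) \<bullet> z i) = 0" by (simp add: R(1,2))
  qed
  have scaleI: "is_proj (\<lambda>i. c *\<^sub>C a i) (\<lambda>i. c *\<^sub>C h i)" if "is_proj a h" for c a h
    by (rule opI[OF that, where R' = "\<lambda>v. cnj c *\<^sub>C v"])
      (auto simp: scaleC_add_right scaleC_minus_right diff_conv_add_uminus inner_scaleC_left scale
        simp del: add_uminus_conv_diff)
  have sumI: "is_proj (\<lambda>i. \<Sum>k\<in>K. a k i) (\<lambda>i. \<Sum>k\<in>K. h k i)" if "finite K" "\<And>k. is_proj (a k) (h k)" for K :: "nat set" and a h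
    using that(1)
  proof (induction K rule: finite_induct)
    case empty then show ?case using zero unfolding is_proj_def by simp
  next
    case (insert k K) then show ?case using addI[OF that(2)[of k] insert.IH] by simp
  qed
  \<comment> \<open>\<open>\<delta> k v\<close> is the vector \<open>v\<close> placed in slot
    \<open>k\<close>, so \<open>G i k\<close> below is a matrix entry of the projection
    \<open>g\<close>.\<close>
  define \<delta> where "\<delta> k v i = (if i = k then v else 0)" for k i :: nat and v :: 'a
  define G where "G i k v = g (\<delta> k v) i" for i k v
  have \<delta>_R: "\<delta> k (R v) = (\<lambda>i. R (\<delta> k v i))" if "R 0 = 0" for R k v
    using that by (simp add: \<delta>_def fun_eq_iff)
  have Gproj: "is_proj a (\<lambda>i. \<Sum>k<n. G i k (a k))" for a
  proof (rule cong)
    show "is_proj (\<lambda>i. \<Sum>k<n. \<delta> k (a k) i) (\<lambda>i. \<Sum>k<n. G i k (a k))"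
      unfolding G_def by (rule sumI) (simp_all add: g)
    show "(\<Sum>k<n. \<delta> k (a k) i) \<bullet> z i = a i \<bullet> z i" if "i < n" for i z using that by (simp add: \<delta>_def)
  qed
  have GM: "G i k \<in> M" if i: "i < n" and k: "k < n" for i k
  proof -
    have bd: "norm (g a i) \<le> sqrt (\<Sum>i<n. (norm (a i))\<^sup>2)" for a
    proof (rule real_le_rsqrt)
      have "(\<Sum>i<n. (norm (a i))\<^sup>2) =
          (\<Sum>i<n. (norm (a i - g a i))\<^sup>2) + 2 * (\<Sum>i<n. (a i - g a i) \<bullet> g a i) + (\<Sum>i<n. (norm (g a i))\<^sup>2)"
        unfolding sum_distrib_left sum.distrib[symmetric]
        by (intro sum.cong refl) (simp add: power2_norm_eq_inner inner_simps inner_commute)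
      moreover have "(\<Sum>i<n. (a i - g a i) \<bullet> g a i) = 0" using g[of a] unfolding is_proj_def by blast
      moreover have "(norm (g a i))\<^sup>2 \<le> (\<Sum>i<n. (norm (g a i))\<^sup>2)" using i by (intro member_le_sum) auto
      moreover have "0 \<le> (\<Sum>i<n. (norm (a i - g a i))\<^sup>2)" by (rule sum_nonneg) simp
      ultimately show "(norm (g a i))\<^sup>2 \<le> (\<Sum>i<n. (norm (a i))\<^sup>2)" by linarith
    qed
    have sc: "G i k (c *\<^sub>C v) = c *\<^sub>C G i k v" for c v
      unfolding G_def \<delta>_R[of "\<lambda>v. c *\<^sub>C v", OF scaleC_zero_right]
      by (rule eqI[OF scaleI[OF g] i])
    have "bounded_linear (G i k)"
    proof (rule bounded_linear_intro[of _ 1])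
      show "G i k (v + w) = G i k v + G i k w" for v w
      proof -
        have "\<delta> k (v + w) = (\<lambda>i. \<delta> k v i + \<delta> k w i)" by (simp add: \<delta>_def fun_eq_iff)
        then show ?thesis unfolding G_def using eqI[OF addI[OF g g] i] by simp
      qed
      show "G i k (r *\<^sub>R v) = r *\<^sub>R G i k v" for r v
        using sc[of "complex_of_real r" v] by (simp add: scaleC_of_real)
      show "norm (G i k v) \<le> norm v * 1" for v
      proof -
        have "(\<Sum>i<n. (norm (\<delta> k v i))\<^sup>2) = (\<Sum>i<n. if i = k then (norm v)\<^sup>2 else 0)"
          by (intro sum.cong refl) (simp add: \<delta>_def)
        then show ?thesis using bd[of "\<delta> k v"] k unfolding G_def by simp
      qed
    qed
    then have Gc: "clinop (G i k)" unfolding clinop_def using sc by blast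
    have "G i k \<in> commutant H M'"
    proof (rule commutantI)
      have "G i k v \<in> H" for v using g[of "\<delta> k v"] ZH i unfolding G_def is_proj_def by blast
      moreover have "G i k (proj H v) = G i k v" for v
        unfolding G_def
      proof (rule eqI[OF _ i], rule cong[OF g])
        show "\<delta> k v i \<bullet> z i = \<delta> k (proj H v) i \<bullet> z i" if "i < n" "z \<in> Z" for i z
          using proj_ident[OF SH ZH[OF that(2,1)]] proj_inner[OF SH, of v "z i"] by (auto simp: \<delta>_def)
      qed
      ultimately show "G i k \<in> bounded_ops H" unfolding bounded_ops_iff[OF H] using Gc by blast
      show "y (G i k v) = G i k (y v)" if y: "y \<in> M'" for y v
      proof -
        note yc = M'_op(1)[OF y]
        have "is_proj (\<lambda>i. y (\<delta> k v i)) (\<lambda>i. y (g (\<delta> k v) i))"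
          by (rule opI[OF g, where R' = "cadjoint y"])
            (simp_all add: clinopD[OF yc] cadjoint_inner[OF yc] inv[OF y] inv[OF vnaD(3)[OF vna' y]])
        from eqI[OF this i] show ?thesis unfolding G_def \<delta>_R[of y, OF clinopD(4)[OF yc]] by simp
      qed
    qed
    then show ?thesis unfolding vnaD(4)[OF vna] .
  qed
  have uniq: "(\<Sum>k<n. G i k (a k)) = h i" if "is_proj a h" "i < n" for a h i
    using eqI[OF that] eqI[OF Gproj that(2)] by simp
  show ?thesis
  proof (rule that)
    show "G \<in> matrices n" using GM by blast
    show "(\<Sum>k<n. G i k (u k)) = u i" if "u \<in> Z" "i < n" for u i
      using uniq[of u u] that unfolding is_proj_def by simp
    show "(\<Sum>k<n. G i k (a k)) = 0" if "i < n" "\<forall>z\<in>Z. (\<Sum>i<n. a i \<bullet> z i) = 0" for a i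
      using uniq[of a "\<lambda>i. 0"] that zero unfolding is_proj_def by simp
  qed
qed

lemma right_mult_hermitian:
  assumes "\<And>l. l < n \<Longrightarrow> J (\<xi> i l) = \<xi> l i" "i < n"
  shows "right_mult n X \<xi> i j = J (left_mult n X \<xi> j i)"
  using assms unfolding right_mult_def left_mult_def J_sum by (intro sum.cong) auto

definition mat_inner :: "nat \<Rightarrow> (nat \<Rightarrow> nat \<Rightarrow> 'a) \<Rightarrow> (nat \<Rightarrow> nat \<Rightarrow> 'a) \<Rightarrow> real" where
  "mat_inner n \<xi> \<zeta> = (\<Sum>i<n. \<Sum>j<n. \<xi> i j \<bullet> \<zeta> i j)"

text \<open>Take \<open>X = 1 + tA\<close>: a polynomial in \<open>t\<close> that is nonnegative and vanishes at \<open>0\<close> has no linear term.\<close>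
lemma mat_inner_perturbation_zero:
  assumes h: "\<And>i j. i < n \<Longrightarrow> j < n \<Longrightarrow> u i j \<in> H" "\<And>i j. i < n \<Longrightarrow> j < n \<Longrightarrow> J (u i j) = u j i"
    "\<And>i j. i < n \<Longrightarrow> j < n \<Longrightarrow> J (w i j) = w j i"
    and pos: "\<And>X. X \<in> matrices n \<Longrightarrow> mat_inner n w (left_mult n X (right_mult n X u)) \<ge> 0"
    and orth: "mat_inner n w u = 0" and A: "A \<in> matrices n"
  shows "mat_inner n w (right_mult n A u) = 0"
proof -
  have AM: "A i k \<in> M" if "i < n" "k < n" for i k using A that by blast
  define X where "X t i k = (\<lambda>v. (if i = k then proj H v else 0) + t *\<^sub>R A i k v)" for t :: real and i k
  have XM: "X t \<in> matrices n" for t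
  proof -
    have "X t i k \<in> M" if "i < n" "k < n" for i k
    proof -
      have "(\<lambda>v. (if i = k then proj H v else 0)) \<in> M" using M_closed(4,5) by (cases "i = k") simp_all
      from M_closed(2)[OF this M_closed(3)[OF AM[OF that], of "complex_of_real t"]]
      show ?thesis unfolding X_def by (simp add: scaleC_of_real)
    qed
    then show ?thesis by simp
  qed
  have R: "right_mult n (X t) u i j = u i j + t *\<^sub>R right_mult n A u i j" if "i < n" "j < n" for t i j
  proof -
    have "right_mult n (X t) u i j = (\<Sum>l<n. (if j = l then u i l else 0) + t *\<^sub>R J (A j l (J (u i l))))"
      unfolding right_mult_def X_def using h(1)[OF that(1)]
      by (intro sum.cong refl) (simp add: J_simps proj_ident[OF SH])
    then show ?thesis using that by (simp add: sum.distrib right_mult_def scaleR_sum_right)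
  qed
  have RH: "right_mult n A u i j \<in> H" for i j
    unfolding right_mult_def by (intro csubspaceD(9)[OF H]) (simp add: J_simps)
  have L: "left_mult n (X t) v i j = v i j + t *\<^sub>R left_mult n A v i j"
    if "i < n" "\<And>k. k < n \<Longrightarrow> v k j \<in> H" for t v i j
  proof -
    have "left_mult n (X t) v i j = (\<Sum>k<n. (if i = k then v k j else 0) + t *\<^sub>R A i k (v k j))"
      unfolding left_mult_def X_def using that by (intro sum.cong refl) (simp add: proj_ident[OF SH])
    then show ?thesis using that by (simp add: sum.distrib left_mult_def scaleR_sum_right)
  qed
  define b where "b = mat_inner n w (right_mult n A u) + mat_inner n w (left_mult n A u)"
  define c where "c = mat_inner n w (left_mult n A (right_mult n A u))"
  have "mat_inner n w (left_mult n (X t) (right_mult n (X t) u)) = t * b + t\<^sup>2 * c" for t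
  proof -
    have "left_mult n (X t) (right_mult n (X t) u) i j =
        u i j + t *\<^sub>R right_mult n A u i j + t *\<^sub>R left_mult n A u i j + t\<^sup>2 *\<^sub>R left_mult n A (right_mult n A u) i j"
      if ij: "i < n" "j < n" for i j
    proof -
      have "left_mult n A (right_mult n (X t) u) i j = (\<Sum>k<n. A i k (u k j) + t *\<^sub>R A i k (right_mult n A u k j))"
        unfolding left_mult_def using ij by (intro sum.cong refl) (simp add: R M_lin AM)
      also have "\<dots> = left_mult n A u i j + t *\<^sub>R left_mult n A (right_mult n A u) i j"
        by (simp add: left_mult_def sum.distrib scaleR_sum_right)
      finally have 1: "left_mult n A (right_mult n (X t) u) i j = \<dots>" .
      have "left_mult n (X t) (right_mult n (X t) u) i j =
          right_mult n (X t) u i j + t *\<^sub>R left_mult n A (right_mult n (X t) u) i j"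
        using ij h(1) RH by (intro L) (simp_all add: R csubspaceD[OF H])
      then show ?thesis unfolding 1 R[OF ij] by (simp add: algebra_simps power2_eq_square)
    qed
    then have "mat_inner n w (left_mult n (X t) (right_mult n (X t) u)) =
        (\<Sum>i<n. \<Sum>j<n. w i j \<bullet> u i j + t * (w i j \<bullet> right_mult n A u i j) + t * (w i j \<bullet> left_mult n A u i j)
          + t\<^sup>2 * (w i j \<bullet> left_mult n A (right_mult n A u) i j))"
      unfolding mat_inner_def by (intro sum.cong refl) (simp add: inner_add_right)
    also have "\<dots> = mat_inner n w u + t * b + t\<^sup>2 * c"
      unfolding b_def c_def mat_inner_def by (simp add: sum.distrib sum_distrib_left distrib_left)
    finally show ?thesis using orth by simp
  qed
  then have "b = 0" using pos[OF XM] by (intro nonneg_quadratic_imp_zero[of b c]) simp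
  \<comment> \<open>For hermitian \<open>w\<close> and \<open>u\<close> the left and right
    first-order terms agree, so each of them is half of \<open>b\<close>.\<close>
  moreover have "mat_inner n w (left_mult n A u) = mat_inner n w (right_mult n A u)"
  proof -
    have "mat_inner n w (right_mult n A u) = (\<Sum>i<n. \<Sum>j<n. w j i \<bullet> left_mult n A u j i)"
      unfolding mat_inner_def
      by (intro sum.cong refl) (simp add: right_mult_hermitian h(2) h(3) flip: J_inner)
    also have "\<dots> = mat_inner n w (left_mult n A u)" unfolding mat_inner_def by (rule sum.swap)
    finally show ?thesis by simp
  qed
  ultimately show ?thesis unfolding b_def by simp
qed

text \<open>
  Let \<open>u\<close> be the point of \<open>C\<close> closest to \<open>\<xi>\<close> and \<open>w = u - \<xi>\<close>. Then \<open>w\<close> is orthogonal to \<open>u\<close> and again in the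
  matrix cone, and the perturbation argument shows that the columns of \<open>u\<close> are orthogonal to the \<open>M'\<close>-module
  generated by the columns of \<open>w\<close>. Hence a projection \<open>X\<close> with entries in \<open>M\<close> satisfies \<open>Xu = 0\<close> and \<open>Xw = w\<close>,
  so \<open>XJXJ\<xi> = - w\<close> is in the matrix cone too, which is pointed.
\<close>
lemma matrix_cone_subset:
  fixes C :: "(nat \<Rightarrow> nat \<Rightarrow> 'a) set"
  assumes zero: "(\<lambda>i j. 0) \<in> C"
    and add: "\<And>u v. u \<in> C \<Longrightarrow> v \<in> C \<Longrightarrow> (\<lambda>i j. u i j + v i j) \<in> C"
    and scale: "\<And>t u. 0 \<le> t \<Longrightarrow> u \<in> C \<Longrightarrow> (\<lambda>i j. t *\<^sub>R u i j) \<in> C"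
    and cl: "\<And>f l. (\<And>k. f k \<in> C) \<Longrightarrow> (\<And>i j. i < n \<Longrightarrow> j < n \<Longrightarrow> (\<lambda>k. f k i j) \<longlonglongrightarrow> l i j) \<Longrightarrow> l \<in> C"
    and CH: "\<And>u i j. u \<in> C \<Longrightarrow> i < n \<Longrightarrow> j < n \<Longrightarrow> u i j \<in> H"
    and herm: "\<And>u i j. u \<in> C \<Longrightarrow> i < n \<Longrightarrow> j < n \<Longrightarrow> J (u i j) = u j i"
    and gen: "\<And>x \<eta>. x \<in> vectors n \<Longrightarrow> \<eta> \<in> P \<Longrightarrow> col_matrix x \<eta> \<in> C"
    and inv: "\<And>X u. X \<in> matrices n \<Longrightarrow> u \<in> C \<Longrightarrow> left_mult n X (right_mult n X u) \<in> C"
    and xi: "\<xi> \<in> MC n"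
  shows "\<xi> \<in> C"
proof -
  \<comment> \<open>The closest-point argument takes families with one index, so matrices are
    flattened to functions of pairs.\<close>
  define C' where "C' = {v. (\<lambda>i j. v (i, j)) \<in> C}"
  have pair: "(\<Sum>k\<in>{..<n}\<times>{..<n}. f k) = (\<Sum>i<n. \<Sum>j<n. f (i, j))" for f :: "nat \<times> nat \<Rightarrow> real"
    by (simp add: sum.cartesian_product case_prod_beta)
  have "\<exists>u\<in>C. (\<forall>c\<in>C. mat_inner n (\<lambda>i j. u i j - \<xi> i j) c \<ge> 0) \<and> mat_inner n (\<lambda>i j. u i j - \<xi> i j) u = 0"
  proof (rule closest_point_cone_family[of "{..<n}\<times>{..<n}" C' "\<lambda>(i, j). \<xi> i j"])
    show "(\<lambda>i. 0) \<in> C'" unfolding C'_def using zero by simp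
    show "(\<lambda>i. u i + v i) \<in> C'" if "u \<in> C'" "v \<in> C'" for u v
      using add that unfolding C'_def by simp
    show "(\<lambda>i. t *\<^sub>R u i) \<in> C'" if "0 \<le> t" "u \<in> C'" for t u
      using scale that unfolding C'_def by simp
    show "l \<in> C'" if "\<And>k. f k \<in> C'" "\<And>i. i \<in> {..<n}\<times>{..<n} \<Longrightarrow> (\<lambda>k. f k i) \<longlonglongrightarrow> l i" for f l
    proof -
      have "(\<lambda>i j. l (i, j)) \<in> C"
        by (rule cl[of "\<lambda>k i j. f k (i, j)"]) (use that in \<open>auto simp: C'_def\<close>)
      then show ?thesis unfolding C'_def by simp
    qed
    fix u assume u: "u \<in> C'"
      "\<And>c. c \<in> C' \<Longrightarrow> (\<Sum>k\<in>{..<n}\<times>{..<n}. (u k - (case k of (i, j) \<Rightarrow> \<xi> i j)) \<bullet> c k) \<ge> 0"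
      "(\<Sum>k\<in>{..<n}\<times>{..<n}. (u k - (case k of (i, j) \<Rightarrow> \<xi> i j)) \<bullet> u k) = 0"
    show ?thesis
    proof (intro bexI[of _ "\<lambda>i j. u (i, j)"] conjI ballI)
      show "(\<lambda>i j. u (i, j)) \<in> C" using u(1) unfolding C'_def by simp
      show "mat_inner n (\<lambda>i j. u (i, j) - \<xi> i j) (\<lambda>i j. u (i, j)) = 0"
        using u(3) unfolding pair mat_inner_def by simp
      show "mat_inner n (\<lambda>i j. u (i, j) - \<xi> i j) c \<ge> 0" if "c \<in> C" for c
        using u(2)[of "\<lambda>(i, j). c i j"] that unfolding C'_def pair mat_inner_def by simp
    qed
  qed simp
  then obtain u where u: "u \<in> C" "\<And>c. c \<in> C \<Longrightarrow> mat_inner n (\<lambda>i j. u i j - \<xi> i j) c \<ge> 0"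
    "mat_inner n (\<lambda>i j. u i j - \<xi> i j) u = 0" by blast
  define w where "w i j = u i j - \<xi> i j" for i j
  note u = u[folded w_def]
  note uH = CH[OF u(1)] and uherm = herm[OF u(1)] and xherm = MC_hermitian[OF xi] and xH = MC_D(1)[OF xi]
  have wH: "w i j \<in> H" if "i < n" "j < n" for i j
    unfolding w_def using uH[OF that] xH[OF that] by (rule csubspaceD(6)[OF H])
  have wherm: "J (w i j) = w j i" if "i < n" "j < n" for i j
    unfolding w_def using uherm[OF that] xherm[OF that] by (simp add: J_simps)
  \<comment> \<open>Pairing with \<open>w\<close> is nonnegative on \<open>C\<close>, in particular
    on the generators, which is the dual description of the cone.\<close>
  have w: "w \<in> MC n"
    by (rule MC_I[OF wH wherm]) (use u(2)[OF gen] in \<open>simp_all add: mat_inner_def\<close>)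
  have A0: "mat_inner n w (right_mult n A u) = 0" if "A \<in> matrices n" for A
    using mat_inner_perturbation_zero[OF uH uherm wherm u(2)[OF inv[OF _ u(1)]] u(3) that] by simp
  have orth: "(\<Sum>i<n. J (a (J (u i k))) \<bullet> w i j) = 0" if a: "a \<in> M" and kj: "k < n" "j < n" for a k j
  proof -
    \<comment> \<open>The only possibly nonzero entry is \<open>a\<close> in position
      \<open>(j, k)\<close>, so \<open>right_mult n A u\<close> has only column \<open>j\<close>,
      namely \<open>JaJ\<close> applied to column \<open>k\<close> of \<open>u\<close>. As
      \<open>a\<close> varies, \<open>JaJ\<close> runs through \<open>M'\<close>.\<close>
    define A where "A j' l = (\<lambda>v. if j' = j \<and> l = k then a v else 0)" for j' l
    have "(if b then a else (\<lambda>v. 0)) \<in> M" for b using a M_closed(4) by (cases b) auto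
    moreover have "A j' l = (if j' = j \<and> l = k then a else (\<lambda>v. 0))" for j' l by (auto simp: A_def fun_eq_iff)
    ultimately have "A j' l \<in> M" for j' l by metis
    then have "A \<in> matrices n" by simp
    from A0[OF this] have "(\<Sum>i<n. \<Sum>j'<n. w i j' \<bullet> right_mult n A u i j') = 0" unfolding mat_inner_def .
    moreover have "(\<Sum>j'<n. w i j' \<bullet> right_mult n A u i j') = J (a (J (u i k))) \<bullet> w i j" for i
    proof -
      have "right_mult n A u i j' = (if j' = j then J (a (J (u i k))) else 0)" for j'
      proof -
        have "right_mult n A u i j' = (\<Sum>l<n. if l = k then (if j' = j then J (a (J (u i l))) else 0) else 0)"
          unfolding right_mult_def A_def by (intro sum.cong refl) (simp add: J_simps)
        then show ?thesis using kj by simp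
      qed
      then have "(\<Sum>j'<n. w i j' \<bullet> right_mult n A u i j') = (\<Sum>j'<n. if j' = j then w i j' \<bullet> J (a (J (u i k))) else 0)"
        by (intro sum.cong refl) simp
      then show ?thesis using kj by (simp add: inner_commute)
    qed
    ultimately show ?thesis by simp
  qed
  \<comment> \<open>The columns whose orbit under \<open>M'\<close> is orthogonal to the columns of
    \<open>w\<close>. This closed submodule contains the columns of \<open>u\<close>; since
    \<open>M'\<close> has the unit \<open>proj H\<close>, it is orthogonal to the columns of
    \<open>w\<close>.\<close>
  define Z where "Z = {z. (\<forall>i<n. z i \<in> H) \<and> (\<forall>y\<in>M'. \<forall>j<n. (\<Sum>i<n. y (z i) \<bullet> w i j) = 0)}"
  have M'_lin: "clinop y" if "y \<in> M'" for y using M'_op(1)[OF that] .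
  have ZI: "z \<in> Z" if "\<And>i. i < n \<Longrightarrow> z i \<in> H" "\<And>y j. y \<in> M' \<Longrightarrow> j < n \<Longrightarrow> (\<Sum>i<n. y (z i) \<bullet> w i j) = 0" for z
    using that unfolding Z_def by simp
  have ZD: "z i \<in> H" if "z \<in> Z" "i < n" for z i using that unfolding Z_def by simp
  have ZD': "(\<Sum>i<n. y (z i) \<bullet> w i j) = 0" if "z \<in> Z" "y \<in> M'" "j < n" for z y j
    using that unfolding Z_def by simp
  have uZ: "(\<lambda>i. u i k) \<in> Z" if k: "k < n" for k
  proof (rule ZI)
    fix y j assume y: "y \<in> M'" and j: "j < n"
    obtain x where "x \<in> M" "y = (\<lambda>v. J (x (J v)))" by (rule commutant_cases[OF y])
    then show "(\<Sum>i<n. y (u i k) \<bullet> w i j) = 0" using orth[OF _ k j] by simp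
  qed (use uH k in simp)
  obtain G where G: "G \<in> matrices n" "\<And>z i. z \<in> Z \<Longrightarrow> i < n \<Longrightarrow> (\<Sum>k<n. G i k (z k)) = z i"
    "\<And>a i. i < n \<Longrightarrow> \<forall>z\<in>Z. (\<Sum>i<n. a i \<bullet> z i) = 0 \<Longrightarrow> (\<Sum>k<n. G i k (a k)) = 0"
  proof (rule column_projection[of Z n])
    show "(\<lambda>i. 0) \<in> Z" by (rule ZI) (simp_all add: csubspaceD[OF H] clinopD[OF M'_lin])
    show "(\<lambda>i. u i + v i) \<in> Z" if "u \<in> Z" "v \<in> Z" for u v
      by (rule ZI) (simp_all add: csubspaceD[OF H] ZD that clinopD[OF M'_lin] inner_add_left sum.distrib ZD')
    show "(\<lambda>i. y (u i)) \<in> Z" if y: "y \<in> M'" and u: "u \<in> Z" for y u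
      using ZD'[OF u vna_closed(1)[OF vna' _ y]] by (intro ZI) (simp_all add: M'_op(2)[OF y])
    show "(\<lambda>i. c *\<^sub>C u i) \<in> Z" if u: "u \<in> Z" for c u
    proof (rule ZI)
      fix y j assume y: "y \<in> M'" and j: "j < n"
      show "(\<Sum>i<n. y (c *\<^sub>C u i) \<bullet> w i j) = 0"
        using ZD'[OF u vna_closed(3)[OF vna' y] j, of c] by (simp add: clinopD[OF M'_lin[OF y]])
    qed (simp add: csubspaceD[OF H] ZD u)
    show "l \<in> Z" if f: "\<And>k. f k \<in> Z" and l: "\<And>i. i < n \<Longrightarrow> (\<lambda>k. f k i) \<longlonglongrightarrow> l i" for f l
    proof (rule ZI)
      show "l i \<in> H" if "i < n" for i
        using closed_sequentially[OF SH(2) ZD[OF f that] l[OF that]] .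
      fix y j assume y: "y \<in> M'" and j: "j < n"
      have "(\<lambda>k. \<Sum>i<n. y (f k i) \<bullet> w i j) \<longlonglongrightarrow> (\<Sum>i<n. y (l i) \<bullet> w i j)"
        by (rule tendsto_sum, rule tendsto_inner, rule bounded_linear.tendsto[OF clinopD(1)[OF M'_lin[OF y]]])
          (simp_all add: l)
      then show "(\<Sum>i<n. y (l i) \<bullet> w i j) = 0"
        by (simp add: ZD'[OF f y j] LIMSEQ_const_iff)
    qed
    show "u i \<in> H" if "u \<in> Z" "i < n" for u i using that by (rule ZD)
    fix G assume "G \<in> matrices n" "\<And>z i. z \<in> Z \<Longrightarrow> i < n \<Longrightarrow> (\<Sum>k<n. G i k (z k)) = z i"
      "\<And>a i. i < n \<Longrightarrow> \<forall>z\<in>Z. (\<Sum>i<n. a i \<bullet> z i) = 0 \<Longrightarrow> (\<Sum>k<n. G i k (a k)) = 0"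
    then show thesis by (rule that)
  qed
  have Gu: "(\<Sum>k<n. G i k (u k j)) = u i j" if "i < n" "j < n" for i j
    using G(2)[OF uZ[OF that(2)] that(1)] .
  have Gw: "(\<Sum>k<n. G i k (w k j)) = 0" if "i < n" "j < n" for i j
  proof (rule G(3)[OF that(1)], rule ballI)
    fix z assume z: "z \<in> Z"
    have "(\<Sum>i<n. proj H (z i) \<bullet> w i j) = 0" by (rule ZD'[OF z vna_closed(5)[OF vna'] that(2)])
    then show "(\<Sum>i<n. w i j \<bullet> z i) = 0"
      using ZD[OF z] by (simp add: inner_commute proj_ident[OF SH])
  qed
  \<comment> \<open>\<open>X = 1 - G\<close> is the projection onto the orthogonal complement of
    \<open>Z\<close>; the unit is \<open>proj H\<close> on the diagonal.\<close>
  define X where "X i k = (\<lambda>v. (if i = k then proj H v else 0) + (- 1) *\<^sub>C G i k v)" for i k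
  have X: "X \<in> matrices n"
  proof -
    have "X i k \<in> M" if "i < n" "k < n" for i k
    proof -
      have "(\<lambda>v. (if i = k then proj H v else 0)) \<in> M" using M_closed(4,5) by (cases "i = k") simp_all
      moreover have "G i k \<in> M" using G(1) that by blast
      ultimately show ?thesis unfolding X_def using M_closed(2)[OF _ M_closed(3)[of "G i k" "-1"]] by blast
    qed
    then show ?thesis by simp
  qed
  have left: "left_mult n X v i j = v i j - (\<Sum>k<n. G i k (v k j))" if "i < n" "\<And>k. k < n \<Longrightarrow> v k j \<in> H" for v i j
  proof -
    have "left_mult n X v i j = (\<Sum>k<n. (if i = k then v k j else 0) - G i k (v k j))"
      unfolding left_mult_def X_def using that
      by (intro sum.cong refl) (simp add: proj_ident[OF SH] scaleC_minus_left scaleC_one)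
    then show ?thesis using that by (simp add: sum_subtractf)
  qed
  have Lw: "left_mult n X w i j = w i j" and Lu: "left_mult n X u i j = 0" if "i < n" "j < n" for i j
    using left[of i w j] left[of i u j] that by (simp_all add: Gw Gu wH uH)
  have Rx: "right_mult n X \<xi> i j = - w i j" if ij: "i < n" "j < n" for i j
  proof -
    have "left_mult n X \<xi> j i = left_mult n X u j i - left_mult n X w j i"
      unfolding left_mult_def sum_subtractf[symmetric] w_def using X ij
      by (intro sum.cong refl) (simp flip: M_lin(6))
    then show ?thesis using ij by (simp add: right_mult_hermitian xherm Lw Lu J_simps wherm)
  qed
  have "left_mult n X (right_mult n X \<xi>) i j = - w i j" if ij: "i < n" "j < n" for i j
  proof -
    have "left_mult n X (right_mult n X \<xi>) i j = - left_mult n X w i j"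
      unfolding left_mult_def sum_negf[symmetric] using X ij
      by (intro sum.cong refl) (simp add: Rx M_lin)
    then show ?thesis by (simp add: Lw ij)
  qed
  then have mw: "(\<lambda>i j. - w i j) \<in> MC n"
    using MC_mult[OF X xi] by (rule MC_cong[rotated])
  have "w i j = 0" if "i < n" "j < n" for i j
  proof (rule row_form_eq_0_imp[OF wH _ that])
    fix x assume x: "x \<in> vectors n"
    show "row_form n x w = 0"
      using MC_D(2)[OF w x] MC_D(2)[OF mw x] unfolding row_form_linear(4)[OF x] by (rule P_pointed)
  qed
  then have eq: "u i j = \<xi> i j" if "i < n" "j < n" for i j using that unfolding w_def by simp
  \<comment> \<open>The constant sequence \<open>u\<close> converges to \<open>\<xi>\<close> in the
    entries below \<open>n\<close>, so \<open>cl\<close> absorbs any difference elsewhere.\<close>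
  show ?thesis by (rule cl[of "\<lambda>k. u"]) (simp_all add: u(1) eq)
qed

end

section \<open>Compression of completely positive operators\<close>

context std_form_projection
begin

sublocale corner: std_form "compression q M" "range q" "q \<circ> J" "q ` P"
  by unfold_locales (rule corner_standard_form)

text \<open>\<open>b\<close> is the preimage of \<open>x\<close> under the isomorphism from
  \<open>pMp\<close> to \<open>qMq\<close>. Matrix cones of \<open>M\<close> accept only entries
  from \<open>M\<close>, hence lifts in place of elements of the corner.\<close>

definition lifts :: "('a \<Rightarrow> 'a) \<Rightarrow> ('a \<Rightarrow> 'a) \<Rightarrow> bool" where
  "lifts x b \<longleftrightarrow> b \<in> compression p M \<and> x = b \<circ> q"

lemma liftsD:
  assumes "lifts x b"
  shows "b \<in> M" "x (q v) = b (q v)" "q (J (x (q (J (q v))))) = J (b (J (q v)))"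
    "p (b v) = b v" "b (p v) = b v" "q (b (q v)) = b (q v)"
  using assms unfolding lifts_def by (auto simp: compression_p_M q_simps(2) q_J q_commute)

lemma lifts_family:
  assumes "\<And>i. i \<in> I \<Longrightarrow> x i \<in> compression q M"
  obtains b where "\<forall>i\<in>I. lifts (x i) (b i)"
proof -
  have "\<forall>i\<in>I. \<exists>b. lifts (x i) b" using assms unfolding compression_q_eq[symmetric] lifts_def by blast
  from bchoice[OF this] that show ?thesis by blast
qed

text \<open>Minimality in the corner is applied to the set \<open>C\<close> of those matrices of the
  large cone whose entries are fixed by \<open>q\<close>. On such entries the generators and
  conjugations of the corner coincide with those formed from lifts in \<open>M\<close>, under which
  the large cone is stable.\<close>

lemma corner_matrix_cone_subset:
  assumes xi: "\<xi> \<in> corner.MC n"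
  shows "\<xi> \<in> MC n"
proof -
  define C where "C = {\<xi> \<in> MC n. \<forall>i<n. \<forall>j<n. q (\<xi> i j) = \<xi> i j}"
  have CI: "\<xi> \<in> C" if "\<xi> \<in> MC n" "\<And>i j. i < n \<Longrightarrow> j < n \<Longrightarrow> q (\<xi> i j) = \<xi> i j" for \<xi>
    using that unfolding C_def by simp
  have CD: "\<xi> \<in> MC n" "i < n \<Longrightarrow> j < n \<Longrightarrow> q (\<xi> i j) = \<xi> i j" if "\<xi> \<in> C" for \<xi> i j
    using that unfolding C_def by simp_all
  have "\<xi> \<in> C"
  proof (rule corner.matrix_cone_subset[OF _ _ _ _ _ _ _ _ xi])
    show "(\<lambda>i j. 0) \<in> C" by (rule CI) (simp_all add: MC_convex_cone q_simps)
    show "(\<lambda>i j. u i j + v i j) \<in> C" if "u \<in> C" "v \<in> C" for u v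
      by (rule CI) (simp_all add: MC_convex_cone(2) CD that q_simps)
    show "(\<lambda>i j. t *\<^sub>R u i j) \<in> C" if "0 \<le> t" "u \<in> C" for t u
      by (rule CI) (simp_all add: MC_convex_cone(3) CD that q_simps)
    show "l \<in> C" if f: "\<And>k. f k \<in> C" and l: "\<And>i j. i < n \<Longrightarrow> j < n \<Longrightarrow> (\<lambda>k. f k i j) \<longlonglongrightarrow> l i j" for f l
    proof (rule CI)
      show "l \<in> MC n" by (rule MC_closed[of f]) (simp_all add: CD f l)
      show "q (l i j) = l i j" if ij: "i < n" "j < n" for i j
      proof (rule LIMSEQ_unique[OF _ l[OF ij]])
        show "(\<lambda>k. f k i j) \<longlonglongrightarrow> q (l i j)"
          using bounded_linear.tendsto[OF q_simps(5) l[OF ij]] by (simp add: CD(2)[OF f ij])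
      qed
    qed
    show "u i j \<in> range q" if "u \<in> C" "i < n" "j < n" for u i j
      using CD(2)[OF that] by (metis rangeI)
    show "(q \<circ> J) (u i j) = u j i" if "u \<in> C" "i < n" "j < n" for u i j
      using MC_hermitian[OF CD(1)[OF that(1)] that(2,3)] CD(2)[OF that(1,3,2)] by simp
    show "corner.col_matrix x \<eta> \<in> C" if x: "x \<in> corner.vectors n" and eta: "\<eta> \<in> q ` P" for x \<eta>
    proof -
      obtain b where "\<forall>i\<in>{..<n}. lifts (x i) (b i)" by (rule lifts_family[of "{..<n}" x]) (use x in auto)
       then have lb: "lifts (x i) (b i)" if "i \<in> {..<n}" for i using that by blast
       note b = liftsD[OF lb]
      obtain \<zeta> where z: "\<eta> = q \<zeta>" using eta by blast
      have eta: "\<eta> \<in> P" "q \<eta> = \<eta>" using eta P_q(1) z q_simps(2) by auto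
      have eq: "col_matrix b \<eta> i j = corner.col_matrix x \<eta> i j" if ij: "i < n" "j < n" for i j
      proof -
        have 1: "J (b j (J \<eta>)) = q (J (x j (q (J \<eta>))))"
          using b(3)[of j \<eta>] ij eta(2) by simp
        show ?thesis unfolding col_matrix_def corner.col_matrix_def 1 using b(2) ij by simp
      qed
      show ?thesis
      proof (rule CI)
        show "corner.col_matrix x \<eta> \<in> MC n" by (rule MC_cong[OF MC_col_matrix[of b] eq]) (use b(1) eta in auto)
        show "q (corner.col_matrix x \<eta> i j) = corner.col_matrix x \<eta> i j" if ij: "i < n" "j < n" for i j
          unfolding corner.col_matrix_def using b(2,6) ij by simp
      qed
    qed
    show "corner.left_mult n X (corner.right_mult n X u) \<in> C" if X: "X \<in> corner.matrices n" and u: "u \<in> C" for X u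
    proof -
      define I where "I = {..<n} \<times> {..<n}"
      have X': "(case k of (i, j) \<Rightarrow> X i j) \<in> compression q M" if "k \<in> I" for k
        using X that unfolding I_def by auto
      obtain b where b: "\<forall>k\<in>I. lifts (case k of (i, j) \<Rightarrow> X i j) (b k)"
        by (rule lifts_family[of I "\<lambda>k. case k of (i, j) \<Rightarrow> X i j"]) (use X' in auto)
      have lb: "lifts (X i k) (b (i, k))" if "i < n" "k < n" for i k using b that unfolding I_def by auto
      note b1 = liftsD(1)[OF lb] and b2 = liftsD(2)[OF lb] and b3 = liftsD(3)[OF lb] and b6 = liftsD(6)[OF lb]
      define Y where "Y i k = b (i, k)" for i k
      have Y: "Y \<in> matrices n" using b1 unfolding Y_def by simp
      have r: "corner.right_mult n X u i j = right_mult n Y u i j" if "i < n" "j < n" for i j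
        unfolding corner.right_mult_def right_mult_def Y_def
      proof (intro sum.cong refl)
        fix l assume "l \<in> {..<n}"
        then show "(q \<circ> J) (X j l ((q \<circ> J) (u i l))) = J (b (j, l) (J (u i l)))"
          using b3[of j l "u i l"] CD(2)[OF u, of i l] that by simp
      qed
      have qr: "q (right_mult n Y u i j) = right_mult n Y u i j" if "i < n" "j < n" for i j
        unfolding r[OF that, symmetric] by (simp add: corner.right_mult_def clinop_sum[OF q_simps(1)] q_simps(2))
      have l: "left_mult n Y (right_mult n Y u) i j = corner.left_mult n X (corner.right_mult n X u) i j"
        if ij: "i < n" "j < n" for i j
        unfolding corner.left_mult_def left_mult_def Y_def[of i]
      proof (intro sum.cong refl)
        fix k assume k: "k \<in> {..<n}"
        then show "b (i, k) (right_mult n Y u k j) = X i k (corner.right_mult n X u k j)"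
          using b2[of i k "right_mult n Y u k j"] ij by (simp add: r qr)
      qed
      show ?thesis
      proof (rule CI)
        show "corner.left_mult n X (corner.right_mult n X u) \<in> MC n"
          by (rule MC_cong[OF MC_mult[OF Y CD(1)[OF u]] l])
        show "q (corner.left_mult n X (corner.right_mult n X u) i j) = corner.left_mult n X (corner.right_mult n X u) i j"
          if ij: "i < n" "j < n" for i j
        proof -
          have "q (Y i k (right_mult n Y u k j)) = Y i k (right_mult n Y u k j)" if "k < n" for k
            using b6[of i k "right_mult n Y u k j"] ij that by (simp add: qr Y_def)
          then have "q (left_mult n Y (right_mult n Y u) i j) = left_mult n Y (right_mult n Y u) i j"
            unfolding left_mult_def clinop_sum[OF q_simps(1)] by (intro sum.cong) (simp_all only: lessThan_iff)
          then show ?thesis unfolding l[OF ij] .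
        qed
      qed
    qed
  qed
  then show ?thesis by (rule CD(1))
qed

text \<open>Lifts satisfy \<open>b = p b = b p\<close>, so all compressions by \<open>q\<close> are
  absorbed: a row form of the compressed matrix in the corner is a row form of \<open>\<xi>\<close>
  itself, with lifted entries.\<close>

lemma corner_matrix_cone_superset:
  assumes xi: "\<xi> \<in> MC n"
  shows "(\<lambda>i j. q (\<xi> i j)) \<in> corner.MC n"
  unfolding corner.MC_iff
proof (intro conjI allI impI ballI)
  fix x assume x: "x \<in> corner.vectors n"
  obtain b where "\<forall>i\<in>{..<n}. lifts (x i) (b i)" by (rule lifts_family[of "{..<n}" x]) (use x in auto)
  then have lb: "lifts (x i) (b i)" if "i \<in> {..<n}" for i using that by blast
  note b = liftsD[OF lb]
  have "corner.row_form n x (\<lambda>i j. q (\<xi> i j)) = row_form n b \<xi>"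
    unfolding corner.row_form_def row_form_def
  proof (intro sum.cong refl)
    fix i j assume ij: "i \<in> {..<n}" "j \<in> {..<n}"
    have e: "e (b j v) = b j (e v)" for v using e_commute[OF b(1)[OF ij(2)]] by simp
    \<comment> \<open>\<open>J (b j) J\<close> lies in \<open>M'\<close> and commutes with
      \<open>p\<close>; from \<open>p b = b = b p\<close> it also absorbs \<open>e\<close> on both
      sides. Hence it commutes with \<open>q\<close>.\<close>
    have 1: "J (b j (J (q v))) = q (J (b j (J v)))" for v
    proof -
      have "J (b j (J (q v))) = J (b j (p (J (p v))))" by (simp add: q_eq(2) e_def J_simps M_D b(1) p_simps ij)
      also have "\<dots> = p (J (b j (J v)))"
        using J_commute[OF pM b(1)[OF ij(2)], of v] by (simp add: b(5)[OF ij(2)])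
      also have "\<dots> = p (J (p (b j (J v))))" by (simp add: b(4)[OF ij(2)])
      also have "\<dots> = q (J (b j (J v)))" by (simp add: q_eq(1) e_def J_simps M_D b(1)[OF ij(2)])
      finally show ?thesis .
    qed
    have "x i ((q \<circ> J) (x j ((q \<circ> J) (q (\<xi> i j))))) = b i (q (J (b j (J (\<xi> i j)))))"
      using b(3)[OF ij(2), of "\<xi> i j"] b(2)[OF ij(1)] by (simp add: 1)
    \<comment> \<open>\<open>b i\<close> absorbs \<open>p\<close>, and \<open>e\<close> fixes the
      range of \<open>J (b j) J\<close>; so \<open>q = p e\<close> disappears between them.\<close>
    also have "\<dots> = b i (J (b j (J (\<xi> i j))))"
    proof -
      have "b i (q w) = b i (e w)" for w using b(5)[OF ij(1), of "e w"] by (simp add: q_eq(1))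
      moreover have "e (J (b j (J v))) = J (b j (J v))" for v
        by (simp add: e_def J_simps M_D b(1)[OF ij(2)] b(4)[OF ij(2)])
      ultimately show ?thesis by simp
    qed
    finally show "x i ((q \<circ> J) (x j ((q \<circ> J) (q (\<xi> i j))))) = b i (J (b j (J (\<xi> i j))))" .
  qed
  moreover have "row_form n b \<xi> \<in> P" using MC_D(2)[OF xi] b(1) by simp
  moreover have "q (corner.row_form n x (\<lambda>i j. q (\<xi> i j))) = corner.row_form n x (\<lambda>i j. q (\<xi> i j))"
    unfolding corner.row_form_def clinop_sum[OF q_simps(1)]
    using x by (intro sum.cong refl) (auto simp: compression_def q_simps(2))
  ultimately show "corner.row_form n x (\<lambda>i j. q (\<xi> i j)) \<in> q ` P" unfolding P_q(1) by (metis IntI rangeI)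
qed simp

lemma bounded_ops_compress:
  assumes "T \<in> bounded_ops H"
  shows "q \<circ> T \<circ> q \<in> bounded_ops (range q)"
proof -
  have "clinop (\<lambda>x. q (T (q x)))"
    using clinop_compose[OF q_simps(1) clinop_compose[OF bounded_opsD(1)[OF H assms] q_simps(1)]] .
  then show ?thesis unfolding bounded_ops_range_iff[OF q_oproj] by (simp add: comp_def q_simps(2))
qed

text \<open>A matrix in the cone of the corner is viewed in the cone of \<open>M\<close>, mapped by
  \<open>T\<close>, and compressed back. Its entries are fixed by \<open>q\<close>, so this is the
  action of \<open>qTq\<close>.\<close>

lemma ccp_operator_compress:
  assumes "ccp_operator M H J P T"
  shows "ccp_operator (compression q M) (range q) (q \<circ> J) (q ` P) (q \<circ> T \<circ> q)"
  unfolding ccp_operator_def cp_operator_def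
proof (intro conjI allI impI ballI)
  have T: "T \<in> bounded_ops H" and cp: "\<And>n \<xi>. n \<ge> 1 \<Longrightarrow> \<xi> \<in> MC n \<Longrightarrow> (\<lambda>i j. T (\<xi> i j)) \<in> MC n"
    and n: "onorm T \<le> 1"
    using assms unfolding ccp_operator_def cp_operator_def by auto
  show "q \<circ> T \<circ> q \<in> bounded_ops (range q)" by (rule bounded_ops_compress[OF T])
  show "(\<lambda>i j. (q \<circ> T \<circ> q) (\<xi> i j)) \<in> corner.MC n" if "1 \<le> n" "\<xi> \<in> corner.MC n" for n \<xi>
  proof (rule corner.MC_cong[OF corner_matrix_cone_superset[OF cp[OF that(1) corner_matrix_cone_subset[OF that(2)]]]])
    show "q (T (\<xi> i j)) = (q \<circ> T \<circ> q) (\<xi> i j)" if "i < n" "j < n" for i j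
      using corner.MC_D(1)[OF \<open>\<xi> \<in> corner.MC n\<close> that] by (auto simp: q_simps(2))
  qed
  have bT: "bounded_linear T" using clinopD(1)[OF bounded_opsD(1)[OF H T]] .
  show "onorm (q \<circ> T \<circ> q) \<le> 1"
  proof (rule onorm_bound)
    show "norm ((q \<circ> T \<circ> q) x) \<le> 1 * norm x" for x
    proof -
      have "norm (q (T (q x))) \<le> norm (T (q x))" by (rule norm_oproj_le[OF q_oproj])
      also have "\<dots> \<le> onorm T * norm (q x)" by (rule onorm[OF bT])
      also have "\<dots> \<le> 1 * norm (q x)" using n by (rule mult_right_mono) simp
      also have "\<dots> \<le> 1 * norm x" using norm_oproj_le[OF q_oproj] by simp
      finally show ?thesis by simp
    qed
  qed simp
qed

text \<open>As \<open>q\<close> is contractive, the image of the unit ball of the corner stays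
  inside \<open>q\<close> applied to the compact set that belongs to \<open>T\<close>.\<close>

lemma compact_operator_compress:
  assumes "compact_operator H T"
  shows "compact_operator (range q) (q \<circ> T \<circ> q)"
  unfolding compact_operator_def
proof
  have T: "T \<in> bounded_ops H" and c: "compact (closure (T ` (H \<inter> cball 0 1)))"
    using assms unfolding compact_operator_def by auto
  show "q \<circ> T \<circ> q \<in> bounded_ops (range q)" by (rule bounded_ops_compress[OF T])
  let ?K = "q ` closure (T ` (H \<inter> cball 0 1))"
  have K: "compact ?K"
    using c by (intro compact_continuous_image linear_continuous_on q_simps(5))
  have "(q \<circ> T \<circ> q) ` (range q \<inter> cball 0 1) \<subseteq> ?K"
  proof
    fix y assume "y \<in> (q \<circ> T \<circ> q) ` (range q \<inter> cball 0 1)"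
    then obtain v where v: "y = q (T (q v))" "norm v \<le> 1" by auto
    then have "T (q v) \<in> T ` (H \<inter> cball 0 1)"
      using q_proj(3) norm_oproj_le[OF q_oproj, of v] by (intro imageI) auto
    then have "T (q v) \<in> closure (T ` (H \<inter> cball 0 1))" using closure_subset[of "T ` (H \<inter> cball 0 1)"] by auto
    then show "y \<in> ?K" unfolding v(1) by (rule imageI)
  qed
  then have "closure ((q \<circ> T \<circ> q) ` (range q \<inter> cball 0 1)) \<subseteq> ?K"
    using compact_imp_closed[OF K] by (rule closure_minimal)
  then have "compact (?K \<inter> closure ((q \<circ> T \<circ> q) ` (range q \<inter> cball 0 1)))"
    using K closed_closure by (intro compact_Int_closed)
  then show "compact (closure ((q \<circ> T \<circ> q) ` (range q \<inter> cball 0 1)))"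
    using \<open>closure _ \<subseteq> ?K\<close> by (simp add: Int_absorb1)
qed

end

section \<open>Star-isomorphisms and transfer of the approximation property\<close>

lemma star_isomorphismD:
  assumes "star_isomorphism M N \<theta>"
  shows "bij_betw \<theta> M N" "x \<in> M \<Longrightarrow> y \<in> M \<Longrightarrow> \<theta> (\<lambda>v. x v + y v) = (\<lambda>v. \<theta> x v + \<theta> y v)"
    "x \<in> M \<Longrightarrow> \<theta> (\<lambda>v. c *\<^sub>C x v) = (\<lambda>v. c *\<^sub>C \<theta> x v)" "x \<in> M \<Longrightarrow> y \<in> M \<Longrightarrow> \<theta> (x \<circ> y) = \<theta> x \<circ> \<theta> y"
    "x \<in> M \<Longrightarrow> \<theta> (cadjoint x) = cadjoint (\<theta> x)" "x \<in> M \<Longrightarrow> \<theta> x \<in> N"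
  using assms bij_betwE unfolding star_isomorphism_def by blast+

lemma star_isomorphism_compose:
  assumes \<theta>: "star_isomorphism M N \<theta>" and \<phi>: "star_isomorphism N K \<phi>"
  shows "star_isomorphism M K (\<lambda>x. \<phi> (\<theta> x))"
  using bij_betw_trans[OF star_isomorphismD(1)[OF \<theta>] star_isomorphismD(1)[OF \<phi>]]
    star_isomorphismD(2-)[OF \<theta>] star_isomorphismD(2-)[OF \<phi>]
  unfolding star_isomorphism_def comp_def by simp

lemma star_isomorphism_inverse:
  assumes \<theta>: "star_isomorphism M N \<theta>" and M: "von_neumann_algebra H M"
  shows "star_isomorphism N M (inv_into M \<theta>)"
proof -
  note D = star_isomorphismD[OF \<theta>]
  have f: "\<theta> (inv_into M \<theta> y) = y" "inv_into M \<theta> y \<in> M" if "y \<in> N" for y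
    using bij_betw_inv_into_right[OF D(1) that] bij_betwE[OF bij_betw_inv_into[OF D(1)]] that by blast+
  have eqI: "inv_into M \<theta> y = x" if "x \<in> M" "\<theta> x = y" for x y
    using bij_betw_inv_into_left[OF D(1) that(1)] that(2) by simp
  note c = vna_closed[OF M]
  show ?thesis
    unfolding star_isomorphism_def
  proof (intro conjI ballI allI)
    show "bij_betw (inv_into M \<theta>) N M" by (rule bij_betw_inv_into[OF D(1)])
    show "inv_into M \<theta> (x \<circ> y) = inv_into M \<theta> x \<circ> inv_into M \<theta> y" if "x \<in> N" "y \<in> N" for x y
      by (rule eqI) (simp_all add: D f that c(1)[unfolded comp_def[symmetric]])
  qed (rule eqI; simp add: D f c vnaD(3)[OF M])+
qed

lemma star_isomorphism_compression:
  assumes \<theta>: "star_isomorphism M N \<theta>" and M: "von_neumann_algebra H M" and N: "von_neumann_algebra K N"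
    and p: "projection_in M p"
  shows "projection_in N (\<theta> p)" "star_isomorphism (compression p M) (compression (\<theta> p) N) \<theta>"
proof -
  note D = star_isomorphismD[OF \<theta>]
  have pM: "p \<in> M" "p \<circ> p = p" "cadjoint p = p" using p unfolding projection_in_def by auto
  show "projection_in N (\<theta> p)"
    unfolding projection_in_def using D(4)[OF pM(1) pM(1)] D(5)[OF pM(1)] D(6)[OF pM(1)] pM by simp
  have comp: "x \<circ> y \<in> M" if "x \<in> M" "y \<in> M" for x y using vna_closed(1)[OF M that] by (simp add: comp_def)
  have sub: "compression p M \<subseteq> M" using comp pM(1) unfolding compression_def by blast
  have \<theta>p: "\<theta> (p \<circ> x \<circ> p) = \<theta> p \<circ> \<theta> x \<circ> \<theta> p" if "x \<in> M" for x
    by (simp add: D(4) comp pM that)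
  have "\<theta> ` compression p M = compression (\<theta> p) N"
  proof
    show "\<theta> ` compression p M \<subseteq> compression (\<theta> p) N"
      unfolding compression_def using \<theta>p D(6) by blast
    show "compression (\<theta> p) N \<subseteq> \<theta> ` compression p M"
    proof
      fix y assume "y \<in> compression (\<theta> p) N"
      then obtain z where z: "z \<in> N" "y = \<theta> p \<circ> z \<circ> \<theta> p" unfolding compression_def by blast
      obtain x where x: "x \<in> M" "z = \<theta> x" using z(1) D(1) unfolding bij_betw_def by blast
      have "p \<circ> x \<circ> p \<in> compression p M" using x(1) unfolding compression_def by blast
      then show "y \<in> \<theta> ` compression p M" unfolding z(2) x(2) \<theta>p[OF x(1), symmetric] by (rule imageI)
    qed
  qed
  moreover have "inj_on \<theta> (compression p M)" using D(1) sub unfolding bij_betw_def by (metis inj_on_subset)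
  ultimately show "star_isomorphism (compression p M) (compression (\<theta> p) N) \<theta>"
    using D(2-5) sub unfolding star_isomorphism_def bij_betw_def by (simp add: subset_iff)
qed

lemma has_HAP_star_isomorphic:
  assumes "star_isomorphism M N \<theta>" "has_HAP TYPE('b::complex_hilbert_space) N"
  shows "has_HAP TYPE('b) M"
  using assms(2) star_isomorphism_compose[OF assms(1)] unfolding has_HAP_def by blast

text \<open>The net of compressions is the image filter under \<open>T \<mapsto> qTq\<close>. Strong
  convergence survives because \<open>q\<close> is bounded and fixes the vectors of the
  corner.\<close>

lemma has_HAP_corner:
  fixes N :: "('b::complex_hilbert_space \<Rightarrow> 'b) set"
  assumes "std_form_projection N K J P p q" and F: "F \<noteq> bot"
    "\<forall>\<^sub>F T in F. ccp_operator N K J P T \<and> compact_operator K T" "\<forall>\<xi>\<in>K. ((\<lambda>T. T \<xi>) \<longlongrightarrow> \<xi>) F"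
  shows "has_HAP TYPE('b) (compression q N)"
proof -
  interpret std_form_projection N K J P p q by fact
  define G where "G = filtermap (\<lambda>T. q \<circ> T \<circ> q) F"
  have "star_isomorphism (compression q N) (compression q N) (\<lambda>x. x)"
    unfolding star_isomorphism_def by (simp add: bij_betw_def)
  moreover have "G \<noteq> bot" unfolding G_def using F(1) by (simp add: filtermap_bot_iff)
  moreover have "\<forall>\<^sub>F T in G. ccp_operator (compression q N) (range q) (q \<circ> J) (q ` P) T \<and> compact_operator (range q) T"
    unfolding G_def eventually_filtermap using F(2)
    by (rule eventually_mono) (use ccp_operator_compress compact_operator_compress in blast)
  moreover have "((\<lambda>T. T \<xi>) \<longlongrightarrow> \<xi>) G" if "\<xi> \<in> range q" for \<xi>
  proof -
    have xi: "q \<xi> = \<xi>" using that by (auto simp: q_simps(2))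
    have "\<xi> \<in> K" using that q_proj(3) by blast
    then have "((\<lambda>T. T \<xi>) \<longlongrightarrow> \<xi>) F" using F(3) by blast
    from bounded_linear.tendsto[OF q_simps(5) this] have "((\<lambda>T. q (T (q \<xi>))) \<longlongrightarrow> \<xi>) F" unfolding xi .
    then show ?thesis unfolding G_def filterlim_filtermap by simp
  qed
  ultimately show ?thesis
    unfolding has_HAP_def using corner_standard_form by blast
qed

theorem theorem3p4:
  fixes M :: "('a::complex_hilbert_space \<Rightarrow> 'a) set"
    and H P :: "'a set"
    and J p q :: "'a \<Rightarrow> 'a"
  assumes "standard_form M H J P"
    and "projection_in M p"
    and "q = p \<circ> J \<circ> p \<circ> J"
    and "has_HAP TYPE('b::complex_hilbert_space) M"
  shows "von_neumann_algebra (q ` H) (compression q M) \<and>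
         has_HAP TYPE('b) (compression q M) \<and>
         von_neumann_algebra (p ` H) (compression p M) \<and>
         has_HAP TYPE('b) (compression p M)"
proof -
  interpret std_form_projection M H J P p q using assms(1-3) by unfold_locales
  obtain N :: "('b \<Rightarrow> 'b) set" and K J' P' \<theta> F where std: "standard_form N K J' P'" and \<theta>: "star_isomorphism M N \<theta>"
    and F: "F \<noteq> bot" "\<forall>\<^sub>F T in F. ccp_operator N K J' P' T \<and> compact_operator K T"
      "\<forall>\<xi>\<in>K. ((\<lambda>T. T \<xi>) \<longlongrightarrow> \<xi>) F"
    using assms(4) unfolding has_HAP_def by blast
  interpret N: std_form N K J' P' using std by unfold_locales
  note \<theta>p = star_isomorphism_compression[OF \<theta> vna N.vna p]
  \<comment> \<open>The standard form on \<open>N\<close> has its own conjugation, so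
    \<open>q'\<close> is built from \<open>\<theta> p\<close> and \<open>J'\<close>; in general
    \<open>q\<close> is not in \<open>M\<close> and has no image under
    \<open>\<theta>\<close>.\<close>
  define q' where "q' = \<theta> p \<circ> J' \<circ> \<theta> p \<circ> J'"
  interpret N: std_form_projection N K J' P' "\<theta> p" q' using \<theta>p(1) q'_def by unfold_locales
  have "has_HAP TYPE('b) (compression q' N)"
    by (rule has_HAP_corner[OF N.std_form_projection_axioms F])
  then have hp: "has_HAP TYPE('b) (compression p M)"
    using has_HAP_star_isomorphic[OF star_isomorphism_compose[OF \<theta>p(2) N.corner_star_isomorphism]] by blast
  note vp = von_neumann_algebra_corner[OF vna p]
  \<comment> \<open>Here the given standard form enters: inverting \<open>x \<mapsto> xq\<close>
    carries the property from \<open>pMp\<close> to \<open>qMq\<close>.\<close>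
  have "has_HAP TYPE('b) (compression q M)"
    by (rule has_HAP_star_isomorphic[OF star_isomorphism_inverse[OF corner_star_isomorphism vp] hp])
  then show ?thesis
    using corner_vna vp hp unfolding q_image projection_inD(3)[OF vna p] by blast
qed

end
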